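(* Let $n\ge1$, and let $\mathbf{q}=(q_1,\dots,q_n)$ and $\mathbf{s}=(s_{1,2},s_{1,3},\dots,s_{n-1,n})$ be vectors of non-negative integers such that the support graph $G$ of $\mathbf{s}$ is a tree with edges $e_1,\dots,e_{n-1}$. Then the generating series $A_n^{(\mathbf{q};\mathbf{s})}(x)=\sum_{L\ge1}a_{n,L}^{(\mathbf{q};\mathbf{s})}x^L$ satisfies, for all integers $K\ge1$, \[ A_n^{(\mathbf{q};\mathbf{s})}(K)=\sum_{\mathbf{t}=\mathbf{0}}^{\mathbf{q}}\prod_{i=1}^{n}\frac{(2q_i+s_i)!}{2^{t_i}t_i!\,(s_i+q_i-t_i)!}\cdot v_{n,K;\mathbf{q}-\mathbf{t}+\mathbf{1}}^{(\mathbf{s})}, \] where the sum is over integer vectors $\mathbf{t}=(t_1,\dots,t_n)$ with $0\le t_i\le q_i$, $\mathbf{1}=(1,\dots,1)$, and for $\mathbf{R}=(R_1,\dots,R_n)$, \[ v_{n,K;\mathbf{R}}^{(\mathbf{s})}=\sum_{A_{e_1}=0}^{\min(s_{e_1},K)-1}\cdots\sum_{A_{e_{n-1}}=0}^{\min(s_{e_{n-1}},K)-1}\left[\prod_{j=1}^{n-1}\frac{(K-A_{e_j}-1)!}{(K+s_{e_j}-A_{e_j}-1)!}\prod_{i=1}^{n}\frac{\left(K+\sum_{k\sim i}(s_{i,k}-A_{i,k}-1)\right)!\left(R_i-1+\sum_{k\sim i}s_{i,k}\right)!}{(R_i-1)!\left(K-R_i-\sum_{k\sim i}A_{i,k}\right)!\left(R_i+\sum_{k\sim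 i}(s_{i,k}-1)\right)!}\right]. \] Furthermore, for fixed $n$, $\mathbf{q}$, $\mathbf{s}$, this expression can be written as a polynomial in $K$ (so substituting $K=x$ gives $A_n^{(\mathbf{q};\mathbf{s})}(x)$).
   Context: For positive integers $p_1,\dots,p_n$, let $[p_1,\dots,p_n]$ be the disjoint union of labelled copies $\{1^{\underline{i}},\dots,p_i^{\underline{i}}\}$ for $i=1,\dots,n$. A pairing of a set is a partition into 2-element subsets. Let $\mathbf{s}=(s_{1,2},\dots,s_{n-1,n})$ be viewed as a strictly upper triangular $n\times n$ matrix, with $s_{i,k}=s_{k,i}$ for $i>k$ and $s_i=\sum_{k\ne i}s_{i,k}$; set $p_i=2q_i+s_i$, assumed positive. Let $\mathcal{P}_n^{(\mathbf{q};\mathbf{s})}$ be the set of pairings of $[p_1,\dots,p_n]$ having exactly $q_i$ pairs of the form $\{x^{\underline{i}},y^{\underline{i}}\}$ and exactly $s_{i,k}$ pairs of the form $\{x^{\underline{i}},y^{\underline{k}}\}$ ($i\ne k$). Let $\gamma_{p_1,\dots,p_n}=(1^{\underline{1}},\dots,p_1^{\underline{1}})\cdots(1^{\underline{n}},\dots,p_n^{\underline{n}})$. For $L\ge1$, let $a_{n,L}^{(\mathbf{q};\mathbf{s})}$ be the number of pairings $\mu\in\mathcal{P}_n^{(\mathbf{q};\mathbf{s})}$ (viewed as fixed-point-free involutions) such that $\mu\gamma_{p_1,\dots,p_n}^{-1}$ has exactly $L$ cycles. The support graph of $\mathbf{s}$ is the graph on vertex set $\{1,\dots,n\}$ with an edge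 $\{i,k\}$ iff $s_{i,k}>0$. In the formula, $\sum_{k\sim i}$ is over the indices $k$ adjacent to $i$ in this support graph; for an edge $e_j=\{i,k\}$, $s_{e_j}=s_{i,k}$ and the summation variable $A_{e_j}$ is also written $A_{i,k}=A_{k,i}$. *)

theory Defs
  imports "HOL-Combinatorics.Combinatorics" "HOL-Computational_Algebra.Polynomial"
begin

text \<open>
  Strictly upper triangular arrays are functions on index pairs of which only the values at
  \<open>(i, k)\<close> with \<open>i < k\<close> are used; \<open>sym_entry M i k\<close> is the entry \<open>M\<^sub>i\<^sub>,\<^sub>k = M\<^sub>k\<^sub>,\<^sub>i\<close>, for
  \<open>i \<noteq> k\<close>.  All indices range over \<open>{1..n}\<close>.
\<close>

definition sym_entry :: "(nat \<times> nat \<Rightarrow> nat) \<Rightarrow> nat \<Rightarrow> nat \<Rightarrow> nat" where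
  "sym_entry M i k = (if i < k then M (i, k) else M (k, i))"

definition row_sum :: "nat \<Rightarrow> (nat \<times> nat \<Rightarrow> nat) \<Rightarrow> nat \<Rightarrow> nat" where
  "row_sum n s i = (\<Sum>k\<in>{1..n} - {i}. sym_entry s i k)"

definition block_size :: "nat \<Rightarrow> (nat \<Rightarrow> nat) \<Rightarrow> (nat \<times> nat \<Rightarrow> nat) \<Rightarrow> nat \<Rightarrow> nat" where
  "block_size n q s i = 2 * q i + row_sum n s i"


subsection \<open>Support graph\<close>

definition support_adj :: "nat \<Rightarrow> (nat \<times> nat \<Rightarrow> nat) \<Rightarrow> nat \<Rightarrow> nat \<Rightarrow> bool" where
  "support_adj n s i k \<longleftrightarrow>
     i \<in> {1..n} \<and> k \<in> {1..n} \<and> i \<noteq> k \<and> sym_entry s i k > 0"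

definition neighbours :: "nat \<Rightarrow> (nat \<times> nat \<Rightarrow> nat) \<Rightarrow> nat \<Rightarrow> nat set" where
  "neighbours n s i = {k. support_adj n s i k}"

text \<open>The edge \<open>{i, k}\<close> with \<open>i < k\<close> is represented by the pair \<open>(i, k)\<close>.\<close>

definition support_edges :: "nat \<Rightarrow> (nat \<times> nat \<Rightarrow> nat) \<Rightarrow> (nat \<times> nat) set" where
  "support_edges n s = {(i, k). i < k \<and> support_adj n s i k}"

text \<open>
  Trees are connected simple graphs without cycles, for a symmetric irreflexive relation
  \<open>adj\<close> on the vertex set \<open>V\<close>.  A cycle is given by the list of its (at least three) distinct
  vertices.
\<close>

definition graph_cycle :: "('v \<Rightarrow> 'v \<Rightarrow> bool) \<Rightarrow> 'v list \<Rightarrow> bool" where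
  "graph_cycle adj c \<longleftrightarrow> length c \<ge> 3 \<and> distinct c \<and>
     (\<forall>j<length c. adj (c ! j) (c ! (Suc j mod length c)))"

definition is_tree :: "'v set \<Rightarrow> ('v \<Rightarrow> 'v \<Rightarrow> bool) \<Rightarrow> bool" where
  "is_tree V adj \<longleftrightarrow> V \<noteq> {} \<and> (\<forall>u\<in>V. \<forall>v\<in>V. adj\<^sup>*\<^sup>* u v) \<and>
     \<not> (\<exists>c. set c \<subseteq> V \<and> graph_cycle adj c)"


subsection \<open>Pairings and their generating series\<close>

text \<open>The pair \<open>(i, x)\<close> stands for the element \<open>x\<close> of the copy with label \<open>i\<close>.\<close>

definition labelled_set :: "nat \<Rightarrow> (nat \<Rightarrow> nat) \<Rightarrow> (nat \<times> nat) set" where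
  "labelled_set n p = (SIGMA i:{1..n}. {1..p i})"

definition pairings :: "'a set \<Rightarrow> 'a set set set" where
  "pairings S = {P. partition_on S P \<and> (\<forall>B\<in>P. card B = 2)}"

definition paired_surfaces ::
    "nat \<Rightarrow> (nat \<Rightarrow> nat) \<Rightarrow> (nat \<times> nat \<Rightarrow> nat) \<Rightarrow> (nat \<times> nat) set set set" where
  "paired_surfaces n q s = {P \<in> pairings (labelled_set n (block_size n q s)).
     (\<forall>i\<in>{1..n}. card {B \<in> P. \<exists>x y. B = {(i, x), (i, y)}} = q i) \<and>
     (\<forall>i\<in>{1..n}. \<forall>k\<in>{1..n}. i \<noteq> k \<longrightarrow>
        card {B \<in> P. \<exists>x y. B = {(i, x), (k, y)}} = sym_entry s i k)}"

definition pairing_involution :: "'a set set \<Rightarrow> 'a \<Rightarrow> 'a" where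
  "pairing_involution P a = (if a \<in> \<Union>P then THE b. b \<noteq> a \<and> {a, b} \<in> P else a)"

definition canonical_perm :: "nat \<Rightarrow> (nat \<Rightarrow> nat) \<Rightarrow> nat \<times> nat \<Rightarrow> nat \<times> nat" where
  "canonical_perm n p =
     (\<lambda>(i, x). if i \<in> {1..n} then (i, cycle_of_list [1..<Suc (p i)] x) else (i, x))"

text \<open>Fixed points in \<open>S\<close> count as cycles.\<close>

definition num_cycles :: "'a set \<Rightarrow> ('a \<Rightarrow> 'a) \<Rightarrow> nat" where
  "num_cycles S f = card (orbit f ` S)"

definition cycle_count :: "nat \<Rightarrow> (nat \<Rightarrow> nat) \<Rightarrow> (nat \<times> nat \<Rightarrow> nat) \<Rightarrow> nat \<Rightarrow> nat" where
  "cycle_count n q s L = card {P \<in> paired_surfaces n q s.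
     num_cycles (labelled_set n (block_size n q s))
       (pairing_involution P \<circ> inv (canonical_perm n (block_size n q s))) = L}"

text \<open>
  Only finitely many \<open>L\<close> contribute to the generating series, since a permutation has at most
  as many cycles as points; see \<open>coeff_genus_series\<close> below.
\<close>

definition genus_series :: "nat \<Rightarrow> (nat \<Rightarrow> nat) \<Rightarrow> (nat \<times> nat \<Rightarrow> nat) \<Rightarrow> real poly" where
  "genus_series n q s =
     (\<Sum>L = 1..card (labelled_set n (block_size n q s)). monom (of_nat (cycle_count n q s L)) L)"

lemma finite_labelled_set: "finite (labelled_set n p)"
  by (simp add: labelled_set_def)

lemma coeff_genus_series:
  "coeff (genus_series n q s) L = (if L \<ge> 1 then of_nat (cycle_count n q s L) else 0)"
proof -
  let ?S = "labelled_set n (block_size n q s)"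
  have "cycle_count n q s L = 0" if "L > card ?S"
  proof -
    have "num_cycles ?S f \<noteq> L" for f
      using that card_image_le[OF finite_labelled_set, of "orbit f" n "block_size n q s"]
      by (simp add: num_cycles_def)
    then show ?thesis by (simp add: cycle_count_def)
  qed
  then show ?thesis
    by (auto simp: genus_series_def coeff_sum)
qed


subsection \<open>The explicit formula\<close>

text \<open>The reciprocal factorial, with the convention \<open>1 / m! = 0\<close> for \<open>m < 0\<close>.\<close>

definition recip_fact :: "int \<Rightarrow> real" where
  "recip_fact m = (if m < 0 then 0 else 1 / fact (nat m))"

text \<open>
  Only \<open>K - R\<^sub>i - (\<Sum>k. A\<^sub>i\<^sub>,\<^sub>k)\<close> can be negative; the subtractions on \<open>nat\<close> below never truncate
  when \<open>K \<ge> 1\<close> and \<open>R\<^sub>i \<ge> 1\<close>, because \<open>A\<^sub>e < min (s\<^sub>e) K\<close> on every edge \<open>e\<close>.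
\<close>

definition vertical_value ::
    "nat \<Rightarrow> nat \<Rightarrow> (nat \<Rightarrow> nat) \<Rightarrow> (nat \<times> nat \<Rightarrow> nat) \<Rightarrow> real" where
  "vertical_value n K R s =
     (\<Sum>A \<in> (\<Pi>\<^sub>E e\<in>support_edges n s. {0..<min (s e) K}).
        (\<Prod>e\<in>support_edges n s. fact (K - A e - 1) / fact (K + s e - A e - 1)) *
        (\<Prod>i = 1..n.
           fact (K + (\<Sum>k\<in>neighbours n s i. sym_entry s i k - sym_entry A i k - 1)) *
           fact (R i - 1 + (\<Sum>k\<in>neighbours n s i. sym_entry s i k)) /
           fact (R i - 1) *
           recip_fact (int K - int (R i) - (\<Sum>k\<in>neighbours n s i. int (sym_entry A i k))) /
           fact (R i + (\<Sum>k\<in>neighbours n s i. sym_entry s i k - 1))))"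

definition genus_formula ::
    "nat \<Rightarrow> (nat \<Rightarrow> nat) \<Rightarrow> (nat \<times> nat \<Rightarrow> nat) \<Rightarrow> nat \<Rightarrow> real" where
  "genus_formula n q s K =
     (\<Sum>t \<in> (\<Pi>\<^sub>E i\<in>{1..n}. {0..q i}).
        (\<Prod>i = 1..n. fact (2 * q i + row_sum n s i) /
           (2 ^ t i * fact (t i) * fact (row_sum n s i + q i - t i))) *
        vertical_value n K (\<lambda>i. q i - t i + 1) s)"

end

theory Submission
  imports Defs
begin

text \<open>
  A permutation with \<open>L\<close> cycles has \<open>K ^ L\<close> colourings with \<open>K\<close> colours that are constant along its
  cycles.  Averaging over conjugation by the permutations that preserve the blocks turns the series
  at \<open>K\<close> into a sum, for one fixed pairing \<open>\<mu>\<close>, of the number of colourings of \<open>\<mu> \<circ> \<beta>\<close>, where \<open>\<beta>\<close> runs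
  over all products of one full cycle on each block.  The indicator of the full cycles is a sum of
  the functions \<open>hook S b\<close> (characters of hook shapes, up to sign), and convolution with the number
  of colourings multiplies each of these by the scalar \<open>hook_content\<close>.

  If the blocks form a tree, then summing over the permutations of a leaf block has the effect of
  replacing the matching between the leaf \<open>l\<close> and its neighbour \<open>k\<close> by a permutation \<open>\<rho>\<close> of the matched
  points of \<open>k\<close>, with the weight \<open>hook U A \<rho>\<close>; the leg lengths \<open>A\<close> are the variables \<open>A\<^sub>e\<close> of the formula.
  By orthogonality of the functions \<open>hook U A\<close> every block finally contributes a linear functional of
  a polynomial \<open>(1 - y\<^sup>2)\<^sup>q (1 - y)\<^sup>d y\<^sup>a / (1 - y)\<close>, and expanding the powers of
  \<open>1 - y\<^sup>2 = (1 - y) (2 y + (1 - y))\<close> yields the sum over \<open>t\<close>.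
\<close>

subsection \<open>Colourings constant along the cycles of a permutation\<close>

text \<open>Hook shapes suffice because every other irreducible character vanishes on a full cycle.
  No representation theory is invoked: that the hook functions are eigenvectors is proved by
  counting colourings, and orthogonality then follows from their eigenvalues. The tree hypothesis
  makes the blocks separable: a leaf meets the rest through a single neighbour, so the rest enters
  the sum over the leaf only as one permutation of the matched points. Each edge carries two
  constants. \<open>hook_content K s A\<close> stands in the denominator, the price of turning a
  hook coefficient back into colourings of the smaller system, and \<open>s!\<close> is the squared
  norm of a hook function. These factorials, together with the numbers \<open>2 ^ q * q!\<close>
  produced by the blocks, are finally absorbed by the number of pairings of the given type.\<close>

text \<open>Colour 0 serves as a marker: it is forced on every cycle that meets \<open>Z\<close>.
  For positive \<open>K\<close> and a permutation \<open>\<pi>\<close> of \<open>S\<close>, the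
  value is therefore \<open>K\<close> to the number of cycles that avoid \<open>Z\<close>.\<close>

definition ncol0 :: "nat \<Rightarrow> 'a set \<Rightarrow> 'a set \<Rightarrow> ('a \<Rightarrow> 'a) \<Rightarrow> nat" where
  "ncol0 K Z S \<pi> = card {f \<in> S \<rightarrow>\<^sub>E {..<K}. (\<forall>x\<in>S \<inter> Z. f x = 0) \<and> (\<forall>x\<in>S. f (\<pi> x) = f x)}"

abbreviation ncol :: "nat \<Rightarrow> 'a set \<Rightarrow> ('a \<Rightarrow> 'a) \<Rightarrow> nat" where
  "ncol K \<equiv> ncol0 K {}"

text \<open>The transposition cuts \<open>z\<close> out of its cycle: the predecessor of
  \<open>z\<close> is sent directly to \<open>\<pi> z\<close>. The colour of \<open>z\<close> is
  that of \<open>\<pi> z\<close>, except at a fixed point, where it is free because \<open>z\<close>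
  is not in \<open>Z\<close>.\<close>

lemma ncol0_insert:
  assumes \<pi>: "\<pi> permutes insert z S" and z: "z \<notin> S" and zZ: "z \<notin> Z"
  shows "ncol0 K Z (insert z S) \<pi> =
    (if \<pi> z = z then K else 1) * ncol0 K Z S (transpose z (\<pi> z) \<circ> \<pi>)"
proof (cases "\<pi> z = z")
  case True
  have im: "\<pi> x \<in> S" if "x \<in> S" for x
    using permutes_in_image[OF \<pi>, of x] that z True permutes_inj[OF \<pi>]
    by (metis injD insertE insert_iff)
  have "bij_betw (\<lambda>(c, f). f(z := c))
      ({..<K} \<times> {f \<in> S \<rightarrow>\<^sub>E {..<K}. (\<forall>x\<in>S \<inter> Z. f x = 0) \<and> (\<forall>x\<in>S. f (\<pi> x) = f x)})
      {f \<in> insert z S \<rightarrow>\<^sub>E {..<K}. (\<forall>x\<in>insert z S \<inter> Z. f x = 0) \<and> (\<forall>x\<in>insert z S. f (\<pi> x) = f x)}"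
    (is "bij_betw _ ?A ?B")
  proof (rule bij_betw_byWitness[where f' = "\<lambda>f. (f z, restrict f S)"])
    show "\<forall>a\<in>?A. (case case a of (c, f) \<Rightarrow> f(z := c) of f \<Rightarrow> (f z, restrict f S)) = a"
      using z by (auto simp: fun_eq_iff PiE_def extensional_def restrict_def)
    show "\<forall>f\<in>?B. (case (f z, restrict f S) of (c, f) \<Rightarrow> f(z := c)) = f"
      by (auto simp: fun_eq_iff PiE_def extensional_def restrict_def)
    show "(\<lambda>(c, f). f(z := c)) ` ?A \<subseteq> ?B"
      using z zZ im True by (auto simp: PiE_def extensional_def)
    show "(\<lambda>f. (f z, restrict f S)) ` ?B \<subseteq> ?A"
      using z zZ im by (auto simp: PiE_def extensional_def)
  qed
  then have "card ?A = card ?B" by (rule bij_betw_same_card)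
  then show ?thesis using True by (simp add: ncol0_def card_cartesian_product)
next
  case False
  let ?\<psi> = "transpose z (\<pi> z) \<circ> \<pi>"
  have \<psi>: "?\<psi> x = (if \<pi> x = z then \<pi> z else \<pi> x)" if "x \<in> S" for x
    using that z permutes_inj[OF \<pi>] by (auto simp: transpose_def dest: injD)
  have pz: "\<pi> z \<in> S" using permutes_in_image[OF \<pi>, of z] False by auto
  have im: "\<pi> x \<in> insert z S" if "x \<in> S" for x
    using permutes_in_image[OF \<pi>, of x] that by auto
  have "bij_betw (\<lambda>f. restrict f S)
      {f \<in> insert z S \<rightarrow>\<^sub>E {..<K}. (\<forall>x\<in>insert z S \<inter> Z. f x = 0) \<and> (\<forall>x\<in>insert z S. f (\<pi> x) = f x)}
      {f \<in> S \<rightarrow>\<^sub>E {..<K}. (\<forall>x\<in>S \<inter> Z. f x = 0) \<and> (\<forall>x\<in>S. f (?\<psi> x) = f x)}" (is "bij_betw _ ?A ?B")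
  proof (rule bij_betw_byWitness[where f' = "\<lambda>f. f(z := f (\<pi> z))"])
    show "\<forall>f\<in>?A. (restrict f S)(z := restrict f S (\<pi> z)) = f"
      using pz by (auto simp: fun_eq_iff PiE_def extensional_def restrict_def)
    show "\<forall>f\<in>?B. restrict (f(z := f (\<pi> z))) S = f"
      using z by (auto simp: fun_eq_iff PiE_def extensional_def restrict_def)
    show "(\<lambda>f. restrict f S) ` ?A \<subseteq> ?B"
    proof clarify
      fix f assume f: "f \<in> insert z S \<rightarrow>\<^sub>E {..<K}" "\<forall>x\<in>insert z S \<inter> Z. f x = 0" "\<forall>x\<in>insert z S. f (\<pi> x) = f x"
      have "restrict f S (?\<psi> x) = restrict f S x" if "x \<in> S" for x
        using f(3) \<psi>[OF that] im[OF that] pz that by auto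
      then show "restrict f S \<in> S \<rightarrow>\<^sub>E {..<K} \<and> (\<forall>x\<in>S \<inter> Z. restrict f S x = 0) \<and> (\<forall>x\<in>S. restrict f S (?\<psi> x) = restrict f S x)"
        using f(1,2) by auto
    qed
    show "(\<lambda>f. f(z := f (\<pi> z))) ` ?B \<subseteq> ?A"
    proof clarify
      fix f assume f: "f \<in> S \<rightarrow>\<^sub>E {..<K}" "\<forall>x\<in>S \<inter> Z. f x = 0" "\<forall>x\<in>S. f (?\<psi> x) = f x"
      have "(f(z := f (\<pi> z))) (\<pi> x) = (f(z := f (\<pi> z))) x" if "x \<in> insert z S" for x
      proof (cases "x = z")
        case True then show ?thesis using False by simp
      next
        case ne: False
        then have x: "x \<in> S" using that by simp
        show ?thesis using f(3)[rule_format, OF x] unfolding \<psi>[OF x]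
          using ne by (auto split: if_splits)
      qed
      moreover have "f(z := f (\<pi> z)) \<in> insert z S \<rightarrow>\<^sub>E {..<K}"
        using f(1) pz by (auto simp: PiE_def extensional_def)
      moreover have "\<forall>x\<in>insert z S \<inter> Z. (f(z := f (\<pi> z))) x = 0" using f(2) zZ by auto
      ultimately show "f(z := f (\<pi> z)) \<in> insert z S \<rightarrow>\<^sub>E {..<K} \<and> (\<forall>x\<in>insert z S \<inter> Z. (f(z := f (\<pi> z))) x = 0) \<and>
          (\<forall>x\<in>insert z S. (f(z := f (\<pi> z))) (\<pi> x) = (f(z := f (\<pi> z))) x)" by blast
    qed
  qed
  then have "card ?A = card ?B" by (rule bij_betw_same_card)
  then show ?thesis using False by (simp add: ncol0_def)
qed

lemma ncol_conj:
  assumes t: "bij t" and \<pi>: "\<pi> permutes S"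
  shows "ncol K (t ` S) (t \<circ> \<pi> \<circ> inv t) = ncol K S \<pi>"
proof -
  have it: "inv t (t x) = x" for x using t by (simp add: bij_def)
  have ti: "t (inv t x) = x" for x using t by (simp add: bij_def surj_f_inv_f)
  have im: "\<pi> x \<in> S \<longleftrightarrow> x \<in> S" for x by (rule permutes_in_image[OF \<pi>])
  have mem: "x \<in> t ` S \<longleftrightarrow> inv t x \<in> S" for x
    by (metis it ti image_iff)
  have "bij_betw (\<lambda>f. f \<circ> t) {f \<in> t ` S \<rightarrow>\<^sub>E {..<K}. \<forall>x\<in>t ` S. f ((t \<circ> \<pi> \<circ> inv t) x) = f x}
     {f \<in> S \<rightarrow>\<^sub>E {..<K}. \<forall>x\<in>S. f (\<pi> x) = f x}" (is "bij_betw _ ?A ?B")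
  proof (rule bij_betw_byWitness[where f' = "\<lambda>f. f \<circ> inv t"])
    show "\<forall>f\<in>?A. f \<circ> t \<circ> inv t = f" by (auto simp: fun_eq_iff ti)
    show "\<forall>f\<in>?B. f \<circ> inv t \<circ> t = f" by (auto simp: fun_eq_iff it)
    show "(\<lambda>f. f \<circ> t) ` ?A \<subseteq> ?B"
      by (auto simp: PiE_def extensional_def mem it)
    show "(\<lambda>f. f \<circ> inv t) ` ?B \<subseteq> ?A"
      by (auto simp: PiE_def extensional_def mem it im)
  qed
  then show ?thesis by (simp add: ncol0_def bij_betw_same_card)
qed

lemma ncol_conj_permutes:
  assumes "t permutes S" "\<pi> permutes S"
  shows "ncol K S (t \<circ> \<pi> \<circ> inv t) = ncol K S \<pi>"
  using ncol_conj[OF permutes_bij[OF assms(1)] assms(2), of K] permutes_image[OF assms(1)] by simp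

lemma ncol_comp_commute:
  assumes "\<sigma> permutes S" "\<pi> permutes S"
  shows "ncol K S (\<sigma> \<circ> \<pi>) = ncol K S (\<pi> \<circ> \<sigma>)"
proof -
  have "\<sigma> \<circ> (\<pi> \<circ> \<sigma>) \<circ> inv \<sigma> = \<sigma> \<circ> \<pi>"
    by (simp add: fun_eq_iff permutes_inverses[OF assms(1)])
  then show ?thesis
    using ncol_conj_permutes[OF assms(1) permutes_compose[OF assms(1,2)], of K] by simp
qed

text \<open>\<open>\<alpha>\<close> is the first-return map of \<open>\<sigma>\<close> to \<open>U\<close>, and \<open>m\<close> counts the cycles of \<open>\<sigma>\<close> that avoid \<open>U\<close>.\<close>

lemma first_return:
  assumes "finite R" "\<sigma> permutes R" "U \<subseteq> R"
  obtains m \<alpha> where "\<alpha> permutes U"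
    "\<And>Z Q \<rho>. Z \<inter> R \<subseteq> U \<Longrightarrow> Q \<inter> R = {} \<Longrightarrow> \<rho> permutes Q \<union> U \<Longrightarrow>
       ncol0 K Z (Q \<union> R) (\<rho> \<circ> \<sigma>) = K ^ m * ncol0 K Z (Q \<union> U) (\<rho> \<circ> \<alpha>)"
proof -
  \<comment> \<open>\<open>Z\<close>, \<open>Q\<close> and \<open>\<rho>\<close> are quantified
    inside the existence claim: \<open>m\<close> and \<open>\<alpha>\<close> depend on
    \<open>\<sigma>\<close> alone, so one return map serves every \<open>\<rho>\<close> that is
    later attached along \<open>U\<close>.\<close>
  have "\<exists>m \<alpha>. \<alpha> permutes U \<and> (\<forall>Z Q \<rho>. Z \<inter> (U \<union> D) \<subseteq> U \<longrightarrow> Q \<inter> (U \<union> D) = {} \<longrightarrow> \<rho> permutes Q \<union> U \<longrightarrow>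
       ncol0 K Z (Q \<union> (U \<union> D)) (\<rho> \<circ> \<sigma>) = K ^ m * ncol0 K Z (Q \<union> U) (\<rho> \<circ> \<alpha>))"
    if "finite D" "U \<inter> D = {}" "\<sigma> permutes U \<union> D" for D \<sigma>
    using that
  proof (induction D arbitrary: \<sigma> rule: finite_induct)
    case empty
    then show ?case by (intro exI[of _ 0] exI[of _ \<sigma>]) auto
  next
    case (insert z D)
    have \<sigma>: "\<sigma> permutes insert z (U \<union> D)" using insert.prems(2) by simp
    let ?\<sigma>' = "transpose z (\<sigma> z) \<circ> \<sigma>"
    have \<sigma>': "?\<sigma>' permutes U \<union> D" by (rule permutes_insert_lemma[OF \<sigma>])
    from insert.IH[OF _ \<sigma>'] insert.prems(1) obtain m \<alpha> where \<alpha>: "\<alpha> permutes U"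
      and *: "\<And>Z Q \<rho>. Z \<inter> (U \<union> D) \<subseteq> U \<Longrightarrow> Q \<inter> (U \<union> D) = {} \<Longrightarrow> \<rho> permutes Q \<union> U \<Longrightarrow>
       ncol0 K Z (Q \<union> (U \<union> D)) (\<rho> \<circ> ?\<sigma>') = K ^ m * ncol0 K Z (Q \<union> U) (\<rho> \<circ> \<alpha>)"
      by blast
    have "ncol0 K Z (Q \<union> (U \<union> insert z D)) (\<rho> \<circ> \<sigma>) =
        K ^ (if \<sigma> z = z then Suc m else m) * ncol0 K Z (Q \<union> U) (\<rho> \<circ> \<alpha>)"
      if Z: "Z \<inter> (U \<union> insert z D) \<subseteq> U" and Q: "Q \<inter> (U \<union> insert z D) = {}" and \<rho>: "\<rho> permutes Q \<union> U" for Z Q \<rho>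
    proof -
      have z: "z \<notin> Q \<union> (U \<union> D)" using Q insert by auto
      have zZ: "z \<notin> Z" using Z insert by auto
      have Z': "Z \<inter> (U \<union> D) \<subseteq> U" using Z by auto
      have \<rho>z: "\<rho> z = z" using \<rho> z by (auto intro: permutes_not_in)
      have \<rho>inj: "\<rho> x = \<rho> y \<longleftrightarrow> x = y" for x y using permutes_inj[OF \<rho>] by (auto dest: injD)
      have \<rho>zi: "\<rho> x = z \<longleftrightarrow> x = z" for x using \<rho>inj[of x z] \<rho>z by simp
      have p: "\<rho> \<circ> \<sigma> permutes insert z (Q \<union> (U \<union> D))"
        by (intro permutes_compose permutes_subset[OF \<rho>] permutes_subset[OF \<sigma>]) auto
      \<comment> \<open>\<open>\<rho>\<close> fixes \<open>z\<close>, so cutting \<open>z\<close>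
        out of \<open>\<rho> \<circ> \<sigma>\<close> is the same as cutting it out of
        \<open>\<sigma>\<close>.\<close>
      have e: "transpose z ((\<rho> \<circ> \<sigma>) z) \<circ> (\<rho> \<circ> \<sigma>) = \<rho> \<circ> ?\<sigma>'"
        by (rule ext) (simp add: transpose_def \<rho>z \<rho>inj \<rho>zi)
      have f: "(\<rho> \<circ> \<sigma>) z = z \<longleftrightarrow> \<sigma> z = z" using \<rho>z \<rho>inj by (metis comp_apply)
      have "ncol0 K Z (insert z (Q \<union> (U \<union> D))) (\<rho> \<circ> \<sigma>) =
          (if \<sigma> z = z then K else 1) * (K ^ m * ncol0 K Z (Q \<union> U) (\<rho> \<circ> \<alpha>))"
        unfolding ncol0_insert[OF p z zZ] e f using *[OF Z' _ \<rho>] Q by (metis Int_Un_distrib Un_empty_right Un_insert_right inf_sup_distrib1 insert_disjoint(2) disjoint_insert(2))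
      then show ?thesis by (simp add: algebra_simps)
    qed
    with \<alpha> show ?case by blast
  qed
  from this[of "R - U" \<sigma>] assms that show thesis
    by (auto simp: Un_absorb1 Int_commute) (metis Diff_partition)
qed

section \<open>Sums of colouring numbers over permutations\<close>

lemma sum_permutes_insert:
  fixes g :: "('a \<Rightarrow> 'a) \<Rightarrow> 'b::comm_monoid_add"
  assumes "finite S" "z \<notin> S"
  shows "(\<Sum>\<pi> | \<pi> permutes insert z S. g \<pi>) =
    (\<Sum>w\<in>insert z S. \<Sum>\<pi> | \<pi> permutes S. g (transpose z w \<circ> \<pi>))"
proof -
  have "inj_on (\<lambda>(b, p). transpose z b \<circ> p) (insert z S \<times> {p. p permutes S})"
  proof (rule inj_onI, clarify)
    fix b p c q
    assume p: "p permutes S" and q: "q permutes S" and e: "transpose z b \<circ> p = transpose z c \<circ> q"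
    have "p z = z" "q z = z" using p q assms(2) by (auto intro: permutes_not_in)
    then have "b = c" using fun_cong[OF e, of z] by simp
    with e show "b = c \<and> p = q" by (metis (no_types, lifting) comp_assoc id_comp transpose_comp_involutory)
  qed
  moreover have "{\<pi>. \<pi> permutes insert z S} =
      (\<lambda>(b, p). transpose z b \<circ> p) ` (insert z S \<times> {p. p permutes S})"
    unfolding permutes_insert by auto
  ultimately have "(\<Sum>\<pi> | \<pi> permutes insert z S. g \<pi>) =
     (\<Sum>(b, p)\<in>insert z S \<times> {p. p permutes S}. g (transpose z b \<circ> p))"
    by (simp add: sum.reindex case_prod_unfold)
  then show ?thesis by (simp add: sum.cartesian_product)
qed

text \<open>A new point either forms a cycle of its own, with a free colour, or is placed directly
  before one of the \<open>card S\<close> old points, without new freedom. Each insertion thus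
  contributes the factor \<open>K + card S\<close> of the rising factorial.\<close>

lemma sum_ncol:
  assumes "finite S"
  shows "(\<Sum>\<pi> | \<pi> permutes S. real (ncol K S \<pi>)) = pochhammer (real K) (card S)"
  using assms
proof (induction S rule: finite_induct)
  case empty
  have "{f \<in> {} \<rightarrow>\<^sub>E {..<K}. \<forall>x\<in>{}. f (id x) = f x} = {\<lambda>_. undefined}" by auto
  then show ?case by (simp add: ncol0_def)
next
  case (insert z S)
  have *: "real (ncol K (insert z S) (transpose z w \<circ> \<pi>)) = (if w = z then K else 1) * ncol K S \<pi>"
    if w: "w \<in> insert z S" and \<pi>: "\<pi> permutes S" for w \<pi>
  proof -
    have "\<pi> z = z" using \<pi> insert by (auto intro: permutes_not_in)
    moreover have "transpose z w \<circ> (transpose z w \<circ> \<pi>) = \<pi>"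
      by (simp add: fun_eq_iff)
    moreover have "transpose z w \<circ> \<pi> permutes insert z S"
      by (intro permutes_compose permutes_swap_id permutes_subset[OF \<pi>]) (use w in auto)
    ultimately show ?thesis using insert.hyps(2) by (subst ncol0_insert) auto
  qed
  have "(\<Sum>\<pi> | \<pi> permutes insert z S. real (ncol K (insert z S) \<pi>)) =
    (\<Sum>w\<in>insert z S. \<Sum>\<pi> | \<pi> permutes S. (if w = z then K else 1) * real (ncol K S \<pi>))"
    unfolding sum_permutes_insert[OF insert.hyps]
    by (intro sum.cong refl) (simp add: *)
  also have "\<dots> = (\<Sum>w\<in>insert z S. if w = z then real K else 1) * pochhammer (real K) (card S)"
    unfolding insert.IH[symmetric] sum_product by (intro sum.cong) auto
  also have "(\<Sum>w\<in>insert z S. if w = z then real K else 1) = real K + real (card S)"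
  proof -
    have "(\<Sum>w\<in>S. if w = z then real K else 1) = (\<Sum>w\<in>S. 1)"
      using insert.hyps by (intro sum.cong) auto
    then show ?thesis using insert.hyps by simp
  qed
  finally show ?case using insert.hyps by (simp add: pochhammer_Suc mult.commute)
qed


text \<open>If \<open>\<beta>\<close> is injective then \<open>agree T \<beta>\<close> consists of the restriction of \<open>\<beta>\<close> to \<open>T\<close> when \<open>\<beta> ` T = T\<close>, and is empty
  otherwise; summing over it avoids case distinctions.\<close>

definition agree :: "'a set \<Rightarrow> ('a \<Rightarrow> 'a) \<Rightarrow> ('a \<Rightarrow> 'a) set" where
  "agree T \<beta> = {\<tau>. \<tau> permutes T \<and> (\<forall>x\<in>T. \<tau> x = \<beta> x)}"

lemma finite_agree: "finite T \<Longrightarrow> finite (agree T \<beta>)"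
  unfolding agree_def using finite_permutations[of T] by (rule rev_finite_subset) auto

text \<open>A permutation of \<open>P\<close> that maps \<open>T\<close> onto itself splits uniquely
  into one of \<open>T\<close> and one of \<open>P - T\<close>; the inner sum over
  \<open>agree T \<beta>\<close> discards every other \<open>\<beta>\<close>.\<close>

lemma sum_permutes_agree:
  fixes g :: "('a \<Rightarrow> 'a) \<Rightarrow> ('a \<Rightarrow> 'a) \<Rightarrow> real"
  assumes P: "finite P" and T: "T \<subseteq> P"
  shows "(\<Sum>\<beta> | \<beta> permutes P. \<Sum>\<tau>\<in>agree T \<beta>. g \<tau> \<beta>) =
    (\<Sum>\<tau> | \<tau> permutes T. \<Sum>\<beta> | \<beta> permutes P - T. g \<tau> (\<tau> \<circ> \<beta>))"
proof -
  have fT: "finite T" using P T finite_subset by blast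
  have A: "inv \<tau> \<circ> \<beta> permutes P - T" if "\<beta> permutes P" "\<tau> permutes T" "\<forall>x\<in>T. \<tau> x = \<beta> x" for \<beta> \<tau>
  proof (rule permutes_superset)
    show "inv \<tau> \<circ> \<beta> permutes P"
      by (intro permutes_compose that permutes_subset[OF permutes_inv[OF that(2)] T])
    fix x assume "x \<in> P - (P - T)"
    then have "\<beta> x = \<tau> x" using that(3) by auto
    then show "(inv \<tau> \<circ> \<beta>) x = x" by (simp add: permutes_inverses[OF that(2)])
  qed
  have B: "\<tau> \<circ> \<beta> permutes P" "\<forall>x\<in>T. (\<tau> \<circ> \<beta>) x = \<tau> x" if "\<tau> permutes T" "\<beta> permutes P - T" for \<tau> \<beta>
  proof -
    show "\<tau> \<circ> \<beta> permutes P"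
      by (intro permutes_compose permutes_subset[OF that(1) T] permutes_subset[OF that(2)]) auto
    show "\<forall>x\<in>T. (\<tau> \<circ> \<beta>) x = \<tau> x" using permutes_not_in[OF that(2)] by auto
  qed
  have "(\<Sum>\<beta> | \<beta> permutes P. \<Sum>\<tau>\<in>agree T \<beta>. g \<tau> \<beta>) =
      (\<Sum>(\<beta>, \<tau>)\<in>(SIGMA \<beta>:{\<beta>. \<beta> permutes P}. agree T \<beta>). g \<tau> \<beta>)"
    by (rule sum.Sigma) (use finite_permutations[OF P] finite_agree[OF fT] in auto)
  also have "\<dots> = (\<Sum>(\<tau>, \<beta>)\<in>{\<tau>. \<tau> permutes T} \<times> {\<beta>. \<beta> permutes P - T}. g \<tau> (\<tau> \<circ> \<beta>))"
  proof (rule sum.reindex_bij_witness[where i = "\<lambda>(\<tau>, \<beta>). (\<tau> \<circ> \<beta>, \<tau>)" and j = "\<lambda>(\<beta>, \<tau>). (\<tau>, inv \<tau> \<circ> \<beta>)"])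
    fix p :: "('a \<Rightarrow> 'a) \<times> ('a \<Rightarrow> 'a)"
    obtain \<beta> \<tau> where p: "p = (\<beta>, \<tau>)" by (cases p)
    { assume "p \<in> (SIGMA \<beta>:{\<beta>. \<beta> permutes P}. agree T \<beta>)"
      then have h: "\<beta> permutes P" "\<tau> permutes T" "\<forall>x\<in>T. \<tau> x = \<beta> x" by (auto simp: p agree_def)
      have e: "\<tau> \<circ> (inv \<tau> \<circ> \<beta>) = \<beta>" by (simp add: fun_eq_iff permutes_inverses[OF h(2)])
      show "(case case p of (\<beta>, \<tau>) \<Rightarrow> (\<tau>, inv \<tau> \<circ> \<beta>) of (\<tau>, \<beta>) \<Rightarrow> (\<tau> \<circ> \<beta>, \<tau>)) = p"
        by (simp add: p e)
      show "(case p of (\<beta>, \<tau>) \<Rightarrow> (\<tau>, inv \<tau> \<circ> \<beta>)) \<in> {\<tau>. \<tau> permutes T} \<times> {\<beta>. \<beta> permutes P - T}"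
        using h A[OF h] by (simp add: p)
      show "(case case p of (\<beta>, \<tau>) \<Rightarrow> (\<tau>, inv \<tau> \<circ> \<beta>) of (\<tau>, \<beta>) \<Rightarrow> g \<tau> (\<tau> \<circ> \<beta>)) = (case p of (\<beta>, \<tau>) \<Rightarrow> g \<tau> \<beta>)"
        by (simp add: p e) }
    obtain \<tau> \<beta> where p: "p = (\<tau>, \<beta>)" by (cases p)
    assume "p \<in> {\<tau>. \<tau> permutes T} \<times> {\<beta>. \<beta> permutes P - T}"
    then have h: "\<tau> permutes T" "\<beta> permutes P - T" by (auto simp: p)
    have e: "inv \<tau> \<circ> (\<tau> \<circ> \<beta>) = \<beta>" by (simp add: fun_eq_iff permutes_inverses[OF h(1)])
    show "(case case p of (\<tau>, \<beta>) \<Rightarrow> (\<tau> \<circ> \<beta>, \<tau>) of (\<beta>, \<tau>) \<Rightarrow> (\<tau>, inv \<tau> \<circ> \<beta>)) = p"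
      by (simp add: p e)
    show "(case p of (\<tau>, \<beta>) \<Rightarrow> (\<tau> \<circ> \<beta>, \<tau>)) \<in> (SIGMA \<beta>:{\<beta>. \<beta> permutes P}. agree T \<beta>)"
      using h B[OF h] by (simp add: p agree_def)
  qed
  also have "\<dots> = (\<Sum>\<tau> | \<tau> permutes T. \<Sum>\<beta> | \<beta> permutes P - T. g \<tau> (\<tau> \<circ> \<beta>))"
    by (simp add: sum.cartesian_product)
  finally show ?thesis .
qed

text \<open>With the return map \<open>\<alpha>\<close> of \<open>\<sigma>\<close> to
  \<open>U\<close>, each summand is \<open>K ^ m\<close> times a count on \<open>U\<close> for
  \<open>\<beta> \<circ> \<alpha>\<close>, which runs through all permutations of \<open>U\<close>.
  The power \<open>K ^ m\<close> is itself a marked count: giving colour 0 to all of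
  \<open>U\<close> leaves exactly the cycles that avoid \<open>U\<close> free.\<close>

lemma sum_ncol_comp:
  assumes P: "finite P" and T: "U \<subseteq> P" and \<sigma>: "\<sigma> permutes P" and K: "K \<ge> 1"
  shows "(\<Sum>\<beta> | \<beta> permutes U. real (ncol K P (\<sigma> \<circ> \<beta>))) =
    pochhammer (real K) (card U) * real (ncol0 K U P \<sigma>)"
proof -
  have fU: "finite U" using P T finite_subset by blast
  obtain m \<alpha> where \<alpha>: "\<alpha> permutes U" and
    *: "\<And>Z Q \<rho>. Z \<inter> P \<subseteq> U \<Longrightarrow> Q \<inter> P = {} \<Longrightarrow> \<rho> permutes Q \<union> U \<Longrightarrow>
       ncol0 K Z (Q \<union> P) (\<rho> \<circ> \<sigma>) = K ^ m * ncol0 K Z (Q \<union> U) (\<rho> \<circ> \<alpha>)"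
    by (rule first_return[OF P \<sigma> T, where K = K]) (rule that)
  have "{f \<in> U \<rightarrow>\<^sub>E {..<K}. (\<forall>x\<in>U \<inter> U. f x = 0) \<and> (\<forall>x\<in>U. f (\<alpha> x) = f x)} = {\<lambda>x. if x \<in> U then 0 else undefined}"
    (is "?L = {?z}")
  proof
    show "?L \<subseteq> {?z}"
    proof
      fix f assume f: "f \<in> ?L"
      then have "f x = ?z x" for x
        by (cases "x \<in> U") (auto intro: PiE_arb[of f U])
      then show "f \<in> {?z}" by blast
    qed
    have "?z \<in> U \<rightarrow>\<^sub>E {..<K}" using K by (intro PiE_I) auto
    then show "{?z} \<subseteq> ?L" by (simp add: permutes_in_image[OF \<alpha>])
  qed
  then have "ncol0 K U U \<alpha> = 1" by (simp add: ncol0_def)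
  moreover have "ncol0 K U P \<sigma> = K ^ m * ncol0 K U U \<alpha>"
    using *[of U "{}" id] by (simp add: permutes_id)
  ultimately have Km: "ncol0 K U P \<sigma> = K ^ m" by simp
  have "ncol K P (\<sigma> \<circ> \<beta>) = K ^ m * ncol K U (\<beta> \<circ> \<alpha>)" if "\<beta> permutes U" for \<beta>
    using *[of "{}" "{}" \<beta>] that ncol_comp_commute[OF \<sigma> permutes_subset[OF that T]] by simp
  then have "(\<Sum>\<beta> | \<beta> permutes U. real (ncol K P (\<sigma> \<circ> \<beta>))) =
      K ^ m * (\<Sum>\<beta> | \<beta> permutes U. real (ncol K U (\<beta> \<circ> \<alpha>)))"
    by (simp add: sum_distrib_left)
  also have "(\<Sum>\<beta> | \<beta> permutes U. real (ncol K U (\<beta> \<circ> \<alpha>))) = pochhammer (real K) (card U)"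
    using sum_permutations_compose_right[OF \<alpha>, of "\<lambda>\<beta>. real (ncol K U \<beta>)"] sum_ncol[OF fU] by simp
  finally show ?thesis by (simp add: Km comp_def)
qed

text \<open>The falling factorial. Subtraction in the reals keeps it a polynomial in
  \<open>m\<close>; for \<open>c > m\<close> one factor is 0.\<close>

definition ffall :: "nat \<Rightarrow> nat \<Rightarrow> real" where
  "ffall m c = (\<Prod>i<c. real m - real i)"

text \<open>Colour 0 is spent on the points outside \<open>T\<close>, which leaves
  \<open>K - 1\<close> colours for \<open>T\<close>.\<close>

lemma card_inj_colourings:
  assumes "finite P" "T \<subseteq> P" "K \<ge> 1"
  shows "real (card {f \<in> P \<rightarrow>\<^sub>E {..<K}. (\<forall>x\<in>P - T. f x = 0) \<and> inj_on f T \<and> (\<forall>x\<in>T. f x \<noteq> 0)}) =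
    ffall (K - 1) (card T)"
proof -
  have fT: "finite T" using assms finite_subset by blast
  have "bij_betw (\<lambda>f. restrict f T)
      {f \<in> P \<rightarrow>\<^sub>E {..<K}. (\<forall>x\<in>P - T. f x = 0) \<and> inj_on f T \<and> (\<forall>x\<in>T. f x \<noteq> 0)}
      {f \<in> T \<rightarrow>\<^sub>E {1..<K}. inj_on f T}" (is "bij_betw _ ?A ?B")
  proof (rule bij_betw_byWitness[where f' = "\<lambda>f x. if x \<in> T then f x else if x \<in> P then 0 else undefined"])
    show "\<forall>f\<in>?A. (\<lambda>x. if x \<in> T then restrict f T x else if x \<in> P then 0 else undefined) = f"
      using assms by (auto simp: fun_eq_iff PiE_def extensional_def)
    show "\<forall>f\<in>?B. restrict (\<lambda>x. if x \<in> T then f x else if x \<in> P then 0 else undefined) T = f"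
      by (auto simp: fun_eq_iff PiE_def extensional_def)
    show "(\<lambda>f. restrict f T) ` ?A \<subseteq> ?B" using assms by (auto simp: inj_on_def PiE_def Pi_def Suc_le_eq)
    show "(\<lambda>f x. if x \<in> T then f x else if x \<in> P then 0 else undefined) ` ?B \<subseteq> ?A"
    proof clarify
      fix f assume f: "f \<in> T \<rightarrow>\<^sub>E {1..<K}" "inj_on f T"
      let ?g = "\<lambda>x. if x \<in> T then f x else if x \<in> P then 0 else undefined"
      have "f x \<ge> 1" "f x < K" if "x \<in> T" for x using PiE_mem[OF f(1) that] by auto
      then have "?g \<in> P \<rightarrow>\<^sub>E {..<K}" "\<forall>x\<in>T. ?g x \<noteq> 0" using assms by (auto simp: Suc_le_eq)
      moreover have "inj_on ?g T" using f(2) by (simp add: inj_on_def)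
      ultimately show "?g \<in> P \<rightarrow>\<^sub>E {..<K} \<and> (\<forall>x\<in>P - T. ?g x = 0) \<and> inj_on ?g T \<and> (\<forall>x\<in>T. ?g x \<noteq> 0)"
        by simp
    qed
  qed
  then have "card ?A = prod ((-) (K - 1)) {0..<card T}"
    using card_inj_on_subset_funcset[OF fT, of "{1..<K}" T] by (simp add: bij_betw_same_card)
  also have "real \<dots> = ffall (K - 1) (card T)"
  proof (cases "card T \<le> K - 1")
    case True
    then show ?thesis by (auto simp: ffall_def atLeast0LessThan of_nat_diff intro!: prod.cong)
  next
    case False
    then have "K - 1 \<in> {..<card T}" by auto
    then have "ffall (K - 1) (card T) = 0" "prod ((-) (K - 1)) {0..<card T} = 0"
      unfolding ffall_def by (auto intro!: prod_zero bexI[of _ "K - 1"])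
    then show ?thesis by simp
  qed
  finally show ?thesis .
qed

text \<open>A colouring that is not injective on \<open>T\<close> is fixed by a transposition, so its terms cancel; for an
  injective one at most one point of \<open>T\<close> has colour \<open>0\<close>, and \<open>\<rho>\<close> is forced at the other points.\<close>

lemma sum_sign_ncol0:
  assumes P: "finite P" and T: "T \<subseteq> P" and a: "a permutes P" and K: "K \<ge> 1"
  shows "(\<Sum>\<rho> | \<rho> permutes T. real_of_int (sign \<rho>) * real (ncol0 K (P - T) P (a \<circ> \<rho>))) =
    ffall (K - 1) (card T) * (\<Sum>\<rho>\<in>agree T (inv a). real_of_int (sign \<rho>)) +
    ffall (K - 1) (card T - 1) *
      (\<Sum>z\<in>T. \<Sum>\<rho> | \<rho> permutes T \<and> (\<forall>x\<in>T - {z}. \<rho> x = inv a x). real_of_int (sign \<rho>))"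
proof -
  have fT: "finite T" using P T finite_subset by blast
  let ?F = "{f \<in> P \<rightarrow>\<^sub>E {..<K}. \<forall>x\<in>P - T. f x = 0}"
  have fF: "finite ?F" by (rule finite_subset[OF _ finite_PiE[OF P, of "\<lambda>_. {..<K}"]]) auto
  have fS: "finite {\<rho>. \<rho> permutes T}" using fT by (rule finite_permutations)
  define h where "h f = (\<Sum>\<rho> | \<rho> permutes T \<and> (\<forall>x\<in>P. f (a (\<rho> x)) = f x). real_of_int (sign \<rho>))" for f :: "'a \<Rightarrow> nat"
  let ?s = "\<lambda>f. \<Sum>\<rho> | \<rho> permutes T \<and> (\<forall>x\<in>T. f x \<noteq> (0::nat) \<longrightarrow> \<rho> x = inv a x). real_of_int (sign \<rho>)"
  let ?I = "{f. f \<in> ?F \<and> inj_on f T}"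
  let ?N = "{f. f \<in> ?F \<and> inj_on f T \<and> (\<forall>x\<in>T. f x \<noteq> 0)}"
  let ?Cz = "\<lambda>z. {f. f \<in> ?F \<and> inj_on f T \<and> f z = 0}"
  have pT: "\<rho> x \<in> T \<longleftrightarrow> x \<in> T" if "\<rho> permutes T" for \<rho> x using permutes_in_image[OF that] .
  have "real_of_int (sign \<rho>) * real (ncol0 K (P - T) P (a \<circ> \<rho>)) =
      (\<Sum>f\<in>?F. if \<forall>x\<in>P. f (a (\<rho> x)) = f x then real_of_int (sign \<rho>) else 0)" for \<rho>
  proof -
    have "{f \<in> P \<rightarrow>\<^sub>E {..<K}. (\<forall>x\<in>P \<inter> (P - T). f x = 0) \<and> (\<forall>x\<in>P. f ((a \<circ> \<rho>) x) = f x)} =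
        {f\<in>?F. \<forall>x\<in>P. f (a (\<rho> x)) = f x}" by auto
    then show ?thesis unfolding ncol0_def using fF by (simp add: sum.inter_filter[symmetric])
  qed
  then have "(\<Sum>\<rho> | \<rho> permutes T. real_of_int (sign \<rho>) * real (ncol0 K (P - T) P (a \<circ> \<rho>))) =
      (\<Sum>f\<in>?F. \<Sum>\<rho> | \<rho> permutes T. if \<forall>x\<in>P. f (a (\<rho> x)) = f x then real_of_int (sign \<rho>) else 0)"
    by (simp add: sum.swap[of _ "{\<rho>. \<rho> permutes T}"])
  also have "\<dots> = (\<Sum>f\<in>?F. h f)"
    unfolding h_def by (rule sum.cong[OF refl]) (simp add: sum.inter_filter[OF fS, symmetric])
  also have "\<dots> = (\<Sum>f | f \<in> ?F \<and> inj_on f T. h f)"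
  proof (rule sum.mono_neutral_right[OF fF])
    show "\<forall>f\<in>?F - {f. f \<in> ?F \<and> inj_on f T}. h f = 0"
    proof
      fix f assume "f \<in> ?F - {f. f \<in> ?F \<and> inj_on f T}"
      then obtain x y where xy: "x \<in> T" "y \<in> T" "x \<noteq> y" "f x = f y" by (auto simp: inj_on_def)
      let ?A = "{\<rho>. \<rho> permutes T \<and> (\<forall>x\<in>P. f (a (\<rho> x)) = f x)}"
      let ?t = "transpose x y"
      have t: "?t permutes T" using xy by (intro permutes_swap_id)
      have cl: "\<rho> \<circ> ?t \<in> ?A" if "\<rho> \<in> ?A" for \<rho>
        using that permutes_compose[OF t, of \<rho>] xy T by (auto simp: transpose_def)
      have sg: "sign (\<rho> \<circ> ?t) = - sign \<rho>" if "\<rho> \<in> ?A" for \<rho>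
        using that t fT xy by (subst sign_compose) (auto simp: sign_swap_id intro: permutes_imp_permutation)
      have "h f = (\<Sum>\<rho>\<in>?A. real_of_int (sign (\<rho> \<circ> ?t)))"
        unfolding h_def
        by (rule sum.reindex_bij_witness[where i = "\<lambda>\<rho>. \<rho> \<circ> ?t" and j = "\<lambda>\<rho>. \<rho> \<circ> ?t"])
           (use cl in \<open>auto simp: comp_assoc\<close>)
      also have "\<dots> = - h f" unfolding h_def using sg by (simp add: sum_negf[symmetric])
      finally show "h f = 0" by simp
    qed
  qed auto
  also have "\<dots> = sum ?s ?I"
  proof (rule sum.cong[OF refl])
    fix f assume f: "f \<in> {f. f \<in> ?F \<and> inj_on f T}"
    have ia: "inv a (a x) = x" "a (inv a x) = x" for x by (simp_all add: permutes_inverses[OF a])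
    have aP: "a x \<in> P \<longleftrightarrow> x \<in> P" for x using permutes_in_image[OF a] .
    \<comment> \<open>From left to right, \<open>a (\<rho> x)\<close> has a nonzero colour, hence
      lies in \<open>T\<close>, and injectivity identifies it with \<open>x\<close>. From right to
      left, if a point \<open>x\<close> of colour 0 were sent to some \<open>y\<close> of nonzero
      colour, then \<open>\<rho> y = inv a y = \<rho> x\<close> and so \<open>y = x\<close>.\<close>
    have "(\<forall>x\<in>P. f (a (\<rho> x)) = f x) \<longleftrightarrow> (\<forall>x\<in>T. f x \<noteq> 0 \<longrightarrow> \<rho> x = inv a x)"
      if \<rho>: "\<rho> permutes T" for \<rho>
    proof
      assume L: "\<forall>x\<in>P. f (a (\<rho> x)) = f x"
      show "\<forall>x\<in>T. f x \<noteq> 0 \<longrightarrow> \<rho> x = inv a x"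
      proof (intro ballI impI)
        fix x assume x: "x \<in> T" "f x \<noteq> 0"
        have e: "f (a (\<rho> x)) = f x" using L x T by auto
        have "a (\<rho> x) \<in> P" using x T pT[OF \<rho>] aP by auto
        then have "a (\<rho> x) \<in> T" using e x f by (metis (mono_tags, lifting) DiffI mem_Collect_eq)
        then have "a (\<rho> x) = x" using e x f by (auto dest: inj_onD)
        then show "\<rho> x = inv a x" using ia by metis
      qed
    next
      assume R: "\<forall>x\<in>T. f x \<noteq> 0 \<longrightarrow> \<rho> x = inv a x"
      show "\<forall>x\<in>P. f (a (\<rho> x)) = f x"
      proof
        fix x assume x: "x \<in> P"
        show "f (a (\<rho> x)) = f x"
        proof (cases "x \<in> T \<and> f x \<noteq> 0")
          case True
          then show ?thesis using R ia by auto
        next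
          case False
          then have f0: "f x = 0" using x f by auto
          let ?y = "a (\<rho> x)"
          have yP: "?y \<in> P" using x aP pT[OF \<rho>] T permutes_not_in[OF \<rho>] by (metis subsetD)
          have "\<not> (?y \<in> T \<and> f ?y \<noteq> 0)"
          proof
            assume y: "?y \<in> T \<and> f ?y \<noteq> 0"
            then have "\<rho> ?y = \<rho> x" using R ia by auto
            then have "?y = x" using permutes_inj[OF \<rho>] by (auto dest: injD)
            then show False using y f0 by simp
          qed
          then show ?thesis using f0 f yP by auto
        qed
      qed
    qed
    then show "h f = (\<Sum>\<rho> | \<rho> permutes T \<and> (\<forall>x\<in>T. f x \<noteq> 0 \<longrightarrow> \<rho> x = inv a x). real_of_int (sign \<rho>))"
      unfolding h_def by (intro sum.cong) auto
  qed
  also have "\<dots> = sum ?s ?N + (\<Sum>z\<in>T. sum ?s (?Cz z))"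
  proof -
    have fsub: "finite {f. f \<in> ?F \<and> Q f}" for Q by (rule rev_finite_subset[OF fF]) auto
    have "?I = ?N \<union> (\<Union>z\<in>T. ?Cz z)" by auto
    moreover have "sum ?s (\<Union>z\<in>T. ?Cz z) = (\<Sum>z\<in>T. sum ?s (?Cz z))"
    proof (rule sum.UNION_disjoint[OF fT])
      show "\<forall>z\<in>T. finite (?Cz z)" using fsub by auto
      show "\<forall>i\<in>T. \<forall>j\<in>T. i \<noteq> j \<longrightarrow> ?Cz i \<inter> ?Cz j = {}"
      proof (intro ballI impI equals0I)
        fix i j f assume "i \<in> T" "j \<in> T" "i \<noteq> j" "f \<in> ?Cz i \<inter> ?Cz j"
        then show False using inj_onD[of f T i j] by simp
      qed
    qed
    moreover have "sum ?s (?N \<union> (\<Union>z\<in>T. ?Cz z)) = sum ?s ?N + sum ?s (\<Union>z\<in>T. ?Cz z)"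
      by (rule sum.union_disjoint) (use fT fsub in \<open>simp_all add: disjoint_iff\<close>)
    ultimately show ?thesis by simp
  qed
  also have "sum ?s ?N = ffall (K - 1) (card T) * (\<Sum>\<rho>\<in>agree T (inv a). real_of_int (sign \<rho>))"
  proof -
    have "sum ?s ?N = (\<Sum>f\<in>?N. \<Sum>\<rho>\<in>agree T (inv a). real_of_int (sign \<rho>))"
      by (intro sum.cong refl) (auto simp: agree_def)
    moreover have "?N = {f \<in> P \<rightarrow>\<^sub>E {..<K}. (\<forall>x\<in>P - T. f x = 0) \<and> inj_on f T \<and> (\<forall>x\<in>T. f x \<noteq> 0)}" by auto
    ultimately show ?thesis using card_inj_colourings[OF P T K] by (auto simp: agree_def)
  qed
  also have "(\<Sum>z\<in>T. sum ?s (?Cz z)) = (\<Sum>z\<in>T. ffall (K - 1) (card T - 1) *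
      (\<Sum>\<rho> | \<rho> permutes T \<and> (\<forall>x\<in>T - {z}. \<rho> x = inv a x). real_of_int (sign \<rho>)))"
  proof (intro sum.cong refl)
    fix z assume z: "z \<in> T"
    have "sum ?s (?Cz z) = (\<Sum>f\<in>?Cz z. \<Sum>\<rho> | \<rho> permutes T \<and> (\<forall>x\<in>T - {z}. \<rho> x = inv a x). real_of_int (sign \<rho>))"
    proof (rule sum.cong[OF refl])
      fix f assume "f \<in> ?Cz z"
      then have "f x \<noteq> 0 \<longleftrightarrow> x \<noteq> z" if "x \<in> T" for x
        using z that inj_onD[of f T x z] by auto
      then show "?s f = (\<Sum>\<rho> | \<rho> permutes T \<and> (\<forall>x\<in>T - {z}. \<rho> x = inv a x). real_of_int (sign \<rho>))"
        by (intro sum.cong) auto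
    qed
    moreover have "?Cz z = {f \<in> P \<rightarrow>\<^sub>E {..<K}. (\<forall>x\<in>P - (T - {z}). f x = 0) \<and> inj_on f (T - {z}) \<and> (\<forall>x\<in>T - {z}. f x \<noteq> 0)}"
      (is "_ = ?Y")
    proof
      show "?Cz z \<subseteq> ?Y"
      proof
        fix f assume "f \<in> ?Cz z"
        then have f: "f \<in> P \<rightarrow>\<^sub>E {..<K}" "\<forall>x\<in>P - T. f x = 0" "inj_on f T" "f z = 0" by auto
        have nz: "\<forall>x\<in>T - {z}. f x \<noteq> 0"
        proof
          fix x assume "x \<in> T - {z}"
          then show "f x \<noteq> 0" using inj_onD[OF f(3), of x z] f(4) z by auto
        qed
        have zz: "\<forall>x\<in>P - (T - {z}). f x = 0" using f(2,4) by blast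
        have "inj_on f (T - {z})" using f(3) by (rule inj_on_subset) auto
        with f(1) nz zz show "f \<in> ?Y" by simp
      qed
      show "?Y \<subseteq> ?Cz z"
      proof
        fix f assume "f \<in> ?Y"
        then have f: "f \<in> P \<rightarrow>\<^sub>E {..<K}" "\<forall>x\<in>P - (T - {z}). f x = 0" "inj_on f (T - {z})"
          "\<forall>x\<in>T - {z}. f x \<noteq> 0" by auto
        have fz: "f z = 0" using z T f(2) by blast
        have "f z \<notin> f ` (T - {z} - {z})" using f(4) fz by (metis (no_types, lifting) DiffD1 imageE)
        then have "inj_on f (insert z (T - {z}))" using f(3) by (subst inj_on_insert) simp
        then have "inj_on f T" using z by (simp add: insert_absorb)
        moreover have "\<forall>x\<in>P - T. f x = 0" using f(2) by blast
        ultimately show "f \<in> ?Cz z" using f(1) fz by simp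
      qed
    qed
    moreover have "card (T - {z}) = card T - 1" using z fT by simp
    ultimately show "sum ?s (?Cz z) = ffall (K - 1) (card T - 1) *
      (\<Sum>\<rho> | \<rho> permutes T \<and> (\<forall>x\<in>T - {z}. \<rho> x = inv a x). real_of_int (sign \<rho>))"
      using card_inj_colourings[OF P _ K, of "T - {z}"] T by auto
  qed
  finally show ?thesis by (simp add: sum_distrib_left comp_def)
qed


subsection \<open>Hook characters\<close>

text \<open>\<open>ycoef S c \<beta>\<close> is the coefficient of \<open>y\<^sup>c\<close> in the product of \<open>1 - y\<^sup>j\<close> over the cycles of \<open>\<beta>\<close> on \<open>S\<close>, where \<open>j\<close> is
  the length of the cycle; the sum in \<open>rcoef\<close> is the second sum of \<open>sum_sign_ncol0\<close>.\<close>

definition ycoef :: "'a set \<Rightarrow> nat \<Rightarrow> ('a \<Rightarrow> 'a) \<Rightarrow> real" where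
  "ycoef S c \<beta> = (\<Sum>T | T \<subseteq> S \<and> card T = c. \<Sum>\<tau>\<in>agree T \<beta>. (-1) ^ c * real_of_int (sign \<tau>))"

definition rcoef :: "'a set \<Rightarrow> nat \<Rightarrow> ('a \<Rightarrow> 'a) \<Rightarrow> real" where
  "rcoef S c \<beta> = (-1) ^ c * (\<Sum>T | T \<subseteq> S \<and> card T = c. \<Sum>z\<in>T.
      \<Sum>\<rho> | \<rho> permutes T \<and> (\<forall>x\<in>T - {z}. \<rho> x = \<beta> x). real_of_int (sign \<rho>))"

text \<open>Moving the one point at which \<open>\<rho>\<close> may differ from \<open>b\<close> in or out of \<open>T\<close> is a sign-reversing
  correspondence between the terms with \<open>b ` T \<noteq> T\<close>.\<close>

lemma sum_sign_exit:
  assumes S: "finite S" and b: "b permutes S" and T: "T \<subseteq> S"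
  shows "(\<Sum>z\<in>S - T. \<Sum>\<rho> | \<rho> permutes insert z T \<and> (\<forall>x\<in>T. \<rho> x = b x). real_of_int (sign \<rho>)) +
    (\<Sum>z\<in>T. \<Sum>\<rho> | \<rho> permutes T \<and> (\<forall>x\<in>T - {z}. \<rho> x = b x). real_of_int (sign \<rho>)) =
    real (card S) * (\<Sum>\<rho>\<in>agree T b. real_of_int (sign \<rho>))"
proof -
  have fT: "finite T" using S T finite_subset by blast
  let ?s = "\<lambda>\<rho>. real_of_int (sign \<rho>)"
  let ?A = "\<Sum>\<rho>\<in>agree T b. ?s \<rho>"
  define E where "E z = {\<rho>. \<rho> permutes insert z T \<and> (\<forall>x\<in>T. \<rho> x = b x) \<and> \<rho> z \<noteq> z}" for z
  define I where "I z = {\<rho>. \<rho> permutes T \<and> (\<forall>x\<in>T - {z}. \<rho> x = b x) \<and> \<rho> z \<noteq> b z}" for z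
  have fp: "finite {\<rho>. \<rho> permutes insert z T}" "finite {\<rho>. \<rho> permutes T}" for z
    using fT by (simp_all add: finite_permutations)
  have fE: "finite (E z)" for z unfolding E_def by (rule rev_finite_subset[OF fp(1)[of z]]) auto
  have fI: "finite (I z)" for z unfolding I_def by (rule rev_finite_subset[OF fp(2)]) auto
  have fA: "finite (agree T b)" by (rule finite_agree[OF fT])
  have 1: "(\<Sum>\<rho> | \<rho> permutes insert z T \<and> (\<forall>x\<in>T. \<rho> x = b x). ?s \<rho>) = ?A + sum ?s (E z)"
    if z: "z \<in> S - T" for z
  proof -
    have "{\<rho>. \<rho> permutes insert z T \<and> (\<forall>x\<in>T. \<rho> x = b x)} = agree T b \<union> E z"
    proof (rule set_eqI)
      fix \<rho>
      have "\<rho> permutes T" if "\<rho> permutes insert z T" "\<rho> z = z"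
        by (rule permutes_superset[OF that(1)]) (use that(2) z in auto)
      moreover have "\<rho> permutes insert z T" if "\<rho> permutes T"
        by (rule permutes_subset[OF that]) auto
      ultimately show "\<rho> \<in> {\<rho>. \<rho> permutes insert z T \<and> (\<forall>x\<in>T. \<rho> x = b x)} \<longleftrightarrow> \<rho> \<in> agree T b \<union> E z"
        unfolding E_def agree_def by blast
    qed
    moreover have "agree T b \<inter> E z = {}"
      using z by (auto simp: agree_def E_def dest: permutes_not_in)
    ultimately show ?thesis using fA fE by (simp add: sum.union_disjoint)
  qed
  have 2: "(\<Sum>\<rho> | \<rho> permutes T \<and> (\<forall>x\<in>T - {z}. \<rho> x = b x). ?s \<rho>) = ?A + sum ?s (I z)"
    if z: "z \<in> T" for z
  proof -
    have "{\<rho>. \<rho> permutes T \<and> (\<forall>x\<in>T - {z}. \<rho> x = b x)} = agree T b \<union> I z"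
      using z by (auto simp: agree_def I_def)
    moreover have "agree T b \<inter> I z = {}"
      using z by (auto simp: agree_def I_def)
    ultimately show ?thesis using fA fI by (simp add: sum.union_disjoint)
  qed
  have binj: "b x = b y \<longleftrightarrow> x = y" for x y using permutes_inj[OF b] by (auto dest: injD)
  have "(\<Sum>z\<in>S - T. sum ?s (E z)) = (\<Sum>(z, \<rho>)\<in>Sigma (S - T) E. ?s \<rho>)"
    by (rule sum.Sigma) (use S fE in auto)
  \<comment> \<open>The cycle of \<open>\<rho>\<close> through \<open>z\<close> leaves
    \<open>T\<close> at a point \<open>w\<close> with \<open>b w = z\<close>. Cutting
    \<open>z\<close> out redirects \<open>w\<close> to \<open>\<rho> z\<close>, which costs one
    transposition and hence a sign. Conversely \<open>b w\<close> lies outside \<open>T\<close>,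
    because \<open>\<rho>\<close> agrees with \<open>b\<close> on all of \<open>T\<close> except
    \<open>w\<close>.\<close>
  also have "\<dots> = (\<Sum>(z, \<rho>)\<in>Sigma T I. - ?s \<rho>)"
  proof (rule sum.reindex_bij_witness[where j = "\<lambda>(z, \<rho>). (inv \<rho> z, transpose z (\<rho> z) \<circ> \<rho>)"
        and i = "\<lambda>(w, \<rho>). (b w, transpose (b w) (\<rho> w) \<circ> \<rho>)"])
    fix p assume p: "p \<in> Sigma (S - T) E"
    obtain z \<rho> where pz: "p = (z, \<rho>)" by (cases p)
    have h: "z \<in> S" "z \<notin> T" "\<rho> permutes insert z T" "\<And>x. x \<in> T \<Longrightarrow> \<rho> x = b x" "\<rho> z \<noteq> z"
      using p by (auto simp: pz E_def)
    have rinj: "\<rho> x = \<rho> y \<longleftrightarrow> x = y" for x y using permutes_inj[OF h(3)] by (auto dest: injD)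
    define w where "w = inv \<rho> z"
    have rw: "\<rho> w = z" by (simp add: w_def permutes_inverses[OF h(3)])
    have w: "w \<in> T" using permutes_in_image[OF h(3), of w] rw h(5) by auto
    have bw: "b w = z" using h(4)[OF w] rw by simp
    let ?r = "transpose z (\<rho> z) \<circ> \<rho>"
    have rr: "?r w = \<rho> z" using rw by simp
    have e: "transpose z (\<rho> z) \<circ> ?r = \<rho>" by (simp add: fun_eq_iff)
    show "(case case p of (z, \<rho>) \<Rightarrow> (inv \<rho> z, transpose z (\<rho> z) \<circ> \<rho>) of (w, \<rho>) \<Rightarrow> (b w, transpose (b w) (\<rho> w) \<circ> \<rho>)) = p"
      using e rr by (simp add: pz w_def[symmetric] bw)
    have "?r x = b x" if "x \<in> T - {w}" for x
    proof -
      have "\<rho> x \<noteq> z" using that rw rinj by auto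
      moreover have "\<rho> x \<noteq> \<rho> z" using that h(2) rinj by auto
      ultimately show ?thesis using h(4) that by (simp add: transpose_def)
    qed
    moreover have "?r permutes T" by (rule permutes_insert_lemma[OF h(3)])
    moreover have "?r w \<noteq> b w" unfolding rr bw by (rule h(5))
    ultimately show "(case p of (z, \<rho>) \<Rightarrow> (inv \<rho> z, transpose z (\<rho> z) \<circ> \<rho>)) \<in> Sigma T I"
      using w by (simp add: pz I_def w_def[symmetric])
    have "sign ?r = - sign \<rho>"
      using h(3,5) fT by (subst sign_compose)
        (auto simp: sign_swap_id permutation_swap_id intro: permutes_imp_permutation[of "insert z T"])
    then show "(case case p of (z, \<rho>) \<Rightarrow> (inv \<rho> z, transpose z (\<rho> z) \<circ> \<rho>) of (z, \<rho>) \<Rightarrow> - ?s \<rho>) = (case p of (z, \<rho>) \<Rightarrow> ?s \<rho>)"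
      by (simp add: pz)
  next
    fix p assume p: "p \<in> Sigma T I"
    obtain w \<rho> where pz: "p = (w, \<rho>)" by (cases p)
    have h: "w \<in> T" "\<rho> permutes T" "\<And>x. x \<in> T \<Longrightarrow> x \<noteq> w \<Longrightarrow> \<rho> x = b x" "\<rho> w \<noteq> b w"
      using p by (auto simp: pz I_def)
    have rinj: "\<rho> x = \<rho> y \<longleftrightarrow> x = y" for x y using permutes_inj[OF h(2)] by (auto dest: injD)
    have zT: "b w \<notin> T"
    proof
      assume "b w \<in> T"
      then obtain y where y: "y \<in> T" "\<rho> y = b w" by (metis h(2) imageE permutes_image)
      then have "y \<noteq> w" using h(4) by auto
      then show False using h(3)[OF y(1)] y(2) binj by auto
    qed
    have zS: "b w \<in> S" using permutes_in_image[OF b] h(1) T by auto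
    let ?r = "transpose (b w) (\<rho> w) \<circ> \<rho>"
    have rz: "?r (b w) = \<rho> w" using permutes_not_in[OF h(2) zT] by simp
    have rw: "?r w = b w" by simp
    have rx: "?r x = b x" if "x \<in> T" for x
    proof (cases "x = w")
      case False
      then have "\<rho> x \<noteq> b w" "\<rho> x \<noteq> \<rho> w" using h(3)[OF that] binj rinj by auto
      then show ?thesis using h(3)[OF that False] by (simp add: transpose_def)
    qed simp
    have rp: "?r permutes insert (b w) T"
      by (intro permutes_compose permutes_swap_id permutes_subset[OF h(2)])
         (use permutes_in_image[OF h(2)] h(1) in auto)
    have iw: "inv ?r (b w) = w" using rw permutes_inv_eq[OF rp] by metis
    show "(case case p of (w, \<rho>) \<Rightarrow> (b w, transpose (b w) (\<rho> w) \<circ> \<rho>) of (z, \<rho>) \<Rightarrow> (inv \<rho> z, transpose z (\<rho> z) \<circ> \<rho>)) = p"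
      unfolding pz prod.case iw rz by (simp add: fun_eq_iff)
    show "(case p of (w, \<rho>) \<Rightarrow> (b w, transpose (b w) (\<rho> w) \<circ> \<rho>)) \<in> Sigma (S - T) E"
      unfolding pz prod.case E_def using zT zS rp rx rz h(4) by simp
  qed
  also have "\<dots> = - (\<Sum>z\<in>T. sum ?s (I z))"
    by (subst sum.Sigma) (use fT fI in \<open>auto simp: sum_negf case_prod_unfold\<close>)
  finally have "(\<Sum>z\<in>S - T. sum ?s (E z)) = - (\<Sum>z\<in>T. sum ?s (I z))" .
  \<comment> \<open>Every point of \<open>S\<close>, inside or outside \<open>T\<close>, contributes
    the \<open>agree\<close> sum once; this is the origin of the factor
    \<open>card S\<close>.\<close>
  moreover have "card S = card (S - T) + card T"
    using S T fT by (simp add: card_Diff_subset card_mono)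
  ultimately show ?thesis
    by (simp add: 1 2 sum.distrib algebra_simps)
qed

text \<open>A set of size \<open>c + 1\<close> with a chosen point \<open>z\<close> is a set of size
  \<open>c\<close> with a point outside it, so summing \<open>sum_sign_exit\<close> over all sets of
  size \<open>c\<close> links consecutive values.\<close>

lemma rcoef_Suc:
  assumes S: "finite S" and b: "b permutes S"
  shows "rcoef S (Suc c) b = rcoef S c b - real (card S) * ycoef S c b"
proof -
  let ?s = "\<lambda>\<rho>. real_of_int (sign \<rho>)"
  let ?C = "\<lambda>c. {T. T \<subseteq> S \<and> card T = c}"
  have fC: "finite (?C c)" for c by (rule rev_finite_subset[OF finite_Pow_iff[THEN iffD2, OF S]]) auto
  have fin: "finite T" if "T \<subseteq> S" for T using S that finite_subset by blast
  have "(\<Sum>T\<in>?C (Suc c). \<Sum>z\<in>T. \<Sum>\<rho> | \<rho> permutes T \<and> (\<forall>x\<in>T - {z}. \<rho> x = b x). ?s \<rho>) =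
      (\<Sum>(T, z)\<in>(SIGMA T:?C (Suc c). T). \<Sum>\<rho> | \<rho> permutes T \<and> (\<forall>x\<in>T - {z}. \<rho> x = b x). ?s \<rho>)"
    by (rule sum.Sigma) (use fC fin in auto)
  also have "\<dots> = (\<Sum>(T, z)\<in>(SIGMA T:?C c. S - T). \<Sum>\<rho> | \<rho> permutes insert z T \<and> (\<forall>x\<in>T. \<rho> x = b x). ?s \<rho>)"
    by (rule sum.reindex_bij_witness[where j = "\<lambda>(T, z). (T - {z}, z)" and i = "\<lambda>(T, z). (insert z T, z)"])
       (auto simp: insert_absorb fin card_Diff_singleton card_insert_if)
  also have "\<dots> = (\<Sum>T\<in>?C c. \<Sum>z\<in>S - T. \<Sum>\<rho> | \<rho> permutes insert z T \<and> (\<forall>x\<in>T. \<rho> x = b x). ?s \<rho>)"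
    by (rule sum.Sigma[symmetric]) (use fC S in auto)
  also have "\<dots> = (\<Sum>T\<in>?C c. real (card S) * (\<Sum>\<rho>\<in>agree T b. ?s \<rho>) -
      (\<Sum>z\<in>T. \<Sum>\<rho> | \<rho> permutes T \<and> (\<forall>x\<in>T - {z}. \<rho> x = b x). ?s \<rho>))"
  proof (rule sum.cong[OF refl])
    fix T assume "T \<in> ?C c"
    then have "T \<subseteq> S" by simp
    from sum_sign_exit[OF S b this]
    show "(\<Sum>z\<in>S - T. \<Sum>\<rho> | \<rho> permutes insert z T \<and> (\<forall>x\<in>T. \<rho> x = b x). ?s \<rho>) =
        real (card S) * (\<Sum>\<rho>\<in>agree T b. ?s \<rho>) -
        (\<Sum>z\<in>T. \<Sum>\<rho> | \<rho> permutes T \<and> (\<forall>x\<in>T - {z}. \<rho> x = b x). ?s \<rho>)" by linarith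
  qed
  also have "\<dots> = real (card S) * (\<Sum>T\<in>?C c. \<Sum>\<rho>\<in>agree T b. ?s \<rho>) -
      (\<Sum>T\<in>?C c. \<Sum>z\<in>T. \<Sum>\<rho> | \<rho> permutes T \<and> (\<forall>x\<in>T - {z}. \<rho> x = b x). ?s \<rho>)"
    unfolding sum_subtractf sum_distrib_left ..
  finally have *: "(\<Sum>T\<in>?C (Suc c). \<Sum>z\<in>T. \<Sum>\<rho> | \<rho> permutes T \<and> (\<forall>x\<in>T - {z}. \<rho> x = b x). ?s \<rho>) = \<dots>" .
  have **: "ycoef S c b = (-1) ^ c * (\<Sum>T\<in>?C c. \<Sum>\<rho>\<in>agree T b. ?s \<rho>)"
    unfolding ycoef_def sum_distrib_left ..
  show ?thesis unfolding rcoef_def * ** by (simp add: algebra_simps)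
qed

lemma rcoef_eq:
  assumes S: "finite S" and b: "b permutes S"
  shows "rcoef S c b = - real (card S) * (\<Sum>j<c. ycoef S j b)"
proof (induction c)
  case 0
  have "{T. T \<subseteq> S \<and> card T = 0} = {{}}" using finite_subset[OF _ S] by auto
  then show ?case by (simp add: rcoef_def)
next
  case (Suc c)
  then show ?case by (simp add: rcoef_Suc[OF assms] algebra_simps)
qed

lemma ycoef_0: "finite S \<Longrightarrow> ycoef S 0 \<beta> = 1"
proof -
  assume S: "finite S"
  have "{T. T \<subseteq> S \<and> card T = 0} = {{}}" using finite_subset[OF _ S] by auto
  moreover have "agree {} \<beta> = {id}" by (auto simp: agree_def)
  ultimately show ?thesis by (simp add: ycoef_def)
qed

lemma no_large_subset: "finite S \<Longrightarrow> c > card S \<Longrightarrow> {T. T \<subseteq> S \<and> card T = c} = {}"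
  by (auto simp: not_le[symmetric] dest: card_mono)

lemma ycoef_gt: "finite S \<Longrightarrow> c > card S \<Longrightarrow> ycoef S c \<beta> = 0"
  by (simp only: ycoef_def no_large_subset sum.empty)

text \<open>The product of the factors \<open>1 - y^j\<close> vanishes at \<open>y = 1\<close>. This
  is read off from \<open>rcoef\<close>, whose defining sum is empty beyond
  \<open>card S\<close>.\<close>

lemma sum_ycoef:
  assumes "finite S" "b permutes S" "S \<noteq> {}"
  shows "(\<Sum>j\<le>card S. ycoef S j b) = 0"
proof -
  have "rcoef S (Suc (card S)) b = 0"
    using assms(1) by (simp only: rcoef_def no_large_subset lessI sum.empty mult_zero_right)
  then show ?thesis using rcoef_eq[OF assms(1,2), of "Suc (card S)"] assms
    by (simp add: lessThan_Suc_atMost)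
qed

lemma inv_agree:
  assumes "\<tau> \<in> agree T b" "bij b"
  shows "inv \<tau> \<in> agree T (inv b)"
proof -
  have \<tau>: "\<tau> permutes T" "\<And>x. x \<in> T \<Longrightarrow> \<tau> x = b x" using assms by (auto simp: agree_def)
  have "inv \<tau> x = inv b x" if "x \<in> T" for x
  proof -
    have "inv \<tau> x \<in> T" using permutes_in_image[OF permutes_inv[OF \<tau>(1)]] that by simp
    then have "b (inv \<tau> x) = x" using \<tau>(2) permutes_inverses(1)[OF \<tau>(1)] by metis
    then show ?thesis using inv_f_eq[OF bij_is_inj[OF assms(2)]] by metis
  qed
  with permutes_inv[OF \<tau>(1)] show ?thesis by (simp add: agree_def)
qed

lemma ycoef_inv:
  assumes S: "finite S" and b: "b permutes S"
  shows "ycoef S c (inv b) = ycoef S c b"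
  unfolding ycoef_def
proof (rule sum.cong[OF refl])
  fix T assume "T \<in> {T. T \<subseteq> S \<and> card T = c}"
  then have fT: "finite T" using finite_subset[OF _ S] by auto
  have bb: "bij b" "bij (inv b)" "inv (inv b) = b"
    using permutes_bij[OF b] permutes_bij[OF permutes_inv[OF b]] permutes_inv_inv[OF b] by auto
  have tt: "inv (inv \<tau>) = \<tau>" if "\<tau> \<in> agree T c" for \<tau> c
    using that permutes_inv_inv by (auto simp: agree_def)
  show "(\<Sum>\<tau>\<in>agree T (inv b). (-1) ^ c * real_of_int (sign \<tau>)) = (\<Sum>\<tau>\<in>agree T b. (-1) ^ c * real_of_int (sign \<tau>))"
  proof (rule sum.reindex_bij_witness[where i = inv and j = inv])
    fix \<tau> assume t: "\<tau> \<in> agree T (inv b)"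
    show "inv (inv \<tau>) = \<tau>" by (rule tt[OF t])
    show "inv \<tau> \<in> agree T b" using inv_agree[OF t bb(2)] bb(3) by simp
    show "(-1) ^ c * real_of_int (sign (inv \<tau>)) = (-1) ^ c * real_of_int (sign \<tau>)"
      using t fT by (subst sign_inverse) (auto simp: agree_def intro: permutes_imp_permutation)
  next
    fix \<tau> assume t: "\<tau> \<in> agree T b"
    show "inv (inv \<tau>) = \<tau>" by (rule tt[OF t])
    show "inv \<tau> \<in> agree T (inv b)" by (rule inv_agree[OF t bb(1)])
  qed
qed

lemma ffall_eq_pochhammer: "ffall m c = pochhammer (real m - real c + 1) c"
proof -
  have "ffall m c = (\<Prod>i<c. real m - real (c - Suc i))"
    unfolding ffall_def by (rule prod.nat_diff_reindex[symmetric])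
  also have "\<dots> = pochhammer (real m - real c + 1) c"
    unfolding pochhammer_prod atLeast0LessThan
    by (intro prod.cong) (auto simp: of_nat_diff Suc_le_eq)
  finally show ?thesis .
qed

text \<open>Partial sums are the coefficients after division by \<open>1 - y\<close>. The quotient
  is the generating function of the hook characters, with \<open>-y\<close> marking the leg
  length.\<close>

definition hook :: "'a set \<Rightarrow> nat \<Rightarrow> ('a \<Rightarrow> 'a) \<Rightarrow> real" where
  "hook S b \<beta> = (\<Sum>c\<le>b. ycoef S c \<beta>)"

definition hook_content :: "nat \<Rightarrow> nat \<Rightarrow> nat \<Rightarrow> real" where
  "hook_content K p b = pochhammer (real K - real b) p"

text \<open>A permutation counted by \<open>ycoef\<close> splits into \<open>\<tau>\<close> on an
  invariant set \<open>T\<close> and a part on \<open>P - T\<close>. Summing over the second part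
  gives a rising factorial and marks \<open>P - T\<close> with colour 0; the signed sum over
  \<open>\<tau>\<close> is then \<open>sum_sign_ncol0\<close>, whose two terms add up to
  \<open>ycoef\<close> and \<open>rcoef\<close> at \<open>inv a\<close>.\<close>

lemma sum_ycoef_ncol:
  assumes P: "finite P" and a: "a permutes P" and K: "K \<ge> 1" and c: "c \<le> card P"
  shows "(\<Sum>\<beta> | \<beta> permutes P. ycoef P c \<beta> * real (ncol K P (a \<circ> \<beta>))) =
    pochhammer (real K) (card P - c) *
      (ffall (K - 1) c * ycoef P c a - ffall (K - 1) (c - 1) * real (card P) * (\<Sum>j<c. ycoef P j a))"
proof -
  let ?s = "\<lambda>\<rho>. real_of_int (sign \<rho>)"
  let ?C = "{T. T \<subseteq> P \<and> card T = c}"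
  let ?D = "\<lambda>T. \<Sum>z\<in>T. \<Sum>\<rho> | \<rho> permutes T \<and> (\<forall>x\<in>T - {z}. \<rho> x = inv a x). ?s \<rho>"
  have "(\<Sum>\<beta> | \<beta> permutes P. ycoef P c \<beta> * real (ncol K P (a \<circ> \<beta>))) =
      (\<Sum>\<beta> | \<beta> permutes P. \<Sum>T\<in>?C. \<Sum>\<tau>\<in>agree T \<beta>. (-1) ^ c * ?s \<tau> * real (ncol K P (a \<circ> \<beta>)))"
    by (simp add: ycoef_def sum_distrib_right)
  also have "\<dots> = (\<Sum>T\<in>?C. \<Sum>\<beta> | \<beta> permutes P. \<Sum>\<tau>\<in>agree T \<beta>. (-1) ^ c * ?s \<tau> * real (ncol K P (a \<circ> \<beta>)))"
    by (rule sum.swap)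
  also have "\<dots> = (\<Sum>T\<in>?C. pochhammer (real K) (card P - c) *
      (ffall (K - 1) c * ((-1) ^ c * (\<Sum>\<rho>\<in>agree T (inv a). ?s \<rho>)) + ffall (K - 1) (c - 1) * ((-1) ^ c * ?D T)))"
  proof (rule sum.cong[OF refl])
    fix T assume "T \<in> ?C"
    then have T: "T \<subseteq> P" "card T = c" by auto
    have fT: "finite T" using T P finite_subset by blast
    have "(\<Sum>\<beta> | \<beta> permutes P. \<Sum>\<tau>\<in>agree T \<beta>. (-1) ^ c * ?s \<tau> * real (ncol K P (a \<circ> \<beta>))) =
        (\<Sum>\<tau> | \<tau> permutes T. \<Sum>\<beta> | \<beta> permutes P - T. (-1) ^ c * ?s \<tau> * real (ncol K P (a \<circ> (\<tau> \<circ> \<beta>))))"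
      by (rule sum_permutes_agree[OF P T(1)])
    also have "\<dots> = (\<Sum>\<tau> | \<tau> permutes T. (-1) ^ c * ?s \<tau> * (pochhammer (real K) (card P - c) * real (ncol0 K (P - T) P (a \<circ> \<tau>))))"
    proof (rule sum.cong[OF refl])
      fix \<tau> assume "\<tau> \<in> {\<tau>. \<tau> permutes T}"
      then have "a \<circ> \<tau> permutes P" using permutes_compose[OF permutes_subset[OF _ T(1)] a] by simp
      from sum_ncol_comp[OF P _ this K, of "P - T"]
      show "(\<Sum>\<beta> | \<beta> permutes P - T. (-1) ^ c * ?s \<tau> * real (ncol K P (a \<circ> (\<tau> \<circ> \<beta>)))) =
          (-1) ^ c * ?s \<tau> * (pochhammer (real K) (card P - c) * real (ncol0 K (P - T) P (a \<circ> \<tau>)))"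
        using T fT by (simp add: sum_distrib_left[symmetric] comp_assoc card_Diff_subset)
    qed
    also have "\<dots> = (-1) ^ c * pochhammer (real K) (card P - c) *
        (\<Sum>\<tau> | \<tau> permutes T. ?s \<tau> * real (ncol0 K (P - T) P (a \<circ> \<tau>)))"
      unfolding sum_distrib_left by (intro sum.cong refl) (simp only: mult_ac)
    finally show "(\<Sum>\<beta> | \<beta> permutes P. \<Sum>\<tau>\<in>agree T \<beta>. (-1) ^ c * ?s \<tau> * real (ncol K P (a \<circ> \<beta>))) =
        pochhammer (real K) (card P - c) *
      (ffall (K - 1) c * ((-1) ^ c * (\<Sum>\<rho>\<in>agree T (inv a). ?s \<rho>)) + ffall (K - 1) (c - 1) * ((-1) ^ c * ?D T))"
      unfolding sum_sign_ncol0[OF P T(1) a K] T(2) by (simp only: distrib_left mult_ac)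
  qed
  also have "\<dots> = pochhammer (real K) (card P - c) *
      (ffall (K - 1) c * ycoef P c (inv a) + ffall (K - 1) (c - 1) * rcoef P c (inv a))"
    unfolding ycoef_def rcoef_def sum_distrib_left[symmetric] sum.distrib ..
  also have "\<dots> = pochhammer (real K) (card P - c) *
      (ffall (K - 1) c * ycoef P c a - ffall (K - 1) (c - 1) * real (card P) * (\<Sum>j<c. ycoef P j a))"
    unfolding rcoef_eq[OF P permutes_inv[OF a]] ycoef_inv[OF P a] by simp
  finally show ?thesis .
qed

text \<open>Up to sign \<open>hook P b\<close> is the character of a hook shape with leg length \<open>b\<close>, and \<open>hook_content K (card P) b\<close> is the
  product of \<open>K\<close> plus the contents of its cells.\<close>

theorem sum_hook_ncol:
  assumes P: "finite P" and a: "a permutes P" and K: "K \<ge> 1" and b: "b < card P"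
  shows "(\<Sum>\<beta> | \<beta> permutes P. hook P b \<beta> * real (ncol K P (a \<circ> \<beta>))) = hook_content K (card P) b * hook P b a"
  using b
proof (induction b)
  case 0
  then show ?case using sum_ycoef_ncol[OF P a K, of 0]
    by (simp add: hook_def hook_content_def ffall_def comp_def)
next
  case (Suc b)
  \<comment> \<open>The common part of the content products for the legs \<open>b\<close> and
    \<open>b + 1\<close>: the longer leg has the factor \<open>K - (b + 1)\<close> in place of
    \<open>K + card P - (b + 1)\<close>. Their difference \<open>card P\<close> is what the second
    term of \<open>sum_ycoef_ncol\<close> supplies.\<close>
  let ?M = "pochhammer (real K - real b) b * pochhammer (real K) (card P - Suc b)"
  have f: "ffall (K - 1) b = pochhammer (real K - real b) b"
    using K by (simp add: ffall_eq_pochhammer of_nat_diff)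
  have f': "ffall (K - 1) (Suc b) = (real K - real (Suc b)) * pochhammer (real K - real b) b"
    using K by (simp add: ffall_eq_pochhammer of_nat_diff pochhammer_rec)
  have "hook_content K (card P) (Suc b) = pochhammer (real K - real (Suc b)) (Suc b + (card P - Suc b))"
    using Suc.prems by (simp add: hook_content_def)
  also have "\<dots> = (real K - real (Suc b)) * ?M"
    unfolding pochhammer_product' pochhammer_rec by simp
  finally have l1: "hook_content K (card P) (Suc b) = (real K - real (Suc b)) * ?M" .
  have "hook_content K (card P) b = pochhammer (real K - real b) (b + Suc (card P - Suc b))"
    using Suc.prems by (simp add: hook_content_def)
  also have "\<dots> = (real K + real (card P - Suc b)) * ?M"
    unfolding pochhammer_product' pochhammer_Suc by simp
  finally have l2: "hook_content K (card P) b = (real K + real (card P) - real (Suc b)) * ?M"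
    using Suc.prems by (simp add: of_nat_diff)
  have h: "hook P (Suc b) \<beta> = hook P b \<beta> + ycoef P (Suc b) \<beta>" for \<beta> by (simp add: hook_def)
  have "(\<Sum>\<beta> | \<beta> permutes P. hook P (Suc b) \<beta> * real (ncol K P (a \<circ> \<beta>))) =
      hook_content K (card P) b * hook P b a + (\<Sum>\<beta> | \<beta> permutes P. ycoef P (Suc b) \<beta> * real (ncol K P (a \<circ> \<beta>)))"
    using Suc by (simp add: h distrib_right sum.distrib comp_def)
  also have "(\<Sum>\<beta> | \<beta> permutes P. ycoef P (Suc b) \<beta> * real (ncol K P (a \<circ> \<beta>))) =
      ?M * ((real K - real (Suc b)) * ycoef P (Suc b) a - real (card P) * hook P b a)"
    unfolding sum_ycoef_ncol[OF P a K less_imp_le[OF Suc.prems]] diff_Suc_1 f f' lessThan_Suc_atMost hook_def[symmetric]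
    by (simp add: algebra_simps)
  finally show ?case unfolding h l1 l2 by (simp add: algebra_simps)
qed


section \<open>Generating polynomials of the hook functions\<close>

text \<open>On an invariant \<open>T\<close> this is \<open>-1\<close> to the number of cycles in
  \<open>T\<close>: a cycle of length \<open>j\<close> has sign \<open>(-1)^(j-1)\<close> and
  contributes \<open>(-1)^j\<close> to the power of \<open>-1\<close>.\<close>

definition isgn :: "'a set \<Rightarrow> ('a \<Rightarrow> 'a) \<Rightarrow> real" where
  "isgn T \<beta> = (\<Sum>\<tau>\<in>agree T \<beta>. (-1) ^ card T * real_of_int (sign \<tau>))"

text \<open>If \<open>\<beta>\<close> permutes the nonempty set \<open>S\<close>, then \<open>hookpoly S \<beta>\<close> is the quotient of \<open>cycpoly S \<beta>\<close> by \<open>1 - y\<close>.\<close>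

definition cycpoly :: "'a set \<Rightarrow> ('a \<Rightarrow> 'a) \<Rightarrow> real poly" where
  "cycpoly S \<beta> = (\<Sum>T\<in>Pow S. monom (isgn T \<beta>) (card T))"

definition hookpoly :: "'a set \<Rightarrow> ('a \<Rightarrow> 'a) \<Rightarrow> real poly" where
  "hookpoly S \<beta> = (\<Sum>b<card S. monom (hook S b \<beta>) b)"

lemma coeff_cycpoly: "finite S \<Longrightarrow> coeff (cycpoly S \<beta>) c = ycoef S c \<beta>"
proof -
  assume S: "finite S"
  have "coeff (cycpoly S \<beta>) c = (\<Sum>T\<in>Pow S. if card T = c then isgn T \<beta> else 0)"
    by (simp add: cycpoly_def coeff_sum)
  also have "\<dots> = (\<Sum>T\<in>{T\<in>Pow S. card T = c}. isgn T \<beta>)"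
    using S by (simp only: sum.inter_filter finite_Pow_iff)
  also have "\<dots> = ycoef S c \<beta>"
    unfolding ycoef_def isgn_def by (rule sum.cong) auto
  finally show ?thesis .
qed

lemma coeff_hookpoly: "coeff (hookpoly S \<beta>) b = (if b < card S then hook S b \<beta> else 0)"
  by (simp add: hookpoly_def coeff_sum)

lemma degree_cycpoly: "finite S \<Longrightarrow> degree (cycpoly S \<beta>) \<le> card S"
  by (rule degree_le) (simp add: coeff_cycpoly ycoef_gt)

lemma agree_cong: "(\<And>x. x \<in> T \<Longrightarrow> \<beta> x = \<beta>' x) \<Longrightarrow> agree T \<beta> = agree T \<beta>'"
  by (auto simp: agree_def)

lemma isgn_cong: "(\<And>x. x \<in> T \<Longrightarrow> \<beta> x = \<beta>' x) \<Longrightarrow> isgn T \<beta> = isgn T \<beta>'"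
  unfolding isgn_def using agree_cong[of T \<beta> \<beta>'] by simp

lemma cycpoly_cong: "(\<And>x. x \<in> S \<Longrightarrow> \<beta> x = \<beta>' x) \<Longrightarrow> cycpoly S \<beta> = cycpoly S \<beta>'"
  unfolding cycpoly_def by (intro sum.cong refl arg_cong2[where f = monom] isgn_cong) auto

lemma coeff_one_minus_mult: "coeff ([:1, -1:] * f) c = coeff f c - (if c = 0 then 0 else coeff f (c - 1))"
  for f :: "'b::comm_ring_1 poly"
  by (cases c) (simp_all add: mult_pCons_left)

lemma cycpoly_eq_hookpoly:
  assumes "finite S" "\<beta> permutes S" "S \<noteq> {}"
  shows "cycpoly S \<beta> = [:1, -1:] * hookpoly S \<beta>"
proof (rule poly_eqI)
  fix c
  have p: "card S > 0" using assms by (simp add: card_gt_0_iff)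
  \<comment> \<open>The last partial sum is the value at \<open>y = 1\<close>; its vanishing makes
    the division by \<open>1 - y\<close> exact.\<close>
  have s: "hook S (card S) \<beta> = 0" using sum_ycoef[OF assms] by (simp add: hook_def)
  have h: "hook S c \<beta> = hook S (c - 1) \<beta> + ycoef S c \<beta>" if "c > 0"
    using that by (cases c) (auto simp: hook_def)
  show "coeff (cycpoly S \<beta>) c = coeff ([:1, -1:] * hookpoly S \<beta>) c"
    unfolding coeff_cycpoly[OF assms(1)] coeff_one_minus_mult coeff_hookpoly
  proof (cases "c = 0")
    case True
    then show "ycoef S c \<beta> = (if c < card S then hook S c \<beta> else 0) -
       (if c = 0 then 0 else if c - 1 < card S then hook S (c - 1) \<beta> else 0)"
      using p by (simp add: hook_def)
  next
    case False
    then show "ycoef S c \<beta> = (if c < card S then hook S c \<beta> else 0) -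
       (if c = 0 then 0 else if c - 1 < card S then hook S (c - 1) \<beta> else 0)"
      using h s ycoef_gt[OF assms(1), of c \<beta>] by (cases "c < card S"; cases "c = card S") auto
  qed
qed

lemma agree_eq:
  assumes "finite T" "inj_on \<beta> T"
  shows "agree T \<beta> = (if \<beta> ` T = T then {perm_restrict \<beta> T} else {})"
proof -
  have e: "\<tau> = perm_restrict \<beta> T" "\<beta> ` T = T" if "\<tau> \<in> agree T \<beta>" for \<tau>
  proof -
    have t: "\<tau> permutes T" "\<forall>x\<in>T. \<tau> x = \<beta> x" using that by (auto simp: agree_def)
    show "\<tau> = perm_restrict \<beta> T" using t permutes_not_in[OF t(1)] by (auto simp: perm_restrict_def)
    show "\<beta> ` T = T" using t permutes_image[OF t(1)] by (metis image_cong)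
  qed
  have "perm_restrict \<beta> T \<in> agree T \<beta>" if "\<beta> ` T = T"
  proof -
    have "bij_betw (perm_restrict \<beta> T) T T"
      using assms(2) that by (simp add: bij_betw_def perm_restrict_def inj_on_def)
    then have "perm_restrict \<beta> T permutes T"
      by (rule bij_imp_permutes) (simp add: perm_restrict_def)
    then show ?thesis by (simp add: agree_def perm_restrict_def)
  qed
  with e show ?thesis by auto
qed

lemma perm_restrict_permutes:
  assumes "inj_on \<beta> T" "\<beta> ` T = T"
  shows "perm_restrict \<beta> T permutes T"
proof (rule bij_imp_permutes)
  show "bij_betw (perm_restrict \<beta> T) T T"
    using assms by (simp add: bij_betw_def perm_restrict_def inj_on_def)
qed (simp add: perm_restrict_def)

lemma isgn_eq:
  assumes "finite T" "inj_on \<beta> T"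
  shows "isgn T \<beta> = (if \<beta> ` T = T then (-1) ^ card T * real_of_int (sign (perm_restrict \<beta> T)) else 0)"
  unfolding isgn_def agree_eq[OF assms] by simp

text \<open>No point of either part is mapped into the other, so the union is invariant only if both
  parts are.\<close>

lemma isgn_Un:
  assumes "finite A" "finite B" "A \<inter> B = {}" "inj_on \<beta> (A \<union> B)" "\<beta> ` A \<inter> B = {}" "\<beta> ` B \<inter> A = {}"
  shows "isgn (A \<union> B) \<beta> = isgn A \<beta> * isgn B \<beta>"
proof -
  have inj: "inj_on \<beta> A" "inj_on \<beta> B" using assms(4) by (auto intro: inj_on_subset)
  have im: "\<beta> ` (A \<union> B) = A \<union> B \<longleftrightarrow> \<beta> ` A = A \<and> \<beta> ` B = B"
    using assms(3,5,6) by blast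
  show ?thesis
  proof (cases "\<beta> ` A = A \<and> \<beta> ` B = B")
    case True
    then have pr: "perm_restrict \<beta> A permutes A" "perm_restrict \<beta> B permutes B"
      using perm_restrict_permutes inj by auto
    have "sign (perm_restrict \<beta> (A \<union> B)) = sign (perm_restrict \<beta> A) * sign (perm_restrict \<beta> B)"
      unfolding perm_restrict_union[OF pr assms(3), symmetric]
      using pr assms(1,2) by (intro sign_compose permutes_imp_permutation)
    then show ?thesis
      using True im assms(1-3) inj assms(4) by (simp add: isgn_eq card_Un_disjoint power_add)
  next
    case False
    then show ?thesis using im assms(1-3) inj assms(4) by (auto simp: isgn_eq)
  qed
qed

lemma sum_Pow_Un:
  fixes g :: "'a set \<Rightarrow> 'b::comm_monoid_add"
  assumes "finite A" "finite B" "A \<inter> B = {}"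
  shows "(\<Sum>T\<in>Pow (A \<union> B). g T) = (\<Sum>T\<in>Pow A. \<Sum>U\<in>Pow B. g (T \<union> U))"
proof -
  have "(\<Sum>T\<in>Pow (A \<union> B). g T) = (\<Sum>(T, U)\<in>Pow A \<times> Pow B. g (T \<union> U))"
    by (rule sum.reindex_bij_witness[where j = "\<lambda>T. (T \<inter> A, T \<inter> B)" and i = "\<lambda>(T, U). T \<union> U"])
       (use assms(3) in \<open>auto intro!: arg_cong[where f = g]\<close>)
  then show ?thesis by (simp add: sum.cartesian_product)
qed

lemma cycpoly_Un:
  assumes "finite A" "finite B" "A \<inter> B = {}" "inj_on \<beta> (A \<union> B)" "\<beta> ` A \<subseteq> A" "\<beta> ` B \<subseteq> B"
  shows "cycpoly (A \<union> B) \<beta> = cycpoly A \<beta> * cycpoly B \<beta>"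
proof -
  have "cycpoly (A \<union> B) \<beta> = (\<Sum>T\<in>Pow A. \<Sum>U\<in>Pow B. monom (isgn (T \<union> U) \<beta>) (card (T \<union> U)))"
    unfolding cycpoly_def by (rule sum_Pow_Un[OF assms(1-3)])
  also have "\<dots> = (\<Sum>T\<in>Pow A. \<Sum>U\<in>Pow B. monom (isgn T \<beta>) (card T) * monom (isgn U \<beta>) (card U))"
  proof (intro sum.cong refl)
    fix T U assume TU: "T \<in> Pow A" "U \<in> Pow B"
    then have f: "finite T" "finite U" "T \<inter> U = {}" using assms(1-3) finite_subset by blast+
    have "isgn (T \<union> U) \<beta> = isgn T \<beta> * isgn U \<beta>"
    proof (rule isgn_Un[OF f])
      show "inj_on \<beta> (T \<union> U)" using TU by (intro inj_on_subset[OF assms(4)]) auto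
      show "\<beta> ` T \<inter> U = {}" using TU assms(3,5) by blast
      show "\<beta> ` U \<inter> T = {}" using TU assms(3,6) by blast
    qed
    then show "monom (isgn (T \<union> U) \<beta>) (card (T \<union> U)) = monom (isgn T \<beta>) (card T) * monom (isgn U \<beta>) (card U)"
      using f by (simp add: mult_monom card_Un_disjoint)
  qed
  also have "\<dots> = cycpoly A \<beta> * cycpoly B \<beta>" by (simp add: cycpoly_def sum_product)
  finally show ?thesis .
qed

lemma isgn_conj:
  assumes t: "permutation t" and "finite T" "inj \<beta>"
  shows "isgn (t ` T) (t \<circ> \<beta> \<circ> inv t) = isgn T \<beta>"
proof -
  have bt: "bij t" by (rule permutation_bijective[OF t])
  have it: "inv t (t x) = x" "t (inv t x) = x" for x
    using bt by (simp_all add: bij_def surj_f_inv_f)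
  have "inj (t \<circ> \<beta> \<circ> inv t)"
    by (intro inj_compose bij_is_inj bt assms(3) bij_imp_bij_inv)
  then have inj: "inj_on \<beta> T" "inj_on (t \<circ> \<beta> \<circ> inv t) (t ` T)"
    using assms(3) by (auto intro: inj_on_subset)
  have im: "(t \<circ> \<beta> \<circ> inv t) ` t ` T = t ` T \<longleftrightarrow> \<beta> ` T = T"
  proof -
    have "(t \<circ> \<beta> \<circ> inv t) ` t ` T = t ` (\<beta> ` T)" by (simp add: image_image it)
    then show ?thesis using inj_image_eq_iff[OF bij_is_inj[OF bt]] by simp
  qed
  have mem: "x \<in> t ` T \<longleftrightarrow> inv t x \<in> T" for x by (metis it image_iff)
  have "perm_restrict (t \<circ> \<beta> \<circ> inv t) (t ` T) = t \<circ> perm_restrict \<beta> T \<circ> inv t"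
    by (auto simp: fun_eq_iff perm_restrict_def mem it)
  moreover have "sign (t \<circ> perm_restrict \<beta> T \<circ> inv t) = sign (perm_restrict \<beta> T)" if "\<beta> ` T = T"
  proof -
    have p: "permutation (perm_restrict \<beta> T)"
      using perm_restrict_permutes[OF inj(1) that] assms(2) by (auto intro: permutes_imp_permutation)
    show ?thesis
      using t p by (simp add: sign_compose permutation_compose permutation_inverse sign_inverse)
  qed
  ultimately show ?thesis
    using assms(2) inj im card_image[OF inj_on_subset[OF bij_is_inj[OF bt] subset_UNIV], of T]
    by (simp add: isgn_eq)
qed

text \<open>\<open>t\<close> may move \<open>S\<close>: in the leaf step it is the matching, which
  carries a permutation of points of the leaf to the matched points of the neighbour.\<close>

lemma cycpoly_conj:
  assumes t: "permutation t" and "finite S" "inj \<beta>"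
  shows "cycpoly (t ` S) (t \<circ> \<beta> \<circ> inv t) = cycpoly S \<beta>"
proof -
  have it: "inj t" using permutation_bijective[OF t] by (simp add: bij_def)
  have "cycpoly (t ` S) (t \<circ> \<beta> \<circ> inv t) = (\<Sum>T\<in>Pow S. monom (isgn (t ` T) (t \<circ> \<beta> \<circ> inv t)) (card (t ` T)))"
    unfolding cycpoly_def image_Pow_surj[OF refl, symmetric]
    by (subst sum.reindex) (use it in \<open>auto simp: inj_on_def inj_image_eq_iff\<close>)
  also have "\<dots> = cycpoly S \<beta>"
    unfolding cycpoly_def
  proof (rule sum.cong[OF refl])
    fix T assume "T \<in> Pow S"
    then have "finite T" using assms(2) finite_subset by auto
    then show "monom (isgn (t ` T) (t \<circ> \<beta> \<circ> inv t)) (card (t ` T)) = monom (isgn T \<beta>) (card T)"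
      using isgn_conj[OF t _ assms(3)] card_image[OF inj_on_subset[OF it subset_UNIV], of T] by simp
  qed
  finally show ?thesis .
qed

lemma hook_conj:
  assumes t: "permutation t" and S: "finite S" "inj \<beta>"
  shows "hook (t ` S) b (t \<circ> \<beta> \<circ> inv t) = hook S b \<beta>"
  unfolding hook_def coeff_cycpoly[OF S(1), symmetric] coeff_cycpoly[OF finite_imageI[OF S(1)], symmetric]
    cycpoly_conj[OF assms] ..

section \<open>Full cycles and their conjugates\<close>

lemma cyclic_invariant:
  assumes "cyclic_on \<beta> P" "T \<subseteq> P" "\<beta> ` T \<subseteq> T"
  shows "T = {} \<or> T = P"
proof (rule disjCI)
  assume "T \<noteq> P"
  show "T = {}"
  proof (rule ccontr)
    assume "T \<noteq> {}"
    then obtain x where x: "x \<in> T" by auto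
    have "y \<in> T" if "y \<in> orbit \<beta> x" for y
      using that by induction (use x assms(3) in auto)
    then have "P \<subseteq> T" using orbit_cyclic_eq3[OF assms(1), of x] x assms(2) by auto
    with \<open>T \<noteq> P\<close> assms(2) show False by auto
  qed
qed

text \<open>The only invariant subsets are the empty set and \<open>P\<close>, so the product is
  \<open>1 - y^p\<close>, and all coefficients of its quotient by \<open>1 - y\<close> are
  1.\<close>

lemma hook_cyclic:
  assumes P: "finite P" and \<beta>: "\<beta> permutes P" and c: "cyclic_on \<beta> P" and b: "b < card P"
  shows "hook P b \<beta> = 1"
proof -
  have "ycoef P j \<beta> = 0" if j: "0 < j" "j < card P" for j
  proof -
    have "isgn T \<beta> = 0" if T: "T \<subseteq> P" "card T = j" for T
    proof -
      have "T \<noteq> {}" "T \<noteq> P" using T j by auto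
      then have "\<beta> ` T \<noteq> T" using cyclic_invariant[OF c T(1)] by auto
      then show ?thesis
        using isgn_eq[OF finite_subset[OF T(1) P] permutes_inj_on[OF \<beta>]] by simp
    qed
    then have "(\<Sum>T | T \<subseteq> P \<and> card T = j. isgn T \<beta>) = 0" by (intro sum.neutral) auto
    moreover have "ycoef P j \<beta> = (\<Sum>T | T \<subseteq> P \<and> card T = j. isgn T \<beta>)"
      unfolding ycoef_def isgn_def by (rule sum.cong) auto
    ultimately show ?thesis by simp
  qed
  then have "hook P b \<beta> = (\<Sum>j\<le>b. if j = 0 then 1 else 0)"
    unfolding hook_def using b ycoef_0[OF P] by (intro sum.cong) auto
  then show ?thesis by simp
qed

text \<open>This writes the indicator of full cycles through hook functions: a second cycle leaves
  another factor \<open>1 - y\<close> in the quotient. The value \<open>card P\<close> in place of 1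
  is the number of ways to conjugate one full cycle into another.\<close>

lemma poly_hookpoly_1:
  assumes P: "finite P" "P \<noteq> {}" and \<beta>: "\<beta> permutes P"
  shows "poly (hookpoly P \<beta>) 1 = (if cyclic_on \<beta> P then real (card P) else 0)"
proof (cases "cyclic_on \<beta> P")
  case True
  then show ?thesis
    by (simp add: hookpoly_def poly_sum poly_monom hook_cyclic[OF P(1) \<beta>])
next
  case False
  obtain x where x: "x \<in> P" using P by auto
  define A where "A = orbit \<beta> x"
  define B where "B = P - A"
  have pe: "permutation \<beta>" using \<beta> P by (auto intro: permutes_imp_permutation)
  have cA: "cyclic_on \<beta> A" unfolding A_def by (rule cyclic_on_orbit[OF \<beta> P(1)])
  have A: "A \<subseteq> P" unfolding A_def by (rule permutes_orbit_subset[OF \<beta> x])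
  have fA: "finite A" and fB: "finite B" using A P B_def finite_subset by auto
  have xA: "x \<in> A" unfolding A_def by (rule permutation_self_in_orbit[OF pe])
  have "A \<noteq> P" using cA False by auto
  then have B: "B \<noteq> {}" "A \<inter> B = {}" "A \<union> B = P" using A B_def by auto
  have iA: "\<beta> ` A \<subseteq> A" using cyclic_on_inI[OF cA] by auto
  have iB: "\<beta> ` B \<subseteq> B"
    using cyclic_on_f_in[OF \<beta> cA] permutes_in_image[OF \<beta>] B_def by auto
  have inj: "inj_on \<beta> X" for X using permutes_inj_on[OF \<beta>] .
  have eA: "\<beta> ` A = A" and eB: "\<beta> ` B = B"
    using endo_inj_surj[OF fA iA inj] endo_inj_surj[OF fB iB inj] by auto
  let ?a = "perm_restrict \<beta> A" and ?b = "perm_restrict \<beta> B"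
  have "[:1, -1:] * hookpoly P \<beta> = cycpoly P \<beta>" using cycpoly_eq_hookpoly[OF P(1) \<beta> P(2)] by simp
  also have "\<dots> = cycpoly A \<beta> * cycpoly B \<beta>"
    using cycpoly_Un[OF fA fB B(2) inj iA iB] B(3) by simp
  also have "cycpoly A \<beta> = cycpoly A ?a" by (rule cycpoly_cong) (simp add: perm_restrict_def)
  also have "\<dots> = [:1, -1:] * hookpoly A ?a"
    using cycpoly_eq_hookpoly[OF fA perm_restrict_permutes[OF inj eA]] xA by auto
  also have "cycpoly B \<beta> = cycpoly B ?b" by (rule cycpoly_cong) (simp add: perm_restrict_def)
  also have "\<dots> = [:1, -1:] * hookpoly B ?b"
    using cycpoly_eq_hookpoly[OF fB perm_restrict_permutes[OF inj eB] B(1)] .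
  finally have "[:1, -1:] * hookpoly P \<beta> = [:1, -1:] * ([:1, -1:] * hookpoly A ?a * hookpoly B ?b)"
    by (simp only: mult_ac)
  then have "hookpoly P \<beta> = [:1, -1:] * hookpoly A ?a * hookpoly B ?b"
    by (subst (asm) mult_left_cancel) auto
  then show ?thesis using False by simp
qed

lemma cyclic_funpow_eq:
  assumes f: "permutation f" and c: "cyclic_on f P" and x: "x \<in> P"
  shows "(f ^^ m) x = (f ^^ n) x \<longleftrightarrow> m mod card P = n mod card P"
proof -
  let ?d = "least_power f x"
  have d: "(f ^^ ?d) x = x" "?d > 0" using least_power_of_permutation[OF f] by auto
  have dist: "distinct (support f x)" by (rule cycle_of_permutation[OF f])
  have "set (support f x) = orbit f x"
    unfolding support_set[OF f] orbit_altdef_permutation[OF f] by auto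
  then have "set (support f x) = P" using orbit_cyclic_eq3[OF c x] by simp
  then have card: "card P = ?d" using distinct_card[OF dist] by simp
  have *: "(f ^^ i) x = (f ^^ j) x \<longleftrightarrow> i = j" if "i < ?d" "j < ?d" for i j
    using nth_eq_iff_index_eq[OF dist, of i j] that by simp
  have "(f ^^ m) x = (f ^^ n) x \<longleftrightarrow> (f ^^ (m mod ?d)) x = (f ^^ (n mod ?d)) x"
    by (simp only: funpow_mod_eq[OF d(1)])
  also have "\<dots> \<longleftrightarrow> m mod ?d = n mod ?d" using d(2) by (intro *) auto
  finally show ?thesis by (simp add: card)
qed

text \<open>If \<open>\<beta>\<close> is a full cycle, then a conjugator is determined by its value
  at one point \<open>x\<close>, and this value may be any point of \<open>P\<close>.\<close>

lemma card_cyclic_conj: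
  assumes P: "finite P" "P \<noteq> {}" and g: "g permutes P" "cyclic_on g P" and \<beta>: "\<beta> permutes P"
  shows "card {t. t permutes P \<and> inv t \<circ> g \<circ> t = \<beta>} = (if cyclic_on \<beta> P then card P else 0)"
proof (cases "cyclic_on \<beta> P")
  case False
  have "cyclic_on \<beta> P" if t: "t permutes P" "inv t \<circ> g \<circ> t = \<beta>" for t
  proof -
    have "cyclic_on \<beta> (inv t ` P)"
    proof (rule cyclic_on_image[OF g(2)])
      fix z
      show "\<beta> (inv t z) = inv t (g z)"
        unfolding t(2)[symmetric] by (simp add: permutes_inverses[OF t(1)])
    qed
    then show ?thesis using permutes_image[OF permutes_inv[OF t(1)]] by simp
  qed
  then have "{t. t permutes P \<and> inv t \<circ> g \<circ> t = \<beta>} = {}" using False by blast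
  then show ?thesis using False by (simp only: card.empty if_False)
next
  case True
  have pg: "permutation g" "permutation \<beta>" using g \<beta> P by (auto intro: permutes_imp_permutation)
  obtain x where x: "x \<in> P" using P by auto
  have eqv: "inv t \<circ> g \<circ> t = \<beta> \<longleftrightarrow> (\<forall>z. g (t z) = t (\<beta> z))" if t: "t permutes P" for t
  proof
    assume "inv t \<circ> g \<circ> t = \<beta>"
    then have "t (inv t (g (t z))) = t (\<beta> z)" for z by (metis comp_apply)
    then show "\<forall>z. g (t z) = t (\<beta> z)" by (simp add: permutes_inverses[OF t])
  qed (simp add: fun_eq_iff permutes_inverses[OF t])
  have orb: "\<exists>n. z = (\<beta> ^^ n) x" if "z \<in> P" for z
    using orbit_cyclic_eq3[OF True x] orbit_altdef_permutation[OF pg(2), of x] that by auto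
  have "bij_betw (\<lambda>t. t x) {t. t permutes P \<and> inv t \<circ> g \<circ> t = \<beta>} P"
  proof (rule bij_betwI')
    fix t u assume t: "t \<in> {t. t permutes P \<and> inv t \<circ> g \<circ> t = \<beta>}" and u: "u \<in> {t. t permutes P \<and> inv t \<circ> g \<circ> t = \<beta>}"
    show "t x = u x \<longleftrightarrow> t = u"
    proof
      assume e: "t x = u x"
      have ind: "t ((\<beta> ^^ n) x) = (g ^^ n) (t x)" if "t \<in> {t. t permutes P \<and> inv t \<circ> g \<circ> t = \<beta>}" for t n
      proof (induction n)
        case (Suc n)
        have "g (t z) = t (\<beta> z)" for z using that eqv by blast
        with Suc show ?case by (metis comp_apply funpow.simps(2))
      qed simp
      show "t = u"
      proof
        fix z show "t z = u z"
        proof (cases "z \<in> P")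
          case True
          then show ?thesis using orb ind[OF t] ind[OF u] e by metis
        next
          case False
          then show ?thesis
            using t u permutes_not_in[of t P z] permutes_not_in[of u P z] by simp
        qed
      qed
    qed simp
  next
    fix t assume "t \<in> {t. t permutes P \<and> inv t \<circ> g \<circ> t = \<beta>}"
    then show "t x \<in> P" using x permutes_in_image by fastforce
  next
    fix y assume y: "y \<in> P"
    \<comment> \<open>A conjugator with \<open>t x = y\<close> must send the \<open>n\<close>-th
      iterate of \<open>x\<close> under \<open>\<beta>\<close> to the \<open>n\<close>-th iterate of
      \<open>y\<close> under \<open>g\<close>. The choice of \<open>n\<close> is immaterial because
      both cycles have length \<open>card P\<close>.\<close>
    define t where "t z = (if z \<in> P then (g ^^ (SOME n. z = (\<beta> ^^ n) x)) y else z)" for z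
    have gP: "(g ^^ n) y \<in> P" for n using cyclic_on_funpow_in[OF g(2) y] .
    have \<beta>P: "(\<beta> ^^ n) x \<in> P" for n using cyclic_on_funpow_in[OF True x] .
    have t: "t ((\<beta> ^^ n) x) = (g ^^ n) y" for n
    proof -
      have "(\<beta> ^^ n) x = (\<beta> ^^ (SOME m. (\<beta> ^^ n) x = (\<beta> ^^ m) x)) x" by (rule someI) simp
      then show ?thesis
        unfolding t_def using \<beta>P cyclic_funpow_eq[OF pg(2) True x] cyclic_funpow_eq[OF pg(1) g(2) y] by metis
    qed
    have "inj_on t P"
    proof (rule inj_onI)
      fix z w assume "z \<in> P" "w \<in> P" "t z = t w"
      then show "z = w"
        using orb t cyclic_funpow_eq[OF pg(2) True x] cyclic_funpow_eq[OF pg(1) g(2) y] by metis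
    qed
    moreover have "t ` P \<subseteq> P" using gP by (auto simp: t_def)
    moreover have tn: "t z = z" if "z \<notin> P" for z using that by (simp add: t_def)
    ultimately have tp: "t permutes P" using P(1) by (intro inj_imp_permutes) auto
    have "g (t z) = t (\<beta> z)" for z
    proof (cases "z \<in> P")
      case z: True
      then obtain n where "z = (\<beta> ^^ n) x" using orb by blast
      then show ?thesis using t[of n] t[of "Suc n"] by simp
    next
      case False
      then show ?thesis by (simp add: tn permutes_not_in[OF g(1)] permutes_not_in[OF \<beta>])
    qed
    then have "t \<in> {t. t permutes P \<and> inv t \<circ> g \<circ> t = \<beta>}" using tp eqv by blast
    moreover have "t x = y" using t[of 0] by simp
    ultimately show "\<exists>t\<in>{t. t permutes P \<and> inv t \<circ> g \<circ> t = \<beta>}. y = t x" by blast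
  qed
  then show ?thesis using True by (simp add: bij_betw_same_card)
qed

lemma sum_cyclic_conj:
  fixes h :: "('a \<Rightarrow> 'a) \<Rightarrow> real"
  assumes P: "finite P" "P \<noteq> {}" and g: "g permutes P" "cyclic_on g P"
  shows "(\<Sum>t | t permutes P. h (inv t \<circ> g \<circ> t)) = (\<Sum>\<beta> | \<beta> permutes P. poly (hookpoly P \<beta>) 1 * h \<beta>)"
proof -
  have "(\<Sum>t | t permutes P. h (inv t \<circ> g \<circ> t)) =
      (\<Sum>\<beta> | \<beta> permutes P. of_nat (card {t \<in> {t. t permutes P}. inv t \<circ> g \<circ> t = \<beta>}) * h \<beta>)"
  proof (rule sum_fun_comp)
    show "finite {t. t permutes P}" "finite {t. t permutes P}" using P by (simp_all add: finite_permutations)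
    show "(\<lambda>t. inv t \<circ> g \<circ> t) ` {t. t permutes P} \<subseteq> {t. t permutes P}"
      using permutes_compose[OF _ permutes_compose[OF g(1) permutes_inv]] by (auto simp only: mem_Collect_eq image_subset_iff)
  qed
  also have "\<dots> = (\<Sum>\<beta> | \<beta> permutes P. poly (hookpoly P \<beta>) 1 * h \<beta>)"
    by (rule sum.cong[OF refl]) (simp add: card_cyclic_conj[OF P g] poly_hookpoly_1[OF P])
  finally show ?thesis .
qed

lemma cyclic_cycle_of_list:
  assumes "distinct cs" "cs \<noteq> []"
  shows "cyclic_on (cycle_of_list cs) (set cs)"
proof (rule cyclic_on_singleI[of "cs ! 0"])
  show "cs ! 0 \<in> set cs" using assms(2) by simp
  have *: "(cycle_of_list cs ^^ n) (cs ! 0) = cs ! (n mod length cs)" for n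
  proof -
    have "(cycle_of_list cs ^^ n) (cs ! 0) = map (cycle_of_list cs ^^ n) cs ! 0" using assms(2) by simp
    also have "\<dots> = rotate n cs ! 0" by (simp only: cyclic_rotation[OF assms(1)])
    also have "\<dots> = cs ! (n mod length cs)" using assms(2) nth_rotate[of 0 cs n] by simp
    finally show ?thesis .
  qed
  show "set cs = orbit (cycle_of_list cs) (cs ! 0)"
    unfolding orbit_altdef_permutation[OF permutation_of_cycle] *
  proof (intro equalityI subsetI)
    fix x assume "x \<in> set cs"
    then obtain i where "i < length cs" "x = cs ! i" by (auto simp: in_set_conv_nth)
    then show "x \<in> {cs ! (n mod length cs) |n. True}" by (auto intro!: exI[of _ i])
  qed (use assms(2) in auto)
qed

section \<open>Orthogonality of the hook functions\<close>

text \<open>Convolution with the number of colourings is a symmetric operator, by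
  \<open>ncol_comp_commute\<close>, and the hook functions are eigenvectors by
  \<open>sum_hook_ncol\<close>. Distinct eigenvalues force orthogonality.\<close>

lemma hook_orthogonal_less:
  assumes S: "finite S" and A: "A < B" and B: "B < card S"
  shows "(\<Sum>\<rho> | \<rho> permutes S. hook S A \<rho> * hook S B \<rho>) = 0"
proof -
  \<comment> \<open>For this number of colours the eigenvalue of leg \<open>A\<close> is the
    factorial of \<open>card S\<close>, while that of the longer leg \<open>B\<close> contains the
    factor 0.\<close>
  let ?K = "Suc A" and ?P = "{\<rho>. \<rho> permutes S}"
  have *: "(\<Sum>a\<in>?P. hook S D a * (\<Sum>\<beta>\<in>?P. hook S C \<beta> * real (ncol ?K S (a \<circ> \<beta>)))) =
      hook_content ?K (card S) C * (\<Sum>\<rho>\<in>?P. hook S C \<rho> * hook S D \<rho>)" if "C < card S" for C D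
  proof -
    have "(\<Sum>a\<in>?P. hook S D a * (\<Sum>\<beta>\<in>?P. hook S C \<beta> * real (ncol ?K S (a \<circ> \<beta>)))) =
        (\<Sum>a\<in>?P. hook_content ?K (card S) C * (hook S C a * hook S D a))"
      by (rule sum.cong[OF refl]) (simp add: sum_hook_ncol[OF S _ _ that, of _ ?K])
    then show ?thesis by (simp only: sum_distrib_left)
  qed
  have "(\<Sum>a\<in>?P. hook S B a * (\<Sum>\<beta>\<in>?P. hook S A \<beta> * real (ncol ?K S (a \<circ> \<beta>)))) =
      (\<Sum>a\<in>?P. \<Sum>\<beta>\<in>?P. hook S A \<beta> * (hook S B a * real (ncol ?K S (\<beta> \<circ> a))))"
    unfolding sum_distrib_left by (intro sum.cong refl) (use ncol_comp_commute in \<open>auto simp: mult_ac\<close>)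
  also have "\<dots> = (\<Sum>a\<in>?P. hook S A a * (\<Sum>\<beta>\<in>?P. hook S B \<beta> * real (ncol ?K S (a \<circ> \<beta>))))"
    unfolding sum_distrib_left by (rule sum.swap)
  finally have "hook_content ?K (card S) A * (\<Sum>\<rho>\<in>?P. hook S A \<rho> * hook S B \<rho>) =
      hook_content ?K (card S) B * (\<Sum>\<rho>\<in>?P. hook S B \<rho> * hook S A \<rho>)"
    using *[of A B] *[of B A] A B by simp
  moreover have "hook_content ?K (card S) A = fact (card S)"
    by (simp add: hook_content_def pochhammer_fact)
  moreover have "hook_content ?K (card S) B = 0"
    unfolding hook_content_def pochhammer_eq_0_iff using A B
    by (intro exI[of _ "B - Suc A"]) (auto simp: of_nat_diff)
  ultimately show ?thesis by simp
qed

text \<open>For the norm, orthogonality allows all other hooks to be added to one of the two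
  factors. The sum of all hooks is the value at \<open>y = 1\<close>, supported on full cycles,
  where \<open>hook S A\<close> is 1; counted by conjugators, every permutation contributes
  1.\<close>

lemma hook_orthogonal:
  assumes S: "finite S" and A: "A < card S" and B: "B < card S"
  shows "(\<Sum>\<rho> | \<rho> permutes S. hook S A \<rho> * hook S B \<rho>) = (if A = B then fact (card S) else 0)"
proof (cases "A = B")
  case False
  then show ?thesis using hook_orthogonal_less[OF S _ B, of A] hook_orthogonal_less[OF S _ A, of B]
    by (cases "A < B") (auto simp: mult.commute)
next
  case True
  have ne: "S \<noteq> {}" using A by auto
  obtain cs where cs: "set cs = S" "distinct cs" using finite_distinct_list[OF S] by blast
  have g: "cycle_of_list cs permutes S" "cyclic_on (cycle_of_list cs) S"
    using cycle_permutes[of cs] cyclic_cycle_of_list[OF cs(2)] cs(1) ne by auto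
  let ?g = "cycle_of_list cs"
  have "(\<Sum>\<rho> | \<rho> permutes S. hook S A \<rho> * hook S A \<rho>) = (\<Sum>C<card S. \<Sum>\<rho> | \<rho> permutes S. hook S C \<rho> * hook S A \<rho>)"
  proof -
    have "(\<Sum>\<rho> | \<rho> permutes S. hook S C \<rho> * hook S A \<rho>) = 0" if "C < card S" "C \<noteq> A" for C
      using hook_orthogonal_less[OF S _ A, of C] hook_orthogonal_less[OF S _ that(1), of A] that(2)
      by (cases "A < C") (auto simp: mult.commute)
    then have "(\<Sum>C<card S. \<Sum>\<rho> | \<rho> permutes S. hook S C \<rho> * hook S A \<rho>) =
        (\<Sum>C<card S. if C = A then (\<Sum>\<rho> | \<rho> permutes S. hook S A \<rho> * hook S A \<rho>) else 0)"
      by (intro sum.cong) auto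
    then show ?thesis using A by simp
  qed
  also have "\<dots> = (\<Sum>\<rho> | \<rho> permutes S. poly (hookpoly S \<rho>) 1 * hook S A \<rho>)"
    by (subst sum.swap) (simp add: hookpoly_def poly_sum poly_monom sum_distrib_right)
  also have "\<dots> = (\<Sum>t | t permutes S. hook S A (inv t \<circ> ?g \<circ> t))"
    by (rule sum_cyclic_conj[OF S ne g, symmetric])
  also have "\<dots> = (\<Sum>t | t permutes S. 1)"
  proof (rule sum.cong[OF refl])
    fix t assume "t \<in> {t. t permutes S}"
    then have t: "t permutes S" by simp
    then have "permutation (inv t)" using S permutes_inv by (auto intro: permutes_imp_permutation)
    from hook_conj[OF this S permutes_inj[OF g(1)], of A]
    show "hook S A (inv t \<circ> ?g \<circ> t) = 1"
      using permutes_image[OF permutes_inv[OF t]] permutes_inv_inv[OF t] hook_cyclic[OF S g A] by simp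
  qed
  also have "\<dots> = fact (card S)" using card_permutations[OF refl S] by simp
  finally show ?thesis using True by simp
qed

text \<open>Weighting with \<open>hook S A\<close> isolates the monomial of exponent
  \<open>A\<close>. In this way the permutation put in place of a matching becomes a power of
  \<open>y\<close> at the neighbouring block.\<close>

lemma sum_hook_hookpoly:
  assumes S: "finite S" and A: "A < card S"
  shows "(\<Sum>\<rho> | \<rho> permutes S. smult (hook S A \<rho>) (hookpoly S \<rho>)) = monom (fact (card S)) A"
proof (rule poly_eqI)
  fix B
  show "coeff (\<Sum>\<rho> | \<rho> permutes S. smult (hook S A \<rho>) (hookpoly S \<rho>)) B = coeff (monom (fact (card S)) A) B"
    using hook_orthogonal[OF S A, of B] A by (cases "B < card S") (auto simp: coeff_sum coeff_hookpoly)
qed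


text \<open>The linear functional with \<open>y\<^sup>b \<mapsto> (K - b) (K - b + 1) \<cdots> (K - b + p - 1)\<close>.\<close>

definition content_eval :: "nat \<Rightarrow> nat \<Rightarrow> real poly \<Rightarrow> real" where
  "content_eval K p f = (\<Sum>b\<le>degree f. coeff f b * hook_content K p b)"

lemma content_eval_altdef:
  assumes "degree f \<le> N"
  shows "content_eval K p f = (\<Sum>b\<le>N. coeff f b * hook_content K p b)"
  unfolding content_eval_def
  by (rule sum.mono_neutral_left) (use assms in \<open>auto simp: coeff_eq_0\<close>)

lemma content_eval_0 [simp]: "content_eval K p 0 = 0"
  by (simp add: content_eval_def)

lemma content_eval_add: "content_eval K p (f + g) = content_eval K p f + content_eval K p g"
proof -
  let ?N = "max (degree f) (degree g)"
  have "degree (f + g) \<le> ?N" by (rule degree_add_le) auto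
  then show ?thesis
    by (simp add: content_eval_altdef[of _ ?N] sum.distrib distrib_right)
qed

lemma content_eval_smult: "content_eval K p (smult c f) = c * content_eval K p f"
proof -
  have "degree (smult c f) \<le> degree f" by (rule degree_smult_le)
  then show ?thesis
    by (simp add: content_eval_altdef[of _ "degree f"] sum_distrib_left mult.assoc)
qed

lemma content_eval_sum: "content_eval K p (sum f A) = (\<Sum>x\<in>A. content_eval K p (f x))"
  by (induction A rule: infinite_finite_induct) (simp_all add: content_eval_add)

lemma content_eval_monom: "content_eval K p (monom c b) = c * hook_content K p b"
proof -
  have "content_eval K p (monom c b) = (\<Sum>j\<le>b. if j = b then c * hook_content K p b else 0)"
    unfolding content_eval_altdef[OF degree_monom_le] by (intro sum.cong) auto
  then show ?thesis by simp
qed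

section \<open>Summing over the full cycles of one block\<close>

text \<open>The eigenvalue rule \<open>sum_hook_ncol\<close>, applied to every coefficient. Once the
  full cycles are summed over, only the hook polynomial of the other permutation \<open>a\<close>
  matters.\<close>

lemma sum_hookpoly_ncol:
  assumes P: "finite P" and a: "a permutes P" and K: "K \<ge> 1"
  shows "(\<Sum>\<beta> | \<beta> permutes P. poly (hookpoly P \<beta>) 1 * real (ncol K P (a \<circ> \<beta>))) =
    content_eval K (card P) (hookpoly P a)"
proof -
  have "(\<Sum>\<beta> | \<beta> permutes P. poly (hookpoly P \<beta>) 1 * real (ncol K P (a \<circ> \<beta>))) =
      (\<Sum>b<card P. \<Sum>\<beta> | \<beta> permutes P. hook P b \<beta> * real (ncol K P (a \<circ> \<beta>)))"
    by (subst sum.swap) (simp add: hookpoly_def poly_sum poly_monom sum_distrib_right)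
  also have "\<dots> = (\<Sum>b<card P. content_eval K (card P) (monom (hook P b a) b))"
    by (rule sum.cong[OF refl]) (simp add: sum_hook_ncol[OF P a K] content_eval_monom)
  finally show ?thesis by (simp add: hookpoly_def content_eval_sum)
qed

lemma hook_content_nonzero: "A < K \<Longrightarrow> hook_content K p A \<noteq> 0"
  unfolding hook_content_def pochhammer_eq_0_iff by (auto simp: of_nat_diff)

text \<open>A hook of \<open>p\<close> cells with leg \<open>b \<ge> K\<close> has a cell of content
  \<open>-K\<close>. This is the origin of the upper summation limit \<open>min(s_e, K) - 1\<close>
  in the formula.\<close>

lemma hook_content_zero:
  assumes "K \<le> b" "b < p"
  shows "hook_content K p b = 0"
  unfolding hook_content_def pochhammer_eq_0_iff
  using assms by (intro exI[of _ "b - K"]) (auto simp: of_nat_diff)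

text \<open>On \<open>U\<close> the composite is just \<open>\<iota>\<close>, so matched points have
  equal colours and those of \<open>U'\<close> are redundant. What remains is the condition along
  two consecutive steps, from \<open>U\<close> to \<open>U'\<close> and back.\<close>

lemma ncol_glue:
  assumes dj: "U \<inter> U' = {}" and \<iota>: "\<And>x. x \<in> U \<Longrightarrow> \<iota> x \<in> U'" "\<And>x. x \<in> U' \<Longrightarrow> \<iota> x \<in> U" "\<And>x. \<iota> (\<iota> x) = x"
    and \<alpha>: "\<alpha> permutes U" and \<alpha>': "\<alpha>' permutes U'"
  shows "ncol K (U \<union> U') (\<alpha> \<circ> \<iota> \<circ> \<alpha>') = ncol K U (\<alpha> \<circ> (\<iota> \<circ> \<alpha>' \<circ> \<iota>))"
proof -
  have aU: "\<alpha> x \<in> U" if "x \<in> U" for x using permutes_in_image[OF \<alpha>] that by simp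
  have aU': "\<alpha>' x \<in> U'" if "x \<in> U'" for x using permutes_in_image[OF \<alpha>'] that by simp
  have aF: "\<alpha> x = x" if "x \<in> U'" for x using permutes_not_in[OF \<alpha>] that dj by auto
  have aF': "\<alpha>' x = x" if "x \<in> U" for x using permutes_not_in[OF \<alpha>'] that dj by auto
  have nU: "x \<notin> U'" if "x \<in> U" for x using that dj by auto
  let ?A = "{f \<in> U \<union> U' \<rightarrow>\<^sub>E {..<K}. \<forall>x\<in>U \<union> U'. f ((\<alpha> \<circ> \<iota> \<circ> \<alpha>') x) = f x}"
  let ?B = "{f \<in> U \<rightarrow>\<^sub>E {..<K}. \<forall>x\<in>U. f ((\<alpha> \<circ> (\<iota> \<circ> \<alpha>' \<circ> \<iota>)) x) = f x}"
  let ?ext = "\<lambda>g x. if x \<in> U then g x else if x \<in> U' then g (\<iota> x) else undefined"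
  have fA: "f (\<iota> x) = f x" if "f \<in> ?A" "x \<in> U" for f x
  proof -
    have "(\<alpha> \<circ> \<iota> \<circ> \<alpha>') x = \<iota> x" using that(2) by (simp add: aF' aF \<iota>)
    then show ?thesis using that by (metis (mono_tags, lifting) UnI1 mem_Collect_eq)
  qed
  have "bij_betw (\<lambda>f. restrict f U) ?A ?B"
  proof (rule bij_betw_byWitness[where f' = ?ext])
    show "\<forall>f\<in>?A. ?ext (restrict f U) = f"
    proof
      fix f assume f: "f \<in> ?A"
      then have fE: "f \<in> U \<union> U' \<rightarrow>\<^sub>E {..<K}" by simp
      show "?ext (restrict f U) = f"
      proof
        fix x
        consider "x \<in> U" | "x \<notin> U" "x \<in> U'" | "x \<notin> U \<union> U'" by auto
        then show "?ext (restrict f U) x = f x"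
        proof cases
          case 2
          then show ?thesis using fA[OF f \<iota>(2)[OF 2(2)]] \<iota>(2,3) by simp
        next
          case 3
          then show ?thesis using PiE_arb[OF fE 3] by simp
        qed simp
      qed
    qed
    show "\<forall>f\<in>?B. restrict (?ext f) U = f"
    proof
      fix f assume "f \<in> ?B"
      then have "f \<in> extensional U" by (auto simp: PiE_def)
      then show "restrict (?ext f) U = f" by (auto simp: fun_eq_iff extensional_def)
    qed
    show "(\<lambda>f. restrict f U) ` ?A \<subseteq> ?B"
    proof clarify
      fix f assume f1: "f \<in> U \<union> U' \<rightarrow>\<^sub>E {..<K}" and f2: "\<forall>x\<in>U \<union> U'. f ((\<alpha> \<circ> \<iota> \<circ> \<alpha>') x) = f x"
      have f: "f \<in> ?A" using f1 f2 by simp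
      have "restrict f U \<in> U \<rightarrow>\<^sub>E {..<K}" using f1 by auto
      moreover have "restrict f U ((\<alpha> \<circ> (\<iota> \<circ> \<alpha>' \<circ> \<iota>)) x) = restrict f U x" if x: "x \<in> U" for x
      proof -
        have "f ((\<alpha> \<circ> (\<iota> \<circ> \<alpha>' \<circ> \<iota>)) x) = f ((\<alpha> \<circ> \<iota> \<circ> \<alpha>') (\<iota> x))" by simp
        also have "\<dots> = f (\<iota> x)" using f2 \<iota>(1)[OF x] by blast
        also have "\<dots> = f x" by (rule fA[OF f x])
        finally show ?thesis using x aU aU' \<iota> by simp
      qed
      ultimately show "restrict f U \<in> U \<rightarrow>\<^sub>E {..<K} \<and>
          (\<forall>x\<in>U. restrict f U ((\<alpha> \<circ> (\<iota> \<circ> \<alpha>' \<circ> \<iota>)) x) = restrict f U x)" by blast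
    qed
    show "?ext ` ?B \<subseteq> ?A"
    proof clarify
      fix g assume g1: "g \<in> U \<rightarrow>\<^sub>E {..<K}" and g2: "\<forall>x\<in>U. g ((\<alpha> \<circ> (\<iota> \<circ> \<alpha>' \<circ> \<iota>)) x) = g x"
      have "g x < K" if "x \<in> U" for x using PiE_mem[OF g1 that] by simp
      then have "?ext g \<in> U \<union> U' \<rightarrow>\<^sub>E {..<K}" using \<iota>(2) by (intro PiE_I) auto
      moreover have "?ext g ((\<alpha> \<circ> \<iota> \<circ> \<alpha>') x) = ?ext g x" if x: "x \<in> U \<union> U'" for x
      proof (cases "x \<in> U")
        case True
        then have "(\<alpha> \<circ> \<iota> \<circ> \<alpha>') x = \<iota> x" by (simp add: aF' aF \<iota>)
        moreover have "\<iota> x \<notin> U" using \<iota>(1)[OF True] nU by auto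
        ultimately show ?thesis using True \<iota> by simp
      next
        case False
        then have x': "x \<in> U'" using x by simp
        have "g ((\<alpha> \<circ> (\<iota> \<circ> \<alpha>' \<circ> \<iota>)) (\<iota> x)) = g (\<iota> x)" using g2 \<iota>(2)[OF x'] by blast
        then show ?thesis using False x' aU aU' \<iota> by simp
      qed
      ultimately show "?ext g \<in> U \<union> U' \<rightarrow>\<^sub>E {..<K} \<and>
          (\<forall>x\<in>U \<union> U'. ?ext g ((\<alpha> \<circ> \<iota> \<circ> \<alpha>') x) = ?ext g x)" by blast
    qed
  qed
  then show ?thesis by (simp add: ncol0_def bij_betw_same_card)
qed

lemma one_minus_y_nonzero: "[:1, -1:] \<noteq> (0 :: real poly)"
  by simp

text \<open>The set \<open>R\<close> acts on the leaf \<open>P\<close> only through a permutation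
  \<open>c\<close> of \<open>U\<close>, the return map of \<open>\<sigma>\<close> to
  \<open>U'\<close> transported by \<open>\<iota>\<close>. The sum over \<open>\<beta>\<close> is
  linear in the coefficients \<open>hook U A c\<close>. Each of them is turned back into colourings
  of \<open>R\<close> by reading \<open>sum_hook_ncol\<close> on \<open>U\<close> from right to
  left, which costs the division by \<open>hook_content K (card U) A\<close>.\<close>

lemma sum_leaf:
  assumes R: "finite R" and P: "finite P" and dj: "R \<inter> P = {}"
    and U: "U \<subseteq> P" "U \<noteq> {}" and U': "U' \<subseteq> R"
    and \<iota>: "\<iota> permutes U \<union> U'" "\<iota> ` U = U'" "\<And>x. \<iota> (\<iota> x) = x"
    and \<sigma>: "\<sigma> permutes R" and \<kappa>: "\<kappa> permutes P - U" and K: "K \<ge> 1"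
  shows "(\<Sum>\<beta> | \<beta> permutes P. poly (hookpoly P \<beta>) 1 * real (ncol K (R \<union> P) (\<iota> \<circ> \<sigma> \<circ> (\<kappa> \<circ> \<beta>)))) =
    (\<Sum>A<min (card U) K. content_eval K (card P) (cycpoly (P - U) \<kappa> * monom 1 A) / hook_content K (card U) A *
       (\<Sum>\<rho> | \<rho> permutes U. hook U A \<rho> * real (ncol K R ((\<iota> \<circ> \<rho> \<circ> \<iota>) \<circ> \<sigma>))))"
proof -
  have fU: "finite U" and fU': "finite U'" using P R U(1) U' finite_subset by blast+
  have UU: "U \<inter> U' = {}" using dj U(1) U' by blast
  have \<iota>U: "\<iota> x \<in> U'" if "x \<in> U" for x using that \<iota>(2) by auto
  have \<iota>U': "\<iota> x \<in> U" if "x \<in> U'" for x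
  proof -
    have "x \<in> \<iota> ` U" using that \<iota>(2) by simp
    then obtain u where "u \<in> U" "x = \<iota> u" by blast
    then show ?thesis using \<iota>(3) by simp
  qed
  have inv\<iota>: "inv \<iota> = \<iota>" using \<iota>(3) by (intro inv_equality)
  have b\<iota>: "bij \<iota>" by (rule permutes_bij[OF \<iota>(1)])
  have p\<iota>: "permutation \<iota>" using \<iota>(1) fU fU' by (auto intro: permutes_imp_permutation)
  have img: "\<iota> ` U' = U" unfolding \<iota>(2)[symmetric] by (simp add: image_image \<iota>(3))
  have cnj: "\<iota> \<circ> \<alpha> \<circ> \<iota> permutes \<iota> ` X" if "\<alpha> permutes X" for \<alpha> X
  proof (rule bij_imp_permutes)
    show "bij_betw (\<iota> \<circ> \<alpha> \<circ> \<iota>) (\<iota> ` X) (\<iota> ` X)"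
    proof (rule bij_betw_trans[of \<iota> _ X])
      show "bij_betw \<iota> (\<iota> ` X) X"
        by (rule bij_betw_byWitness[where f' = \<iota>]) (simp_all add: \<iota>(3) image_image)
      show "bij_betw (\<iota> \<circ> \<alpha>) X (\<iota> ` X)"
      proof (rule bij_betw_trans[of \<alpha> _ X])
        show "bij_betw \<alpha> X X" by (rule permutes_imp_bij[OF that])
        show "bij_betw \<iota> X (\<iota> ` X)" using b\<iota> by (auto simp: bij_betw_def intro: inj_on_subset)
      qed
    qed
    fix x assume "x \<notin> \<iota> ` X"
    then have "\<iota> x \<notin> X" using \<iota>(3) by (metis imageI)
    then show "(\<iota> \<circ> \<alpha> \<circ> \<iota>) x = x" using permutes_not_in[OF that] \<iota>(3) by simp
  qed
  obtain m' \<alpha>' where \<alpha>': "\<alpha>' permutes U'" and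
    fr': "\<And>Z Q \<rho>. Z \<inter> R \<subseteq> U' \<Longrightarrow> Q \<inter> R = {} \<Longrightarrow> \<rho> permutes Q \<union> U' \<Longrightarrow>
       ncol0 K Z (Q \<union> R) (\<rho> \<circ> \<sigma>) = K ^ m' * ncol0 K Z (Q \<union> U') (\<rho> \<circ> \<alpha>')"
    by (rule first_return[OF R \<sigma> U', where K = K]) (rule that)
  define c where "c = \<iota> \<circ> \<alpha>' \<circ> \<iota>"
  have c: "c permutes U" using cnj[OF \<alpha>'] img by (simp add: c_def)
  have c\<kappa>: "c \<circ> \<kappa> permutes P"
    by (intro permutes_compose permutes_subset[OF c U(1)] permutes_subset[OF \<kappa>]) auto
  \<comment> \<open>Return maps are taken on both sides: that of
    \<open>\<kappa> \<circ> \<beta>\<close> serves only to pass through \<open>U\<close> and is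
    expanded again at the end, while that of \<open>\<sigma>\<close> leaves the factor
    \<open>K ^ m'\<close>, which does not depend on \<open>\<beta>\<close>.\<close>
  have step: "ncol K (R \<union> P) (\<iota> \<circ> \<sigma> \<circ> (\<kappa> \<circ> \<beta>)) = K ^ m' * ncol K P (c \<circ> \<kappa> \<circ> \<beta>)"
    if \<beta>: "\<beta> permutes P" for \<beta>
  proof -
    have s: "\<kappa> \<circ> \<beta> permutes P" by (intro permutes_compose[OF \<beta>] permutes_subset[OF \<kappa>]) auto
    obtain m \<alpha> where \<alpha>: "\<alpha> permutes U" and
      fr: "\<And>Z Q \<rho>. Z \<inter> P \<subseteq> U \<Longrightarrow> Q \<inter> P = {} \<Longrightarrow> \<rho> permutes Q \<union> U \<Longrightarrow>
         ncol0 K Z (Q \<union> P) (\<rho> \<circ> (\<kappa> \<circ> \<beta>)) = K ^ m * ncol0 K Z (Q \<union> U) (\<rho> \<circ> \<alpha>)"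
      by (rule first_return[OF P s U(1), where K = K]) (rule that)
    have p1: "\<iota> \<circ> \<sigma> permutes R \<union> U"
      by (intro permutes_compose permutes_subset[OF \<sigma>] permutes_subset[OF \<iota>(1)]) (use U' in auto)
    have p2: "\<alpha> permutes R \<union> U" by (rule permutes_subset[OF \<alpha>]) auto
    have p3: "\<alpha> \<circ> \<iota> permutes U \<union> U'"
      by (intro permutes_compose[OF \<iota>(1)] permutes_subset[OF \<alpha>]) auto
    have "ncol K (R \<union> P) (\<iota> \<circ> \<sigma> \<circ> (\<kappa> \<circ> \<beta>)) = K ^ m * ncol K (R \<union> U) (\<iota> \<circ> \<sigma> \<circ> \<alpha>)"
      by (rule fr[OF _ dj p1]) auto
    also have "ncol K (R \<union> U) (\<iota> \<circ> \<sigma> \<circ> \<alpha>) = ncol K (U \<union> R) (\<alpha> \<circ> \<iota> \<circ> \<sigma>)"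
      using ncol_comp_commute[OF p1 p2] by (simp add: comp_assoc Un_commute)
    also have "\<dots> = K ^ m' * ncol K (U \<union> U') (\<alpha> \<circ> \<iota> \<circ> \<alpha>')"
      by (rule fr'[OF _ _ p3]) (use dj U(1) in auto)
    also have "ncol K (U \<union> U') (\<alpha> \<circ> \<iota> \<circ> \<alpha>') = ncol K U (\<alpha> \<circ> c)"
      unfolding c_def by (rule ncol_glue[OF UU \<iota>U \<iota>U' \<iota>(3) \<alpha> \<alpha>'])
    also have "\<dots> = ncol K U (c \<circ> \<alpha>)" by (rule ncol_comp_commute[OF \<alpha> c])
    finally have f: "ncol K (R \<union> P) (\<iota> \<circ> \<sigma> \<circ> (\<kappa> \<circ> \<beta>)) = K ^ m * (K ^ m' * ncol K U (c \<circ> \<alpha>))" .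
    have "ncol K P (c \<circ> (\<kappa> \<circ> \<beta>)) = K ^ m * ncol K U (c \<circ> \<alpha>)"
      using fr[of "{}" "{}" c] c by simp
    then have "ncol K P (c \<circ> \<kappa> \<circ> \<beta>) = K ^ m * ncol K U (c \<circ> \<alpha>)" by (simp only: comp_assoc)
    then show ?thesis unfolding f by (simp only: mult.left_commute)
  qed
  \<comment> \<open>\<open>c\<close> and \<open>\<kappa>\<close> act on complementary parts of
    \<open>P\<close>, so their cycle polynomials multiply; the single division by
    \<open>1 - y\<close> is carried out on the part of \<open>U\<close>.\<close>
  have hp: "hookpoly P (c \<circ> \<kappa>) = cycpoly (P - U) \<kappa> * hookpoly U c"
  proof -
    have kP: "\<kappa> x \<in> P - U" if "x \<in> P - U" for x using permutes_in_image[OF \<kappa>] that by simp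
    have cU: "c x \<in> U" if "x \<in> U" for x using permutes_in_image[OF c] that by simp
    have e1: "(c \<circ> \<kappa>) x = \<kappa> x" if "x \<in> P - U" for x
      using permutes_not_in[OF c] kP[OF that] by auto
    have e2: "(c \<circ> \<kappa>) x = c x" if "x \<in> U" for x
      using permutes_not_in[OF \<kappa>] that by auto
    have PU: "(P - U) \<union> U = P" using U(1) by auto
    have ne: "P \<noteq> {}" using U by auto
    have "[:1, -1:] * hookpoly P (c \<circ> \<kappa>) = cycpoly P (c \<circ> \<kappa>)"
      by (rule cycpoly_eq_hookpoly[OF P c\<kappa> ne, symmetric])
    also have "\<dots> = cycpoly (P - U) (c \<circ> \<kappa>) * cycpoly U (c \<circ> \<kappa>)"
      using cycpoly_Un[of "P - U" U "c \<circ> \<kappa>"] P fU permutes_inj_on[OF c\<kappa>] e1 e2 kP cU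
      unfolding PU by (simp add: image_subset_iff Diff_disjoint Int_commute)
    also have "cycpoly (P - U) (c \<circ> \<kappa>) = cycpoly (P - U) \<kappa>" by (rule cycpoly_cong[OF e1])
    also have "cycpoly U (c \<circ> \<kappa>) = cycpoly U c" by (rule cycpoly_cong[OF e2])
    also have "\<dots> = [:1, -1:] * hookpoly U c" by (rule cycpoly_eq_hookpoly[OF fU c U(2)])
    finally have "[:1, -1:] * hookpoly P (c \<circ> \<kappa>) = [:1, -1:] * (cycpoly (P - U) \<kappa> * hookpoly U c)"
      by (simp only: mult_ac)
    then show ?thesis by (subst (asm) mult_left_cancel) auto
  qed
  \<comment> \<open>Only exponents from \<open>A\<close> to \<open>card P - 1\<close> occur, and for
    \<open>K \<le> A\<close> all their content products are 0. These terms have to be removed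
    beforehand, since \<open>hook_content K (card U) A\<close> is 0 as well and stands in the
    denominator.\<close>
  have vanish: "content_eval K (card P) (cycpoly (P - U) \<kappa> * monom 1 A) = 0" if A: "K \<le> A" "A < card U" for A
  proof -
    let ?f = "cycpoly (P - U) \<kappa> * monom 1 A"
    have "degree ?f \<le> card (P - U) + A"
      using degree_mult_le[of "cycpoly (P - U) \<kappa>" "monom 1 A"] degree_cycpoly[of "P - U" \<kappa>] P
        degree_monom_le[of "1::real" A] by (meson add_mono finite_Diff le_trans)
    moreover have "card P = card (P - U) + card U"
      using P U(1) fU by (simp add: card_Diff_subset card_mono)
    ultimately have d: "degree ?f < card P" using A by simp
    have "coeff ?f b * hook_content K (card P) b = 0" if "b \<le> degree ?f" for b
    proof (cases "b < K")
      case True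
      then show ?thesis using A by (simp add: mult.commute[of _ "monom 1 A"] coeff_monom_mult)
    next
      case False
      then show ?thesis using hook_content_zero[of K b "card P"] that d by simp
    qed
    then show ?thesis unfolding content_eval_def by (intro sum.neutral) auto
  qed
  have "(\<Sum>\<beta> | \<beta> permutes P. poly (hookpoly P \<beta>) 1 * real (ncol K (R \<union> P) (\<iota> \<circ> \<sigma> \<circ> (\<kappa> \<circ> \<beta>)))) =
      real K ^ m' * (\<Sum>\<beta> | \<beta> permutes P. poly (hookpoly P \<beta>) 1 * real (ncol K P (c \<circ> \<kappa> \<circ> \<beta>)))"
    by (simp add: step sum_distrib_left mult_ac)
  also have "(\<Sum>\<beta> | \<beta> permutes P. poly (hookpoly P \<beta>) 1 * real (ncol K P (c \<circ> \<kappa> \<circ> \<beta>))) =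
      content_eval K (card P) (cycpoly (P - U) \<kappa> * hookpoly U c)"
    unfolding sum_hookpoly_ncol[OF P c\<kappa> K] hp ..
  also have "cycpoly (P - U) \<kappa> * hookpoly U c =
      (\<Sum>A<card U. smult (hook U A c) (cycpoly (P - U) \<kappa> * monom 1 A))"
    unfolding hookpoly_def sum_distrib_left
    by (intro sum.cong refl) (simp add: mult_smult_right[symmetric] smult_monom)
  also have "content_eval K (card P) \<dots> =
      (\<Sum>A<card U. hook U A c * content_eval K (card P) (cycpoly (P - U) \<kappa> * monom 1 A))"
    by (simp add: content_eval_sum content_eval_smult)
  also have "\<dots> = (\<Sum>A<min (card U) K. hook U A c * content_eval K (card P) (cycpoly (P - U) \<kappa> * monom 1 A))"
    by (rule sum.mono_neutral_right) (use vanish in auto)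
  also have "real K ^ m' * \<dots> = (\<Sum>A<min (card U) K. content_eval K (card P) (cycpoly (P - U) \<kappa> * monom 1 A) / hook_content K (card U) A *
       (\<Sum>\<rho> | \<rho> permutes U. hook U A \<rho> * real (ncol K R ((\<iota> \<circ> \<rho> \<circ> \<iota>) \<circ> \<sigma>))))"
  proof (subst sum_distrib_left, rule sum.cong[OF refl])
    fix A assume "A \<in> {..<min (card U) K}"
    then have A: "A < card U" "A < K" by auto
    \<comment> \<open>The reduction read backwards: after transport by \<open>\<iota>\<close> the
      return map on \<open>U'\<close> is expanded again to \<open>\<sigma>\<close> on
      \<open>R\<close>, which absorbs \<open>K ^ m'\<close>.\<close>
    have "real K ^ m' * real (ncol K U (c \<circ> \<rho>)) = real (ncol K R ((\<iota> \<circ> \<rho> \<circ> \<iota>) \<circ> \<sigma>))"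
      if \<rho>: "\<rho> permutes U" for \<rho>
    proof -
      have \<rho>': "\<iota> \<circ> \<rho> \<circ> \<iota> permutes U'" using cnj[OF \<rho>] \<iota>(2) by simp
      have "ncol K U (c \<circ> \<rho>) = ncol K (\<iota> ` U) (\<iota> \<circ> (c \<circ> \<rho>) \<circ> inv \<iota>)"
        by (rule ncol_conj[OF b\<iota> permutes_compose[OF \<rho> c], symmetric])
      also have "\<iota> \<circ> (c \<circ> \<rho>) \<circ> inv \<iota> = \<alpha>' \<circ> (\<iota> \<circ> \<rho> \<circ> \<iota>)"
        by (simp add: inv\<iota> c_def fun_eq_iff \<iota>(3))
      also have "ncol K (\<iota> ` U) \<dots> = ncol K U' ((\<iota> \<circ> \<rho> \<circ> \<iota>) \<circ> \<alpha>')"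
        unfolding \<iota>(2) by (rule ncol_comp_commute[OF \<alpha>' \<rho>'])
      finally have e: "ncol K U (c \<circ> \<rho>) = ncol K U' ((\<iota> \<circ> \<rho> \<circ> \<iota>) \<circ> \<alpha>')" .
      have "ncol K R ((\<iota> \<circ> \<rho> \<circ> \<iota>) \<circ> \<sigma>) = K ^ m' * ncol K U' ((\<iota> \<circ> \<rho> \<circ> \<iota>) \<circ> \<alpha>')"
        using fr'[of "{}" "{}" "\<iota> \<circ> \<rho> \<circ> \<iota>"] \<rho>' by simp
      then have "K ^ m' * ncol K U (c \<circ> \<rho>) = ncol K R ((\<iota> \<circ> \<rho> \<circ> \<iota>) \<circ> \<sigma>)" by (simp only: e)
      then show ?thesis by (metis of_nat_mult of_nat_power)
    qed
    then have "(\<Sum>\<rho> | \<rho> permutes U. hook U A \<rho> * real (ncol K R ((\<iota> \<circ> \<rho> \<circ> \<iota>) \<circ> \<sigma>))) =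
        real K ^ m' * (\<Sum>\<rho> | \<rho> permutes U. hook U A \<rho> * real (ncol K U (c \<circ> \<rho>)))"
      unfolding sum_distrib_left by (intro sum.cong refl) (simp add: mult_ac)
    also have "\<dots> = real K ^ m' * (hook_content K (card U) A * hook U A c)"
      unfolding sum_hook_ncol[OF fU c K A(1)] ..
    finally show "real K ^ m' * (hook U A c * content_eval K (card P) (cycpoly (P - U) \<kappa> * monom 1 A)) =
        content_eval K (card P) (cycpoly (P - U) \<kappa> * monom 1 A) / hook_content K (card U) A *
       (\<Sum>\<rho> | \<rho> permutes U. hook U A \<rho> * real (ncol K R ((\<iota> \<circ> \<rho> \<circ> \<iota>) \<circ> \<sigma>)))"
      using hook_content_nonzero[OF A(2), of "card U"] by (simp add: field_simps)
  qed
  finally show ?thesis .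
qed


subsection \<open>Trees of blocks\<close>

text \<open>Trees in the form needed for induction: each vertex has exactly one neighbour among
  those added before it.\<close>

inductive leafy :: "('v \<Rightarrow> 'v \<Rightarrow> bool) \<Rightarrow> 'v set \<Rightarrow> bool" for adj where
  single: "leafy adj {v}"
| leaf: "leafy adj V \<Longrightarrow> l \<notin> V \<Longrightarrow> k \<in> V \<Longrightarrow> adj l k \<Longrightarrow> (\<And>j. j \<in> V \<Longrightarrow> adj l j \<Longrightarrow> j = k) \<Longrightarrow>
    leafy adj (insert l V)"

lemma leafy_finite: "leafy adj V \<Longrightarrow> finite V"
  by (induction rule: leafy.induct) auto

lemma hookpoly_cong:
  assumes "\<And>x. x \<in> S \<Longrightarrow> \<beta> x = \<beta>' x"
  shows "hookpoly S \<beta> = hookpoly S \<beta>'"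
proof -
  have "agree T \<beta> = agree T \<beta>'" if "T \<subseteq> S" for T by (rule agree_cong) (use that assms in auto)
  then have "ycoef S c \<beta> = ycoef S c \<beta>'" for c unfolding ycoef_def by (intro sum.cong) auto
  then show ?thesis by (simp add: hookpoly_def hook_def)
qed

lemma support_adj_sym: "support_adj n s i k \<longleftrightarrow> support_adj n s k i"
  by (auto simp: support_adj_def sym_entry_def)

section \<open>Systems of labelled blocks\<close>

locale network =
  fixes S :: "'a set" and lab :: "'a \<Rightarrow> nat" and n :: nat and s :: "nat \<times> nat \<Rightarrow> nat"
  assumes fin: "finite S"
begin

definition pts :: "nat set \<Rightarrow> 'a set" where
  "pts V = {x \<in> S. lab x \<in> V}"

definition blockperms :: "nat set \<Rightarrow> ('a \<Rightarrow> 'a) set" where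
  "blockperms V = {\<beta>. \<beta> permutes pts V \<and> (\<forall>x. lab (\<beta> x) = lab x)}"

text \<open>For a \<open>\<beta>\<close> that permutes each of the nonempty blocks, this is nonzero
  only if \<open>\<beta>\<close> is a full cycle on every block. It then counts the block-preserving
  conjugators from one such product of cycles to another.\<close>

definition block_weight :: "nat set \<Rightarrow> ('a \<Rightarrow> 'a) \<Rightarrow> real" where
  "block_weight V \<beta> = (\<Prod>i\<in>V. poly (hookpoly (pts {i}) \<beta>) 1)"

definition netsum :: "nat \<Rightarrow> nat set \<Rightarrow> ('a \<Rightarrow> 'a) \<Rightarrow> real" where
  "netsum K V \<kappa> = (\<Sum>\<beta>\<in>blockperms V. block_weight V \<beta> * real (ncol K (pts V) (\<kappa> \<circ> \<beta>)))"

text \<open>Inside the blocks \<open>\<kappa>\<close> need not be an involution: removing a leaf replaces its matching with a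
  neighbour by an arbitrary permutation.\<close>

definition compatible :: "nat set \<Rightarrow> ('a \<Rightarrow> 'a) \<Rightarrow> bool" where
  "compatible V \<kappa> \<longleftrightarrow> \<kappa> permutes pts V \<and> (\<forall>x\<in>pts V. lab (\<kappa> x) \<noteq> lab x \<longrightarrow> \<kappa> (\<kappa> x) = x) \<and>
     (\<forall>i\<in>V. \<forall>k\<in>V. i \<noteq> k \<longrightarrow> card {x \<in> pts {i}. lab (\<kappa> x) = k} = sym_entry s i k)"

definition stay :: "('a \<Rightarrow> 'a) \<Rightarrow> nat \<Rightarrow> 'a set" where
  "stay \<kappa> i = {x \<in> pts {i}. lab (\<kappa> x) = i}"

definition edges :: "nat set \<Rightarrow> (nat \<times> nat) set" where
  "edges V = {(i, k). i \<in> V \<and> k \<in> V \<and> i < k \<and> support_adj n s i k}"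

definition nbrs :: "nat set \<Rightarrow> nat \<Rightarrow> nat set" where
  "nbrs V i = {k \<in> V. support_adj n s i k}"

text \<open>At either end of an edge the matched points contribute \<open>(1 - y) y^A\<close>, the
  cycle polynomial of a permutation on them reduced to its hook component of leg \<open>A\<close>.
  The final division is the passage from \<open>cycpoly\<close> to \<open>hookpoly\<close> for the
  block as a whole.\<close>

definition vertex_poly :: "nat set \<Rightarrow> ('a \<Rightarrow> 'a) \<Rightarrow> (nat \<times> nat \<Rightarrow> nat) \<Rightarrow> nat \<Rightarrow> real poly" where
  "vertex_poly V \<kappa> A i =
     (cycpoly (stay \<kappa> i) \<kappa> * (\<Prod>k\<in>nbrs V i. [:1, -1:] * monom 1 (sym_entry A i k))) div [:1, -1:]"

text \<open>For each edge, the factorial is the squared norm of a hook function on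
  \<open>s e\<close> points and the denominator comes from \<open>sum_leaf\<close>.\<close>

definition netval :: "nat \<Rightarrow> nat set \<Rightarrow> ('a \<Rightarrow> 'a) \<Rightarrow> real" where
  "netval K V \<kappa> = (\<Sum>A\<in>PiE (edges V) (\<lambda>e. {..<min (s e) K}).
     (\<Prod>e\<in>edges V. fact (s e) / hook_content K (s e) (A e)) *
     (\<Prod>i\<in>V. content_eval K (card (pts {i})) (vertex_poly V \<kappa> A i)))"

lemma finite_pts [simp]: "finite (pts V)"
  using fin by (simp add: pts_def)

lemma finite_blockperms [simp]: "finite (blockperms V)"
  unfolding blockperms_def using finite_permutations[OF finite_pts] by (rule rev_finite_subset) auto

lemma pts_insert: "pts (insert l V) = pts V \<union> pts {l}"
  by (auto simp: pts_def)

lemma pts_disjoint: "l \<notin> V \<Longrightarrow> pts V \<inter> pts {l} = {}"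
  by (auto simp: pts_def)

lemma sum_blockperms_insert:
  fixes h :: "('a \<Rightarrow> 'a) \<Rightarrow> real"
  assumes l: "l \<notin> V"
  shows "(\<Sum>\<beta>\<in>blockperms (insert l V). h \<beta>) = (\<Sum>\<beta>\<in>blockperms V. \<Sum>\<gamma> | \<gamma> permutes pts {l}. h (\<beta> \<circ> \<gamma>))"
proof -
  have "(\<Sum>\<beta>\<in>blockperms (insert l V). h \<beta>) = (\<Sum>(\<beta>, \<gamma>)\<in>blockperms V \<times> {\<gamma>. \<gamma> permutes pts {l}}. h (\<beta> \<circ> \<gamma>))"
  proof (rule sum.reindex_bij_witness[where i = "\<lambda>(\<beta>, \<gamma>). \<beta> \<circ> \<gamma>"
        and j = "\<lambda>\<beta>. (perm_restrict \<beta> (pts V), perm_restrict \<beta> (pts {l}))"])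
    fix \<beta> assume "\<beta> \<in> blockperms (insert l V)"
    then have \<beta>: "\<beta> permutes pts (insert l V)" "\<And>x. lab (\<beta> x) = lab x" by (auto simp: blockperms_def)
    have mem: "\<beta> x \<in> pts W \<longleftrightarrow> x \<in> pts W" if "W \<subseteq> insert l V" for x W
      using permutes_in_image[OF \<beta>(1), of x] \<beta>(2)[of x] that by (auto simp: pts_def)
    have im: "\<beta> ` pts W = pts W" if "W \<subseteq> insert l V" for W
      by (rule endo_inj_surj) (use mem[OF that] permutes_inj_on[OF \<beta>(1)] in auto)
    have pr: "perm_restrict \<beta> (pts W) permutes pts W" if "W \<subseteq> insert l V" for W
      by (rule perm_restrict_permutes[OF permutes_inj_on[OF \<beta>(1)] im[OF that]])
    have e: "perm_restrict \<beta> (pts V) \<circ> perm_restrict \<beta> (pts {l}) = \<beta>"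
      using perm_restrict_union[OF pr pr pts_disjoint[OF l]] \<beta>(1) by (auto simp: pts_insert[symmetric])
    show "(case (perm_restrict \<beta> (pts V), perm_restrict \<beta> (pts {l})) of (\<beta>, \<gamma>) \<Rightarrow> \<beta> \<circ> \<gamma>) = \<beta>"
      using e by simp
    show "(case (perm_restrict \<beta> (pts V), perm_restrict \<beta> (pts {l})) of (\<beta>, \<gamma>) \<Rightarrow> h (\<beta> \<circ> \<gamma>)) = h \<beta>"
      using e by simp
    show "(perm_restrict \<beta> (pts V), perm_restrict \<beta> (pts {l})) \<in> blockperms V \<times> {\<gamma>. \<gamma> permutes pts {l}}"
      using pr[of V] pr[of "{l}"] \<beta>(2) by (auto simp: blockperms_def perm_restrict_def)
  next
    fix p assume "p \<in> blockperms V \<times> {\<gamma>. \<gamma> permutes pts {l}}"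
    then obtain \<beta> \<gamma> where p: "p = (\<beta>, \<gamma>)" and \<beta>: "\<beta> permutes pts V" "\<And>x. lab (\<beta> x) = lab x"
      and \<gamma>: "\<gamma> permutes pts {l}" by (auto simp: blockperms_def)
    have \<gamma>lab: "lab (\<gamma> x) = lab x" for x
      using permutes_in_image[OF \<gamma>, of x] permutes_not_in[OF \<gamma>, of x]
      by (cases "x \<in> pts {l}") (auto simp: pts_def)
    have 1: "(\<beta> \<circ> \<gamma>) x = \<beta> x" if "x \<notin> pts {l}" for x using permutes_not_in[OF \<gamma> that] by simp
    have 2: "(\<beta> \<circ> \<gamma>) x = \<gamma> x" if "x \<notin> pts V" for x
    proof -
      have "\<gamma> x \<notin> pts V"
        using that permutes_in_image[OF \<gamma>, of x] permutes_not_in[OF \<gamma>, of x] pts_disjoint[OF l]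
        by (cases "x \<in> pts {l}") auto
      then show ?thesis using permutes_not_in[OF \<beta>(1)] by simp
    qed
    have dj: "x \<notin> pts {l}" if "x \<in> pts V" for x using that pts_disjoint[OF l] by auto
    have "perm_restrict (\<beta> \<circ> \<gamma>) (pts V) x = \<beta> x" for x
      by (cases "x \<in> pts V") (simp_all only: perm_restrict_simps 1[OF dj] permutes_not_in[OF \<beta>(1)] not_False_eq_True)
    moreover have "perm_restrict (\<beta> \<circ> \<gamma>) (pts {l}) x = \<gamma> x" for x
    proof (cases "x \<in> pts {l}")
      case True
      then have "x \<notin> pts V" using dj by auto
      then show ?thesis using True 2 by (simp only: perm_restrict_simps)
    next
      case False
      then show ?thesis by (simp only: perm_restrict_simps permutes_not_in[OF \<gamma>] not_False_eq_True)
    qed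
    ultimately have "perm_restrict (\<beta> \<circ> \<gamma>) (pts V) = \<beta>" "perm_restrict (\<beta> \<circ> \<gamma>) (pts {l}) = \<gamma>"
      by (simp_all add: fun_eq_iff)
    then show "(perm_restrict (case p of (\<beta>, \<gamma>) \<Rightarrow> \<beta> \<circ> \<gamma>) (pts V), perm_restrict (case p of (\<beta>, \<gamma>) \<Rightarrow> \<beta> \<circ> \<gamma>) (pts {l})) = p"
      by (simp add: p)
    have "\<beta> \<circ> \<gamma> permutes pts (insert l V)"
      by (intro permutes_compose permutes_subset[OF \<beta>(1)] permutes_subset[OF \<gamma>]) (auto simp: pts_def)
    then show "(case p of (\<beta>, \<gamma>) \<Rightarrow> \<beta> \<circ> \<gamma>) \<in> blockperms (insert l V)"
      by (simp add: p blockperms_def \<beta>(2) \<gamma>lab)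
  qed
  then show ?thesis by (simp add: sum.cartesian_product)
qed

lemma block_weight_insert:
  assumes l: "l \<notin> V" "finite V" and \<beta>: "\<beta> permutes pts V" and \<gamma>: "\<gamma> permutes pts {l}"
  shows "block_weight (insert l V) (\<beta> \<circ> \<gamma>) = block_weight V \<beta> * poly (hookpoly (pts {l}) \<gamma>) 1"
proof -
  have "hookpoly (pts {i}) (\<beta> \<circ> \<gamma>) = hookpoly (pts {i}) \<beta>" if "i \<in> V" for i
  proof (rule hookpoly_cong)
    fix x assume "x \<in> pts {i}"
    then have "x \<notin> pts {l}" using that l by (auto simp: pts_def)
    then show "(\<beta> \<circ> \<gamma>) x = \<beta> x" using permutes_not_in[OF \<gamma>] by simp
  qed
  moreover have "hookpoly (pts {l}) (\<beta> \<circ> \<gamma>) = hookpoly (pts {l}) \<gamma>"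
  proof (rule hookpoly_cong)
    fix x assume "x \<in> pts {l}"
    then have "\<gamma> x \<notin> pts V" using permutes_in_image[OF \<gamma>, of x] pts_disjoint[OF l(1)] by auto
    then show "(\<beta> \<circ> \<gamma>) x = \<gamma> x" using permutes_not_in[OF \<beta>] by simp
  qed
  ultimately show ?thesis using l by (simp add: block_weight_def mult.commute)
qed

lemma blockperms_empty: "blockperms {} = {id}"
  by (auto simp: blockperms_def pts_def)

text \<open>If \<open>\<kappa> x\<close> left the block, then \<open>\<kappa>\<close> would send its
  image back to \<open>\<kappa> x\<close>; by injectivity that image would be \<open>x\<close>,
  which lies in the block.\<close>

lemma stay_closed:
  assumes c: "compatible V \<kappa>" and x: "x \<in> stay \<kappa> i" and i: "i \<in> V"
  shows "\<kappa> x \<in> stay \<kappa> i"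
proof -
  have \<kappa>: "\<kappa> permutes pts V" and inv: "\<And>x. x \<in> pts V \<Longrightarrow> lab (\<kappa> x) \<noteq> lab x \<Longrightarrow> \<kappa> (\<kappa> x) = x"
    using c by (auto simp: compatible_def)
  have xV: "x \<in> pts V" and lx: "lab x = i" "lab (\<kappa> x) = i" using x i by (auto simp: stay_def pts_def)
  have kV: "\<kappa> x \<in> pts V" using permutes_in_image[OF \<kappa>] xV by simp
  have "lab (\<kappa> (\<kappa> x)) = i"
  proof (rule ccontr)
    assume "lab (\<kappa> (\<kappa> x)) \<noteq> i"
    then have "\<kappa> (\<kappa> (\<kappa> x)) = \<kappa> x" using inv[OF kV] lx by simp
    then have "\<kappa> (\<kappa> x) = x" using permutes_inj[OF \<kappa>] by (auto dest: injD)
    then show False using \<open>lab (\<kappa> (\<kappa> x)) \<noteq> i\<close> lx by simp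
  qed
  then show ?thesis using kV lx by (auto simp: stay_def pts_def)
qed

text \<open>The decomposition required by \<open>sum_leaf\<close>: \<open>\<iota>\<close> is the
  matching between leaf and neighbour, \<open>\<kappa>'\<close> the part inside the leaf, and
  \<open>\<tau>\<close> the part on the other blocks. \<open>\<tau>\<close> fixes the matched points
  \<open>U'\<close>, so that a permutation can be inserted there.\<close>

lemma leaf_data:
  assumes l: "l \<notin> V" and k: "k \<in> V" and fV: "finite V" and V: "insert l V \<subseteq> {1..n}"
    and adj: "\<And>j. j \<in> V \<Longrightarrow> support_adj n s l j \<Longrightarrow> j = k" and c: "compatible (insert l V) \<kappa>"
  obtains U U' \<iota> \<tau> \<kappa>' where
    "U \<subseteq> pts {l}" "U' \<subseteq> pts {k}" "card U = sym_entry s l k" "\<iota> permutes U \<union> U'" "\<iota> ` U = U'"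
    "\<And>x. \<iota> (\<iota> x) = x" "\<tau> permutes pts V" "\<And>x. x \<in> U' \<Longrightarrow> \<tau> x = x"
    "\<And>x. x \<in> pts V - U' \<Longrightarrow> \<tau> x = \<kappa> x \<and> \<kappa> x \<in> pts V - U'" "\<kappa>' permutes pts {l} - U" "\<kappa> = \<iota> \<circ> \<tau> \<circ> \<kappa>'"
    "stay \<kappa> l = pts {l} - U" "\<And>x. x \<in> pts {l} - U \<Longrightarrow> \<kappa>' x = \<kappa> x" "U' = {x \<in> pts V. lab (\<kappa> x) = l}"
proof -
  let ?W = "insert l V"
  have \<kappa>: "\<kappa> permutes pts ?W" and inv: "\<And>x. x \<in> pts ?W \<Longrightarrow> lab (\<kappa> x) \<noteq> lab x \<Longrightarrow> \<kappa> (\<kappa> x) = x"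
    and cnt: "\<And>i k. i \<in> ?W \<Longrightarrow> k \<in> ?W \<Longrightarrow> i \<noteq> k \<Longrightarrow> card {x \<in> pts {i}. lab (\<kappa> x) = k} = sym_entry s i k"
    using c by (auto simp: compatible_def)
  have kl: "k \<noteq> l" using l k by auto
  have im: "\<kappa> x \<in> pts ?W \<longleftrightarrow> x \<in> pts ?W" for x by (rule permutes_in_image[OF \<kappa>])
  have inj: "inj_on \<kappa> X" for X by (rule permutes_inj_on[OF \<kappa>])
  have \<kappa>i: "\<kappa> x = \<kappa> y \<Longrightarrow> x = y" for x y using permutes_inj[OF \<kappa>] by (auto dest: injD)
  have lW: "x \<in> pts ?W" if "x \<in> pts {l}" for x using that by (auto simp: pts_def)
  have VW: "x \<in> pts ?W" if "x \<in> pts V" for x using that by (auto simp: pts_def)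
  \<comment> \<open>A third block would make one of the counts in \<open>compatible\<close> positive
    and thus be a second neighbour of the leaf.\<close>
  have A: "lab (\<kappa> x) = l \<or> lab (\<kappa> x) = k" if x: "x \<in> pts {l}" for x
  proof (rule ccontr)
    assume n: "\<not> (lab (\<kappa> x) = l \<or> lab (\<kappa> x) = k)"
    let ?j = "lab (\<kappa> x)"
    have j: "?j \<in> V" using im[of x] lW[OF x] n by (auto simp: pts_def)
    have "card {y \<in> pts {l}. lab (\<kappa> y) = ?j} > 0" using x by (subst card_gt_0_iff) auto
    then have "sym_entry s l ?j > 0" using cnt[of l ?j] j n by auto
    then have "support_adj n s l ?j" using V j n by (auto simp: support_adj_def)
    then show False using adj[OF j] n by simp
  qed
  have B: "lab x = k" "\<kappa> (\<kappa> x) = x" if x: "x \<in> pts V" "lab (\<kappa> x) = l" for x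
  proof -
    have lx: "lab x \<noteq> l" using x(1) l by (auto simp: pts_def)
    show e: "\<kappa> (\<kappa> x) = x" using inv[OF VW[OF x(1)]] lx x(2) by simp
    have "\<kappa> x \<in> pts {l}" using im[of x] VW[OF x(1)] x(2) by (auto simp: pts_def)
    then show "lab x = k" using A[of "\<kappa> x"] e lx by simp
  qed
  define U where "U = {x \<in> pts {l}. lab (\<kappa> x) = k}"
  define U' where "U' = {x \<in> pts V. lab (\<kappa> x) = l}"
  have UU: "U \<inter> pts V = {}" using l by (auto simp: U_def pts_def)
  have \<kappa>U: "\<kappa> x \<in> U'" "\<kappa> (\<kappa> x) = x" if x: "x \<in> U" for x
  proof -
    have lx: "x \<in> pts {l}" "lab x = l" "lab (\<kappa> x) = k" using x by (auto simp: U_def pts_def)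
    show e: "\<kappa> (\<kappa> x) = x" using inv[OF lW[OF lx(1)]] lx kl by simp
    have "\<kappa> x \<in> pts V" using im[of x] lW[OF lx(1)] lx k by (auto simp: pts_def)
    then show "\<kappa> x \<in> U'" using e lx by (simp add: U'_def)
  qed
  have \<kappa>U': "\<kappa> x \<in> U" "\<kappa> (\<kappa> x) = x" if x: "x \<in> U'" for x
  proof -
    have h: "x \<in> pts V" "lab (\<kappa> x) = l" using x by (auto simp: U'_def)
    show e: "\<kappa> (\<kappa> x) = x" by (rule B(2)[OF h])
    have "\<kappa> x \<in> pts {l}" using im[of x] VW[OF h(1)] h(2) by (auto simp: pts_def)
    then show "\<kappa> x \<in> U" using e B(1)[OF h] by (simp add: U_def)
  qed
  define \<iota> where "\<iota> = perm_restrict \<kappa> (U \<union> U')"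
  define \<tau> where "\<tau> = perm_restrict \<kappa> (pts V - U')"
  define \<kappa>' where "\<kappa>' = perm_restrict \<kappa> (pts {l} - U)"
  have fU: "finite (U \<union> U')" by (simp add: U_def U'_def)
  have \<kappa>V: "\<kappa> x \<in> pts V - U'" if x: "x \<in> pts V - U'" for x
  proof -
    have lx: "lab x \<noteq> l" using x l by (auto simp: pts_def)
    have lk: "lab (\<kappa> x) \<noteq> l" using x by (auto simp: U'_def)
    have V': "\<kappa> x \<in> pts V" using im[of x] VW[of x] x lk by (auto simp: pts_def)
    have "\<kappa> x \<notin> U'"
    proof
      assume "\<kappa> x \<in> U'"
      then have "\<kappa> (\<kappa> (\<kappa> x)) = \<kappa> x" "lab (\<kappa> (\<kappa> x)) = l" using \<kappa>U'(2) by (auto simp: U'_def)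
      then show False using \<kappa>i lx by metis
    qed
    with V' show ?thesis by simp
  qed
  have st: "stay \<kappa> l = pts {l} - U" using A kl by (auto simp: stay_def U_def)
  have \<kappa>l: "\<kappa> x \<in> pts {l} - U" if "x \<in> pts {l} - U" for x
    using stay_closed[OF c, of x l] that st by simp
  show thesis
  proof
    show "U \<subseteq> pts {l}" "U' = {x \<in> pts V. lab (\<kappa> x) = l}" by (auto simp: U_def U'_def)
    show "U' \<subseteq> pts {k}" using B(1) by (auto simp: U'_def pts_def)
    show "card U = sym_entry s l k" using cnt[of l k] k kl by (simp add: U_def)
    have eU: "\<kappa> ` (U \<union> U') = U \<union> U'"
      by (rule endo_inj_surj[OF fU _ inj]) (use \<kappa>U(1) \<kappa>U'(1) in auto)
    show "\<iota> permutes U \<union> U'" unfolding \<iota>_def by (rule perm_restrict_permutes[OF inj eU])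
    have "\<kappa> ` U = U'"
    proof
      show "U' \<subseteq> \<kappa> ` U"
      proof
        fix x assume "x \<in> U'"
        then show "x \<in> \<kappa> ` U" using \<kappa>U'[of x] by (intro image_eqI[of _ _ "\<kappa> x"]) auto
      qed
    qed (use \<kappa>U in auto)
    moreover have "\<iota> ` U = \<kappa> ` U" unfolding \<iota>_def by (rule image_cong) (auto simp: perm_restrict_def)
    ultimately show "\<iota> ` U = U'" by simp
    show "\<iota> (\<iota> x) = x" for x
      using \<kappa>U[of x] \<kappa>U'[of x] by (simp add: \<iota>_def perm_restrict_def)
    have "\<kappa> ` (pts V - U') = pts V - U'"
      by (rule endo_inj_surj[OF _ _ inj]) (use \<kappa>V in auto)
    then have "\<tau> permutes pts V - U'" unfolding \<tau>_def by (rule perm_restrict_permutes[OF inj])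
    then show "\<tau> permutes pts V" by (rule permutes_subset) auto
    show "\<tau> x = x" if "x \<in> U'" for x using that by (simp add: \<tau>_def perm_restrict_def)
    show "\<tau> x = \<kappa> x \<and> \<kappa> x \<in> pts V - U'" if "x \<in> pts V - U'" for x
      using \<kappa>V[OF that] that by (simp add: \<tau>_def perm_restrict_def)
    have "\<kappa> ` (pts {l} - U) = pts {l} - U"
      by (rule endo_inj_surj[OF _ _ inj]) (use \<kappa>l in auto)
    then show "\<kappa>' permutes pts {l} - U" unfolding \<kappa>'_def by (rule perm_restrict_permutes[OF inj])
    show "stay \<kappa> l = pts {l} - U" by (rule st)
    show "\<kappa>' x = \<kappa> x" if "x \<in> pts {l} - U" for x using that by (simp add: \<kappa>'_def perm_restrict_def)
    have UV: "x \<notin> pts V" if "x \<in> pts {l}" for x using that l by (auto simp: pts_def)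
    have U'V: "x \<in> pts V" if "x \<in> U'" for x using that by (simp add: U'_def)
    have Ul: "x \<in> pts {l}" if "x \<in> U" for x using that by (simp add: U_def)
    show "\<kappa> = \<iota> \<circ> \<tau> \<circ> \<kappa>'"
    proof
      fix x
      consider "x \<in> U" | "x \<in> pts {l} - U" | "x \<in> U'" | "x \<in> pts V - U'" | "x \<notin> pts ?W"
        using pts_insert[of l V] by blast
      then show "\<kappa> x = (\<iota> \<circ> \<tau> \<circ> \<kappa>') x"
      proof cases
        case 1
        then show ?thesis using UV[OF Ul[OF 1]] by (simp add: \<iota>_def \<tau>_def \<kappa>'_def perm_restrict_def)
      next
        case 2
        then have "\<kappa> x \<notin> pts V" "\<kappa> x \<notin> U'" using \<kappa>l[OF 2] UV[of "\<kappa> x"] U'V[of "\<kappa> x"] by auto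
        then show ?thesis using 2 \<kappa>l[OF 2]
          by (simp add: \<iota>_def \<tau>_def \<kappa>'_def perm_restrict_def)
      next
        case 3
        then show ?thesis using UV[of x] U'V[OF 3] by (auto simp: \<iota>_def \<tau>_def \<kappa>'_def perm_restrict_def)
      next
        case 4
        then have "x \<notin> pts {l}" "\<kappa> x \<notin> U" using UV[of x] UV[OF Ul, of "\<kappa> x"] \<kappa>V[OF 4] by auto
        then show ?thesis using 4 \<kappa>V[OF 4] by (simp add: \<iota>_def \<tau>_def \<kappa>'_def perm_restrict_def)
      next
        case 5
        then have "x \<notin> pts {l}" "x \<notin> pts V" "x \<notin> U" "x \<notin> U'" using lW VW Ul U'V by auto
        then show ?thesis using permutes_not_in[OF \<kappa> 5] by (simp add: \<iota>_def \<tau>_def \<kappa>'_def perm_restrict_def)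
      qed
    qed
  qed
qed

text \<open>Removing a leaf produces the smaller systems \<open>kap \<rho>\<close> for all
  \<open>\<rho>\<close>, weighted with \<open>hook U A \<rho>\<close>. In their values
  \<open>\<rho>\<close> occurs only at the neighbour \<open>k\<close>, through the factor
  \<open>hookpoly U \<rho>\<close>, so the sum over \<open>\<rho>\<close> collapses by
  orthogonality.\<close>

theorem netsum_eq_netval:
  assumes "leafy (support_adj n s) V" "V \<subseteq> {1..n}" "compatible V \<kappa>" "\<forall>i\<in>V. pts {i} \<noteq> {}" and K: "K \<ge> 1"
  shows "netsum K V \<kappa> = netval K V \<kappa>"
  using assms(1-4)
proof (induction arbitrary: \<kappa> rule: leafy.induct)
  case (single v)
  have \<kappa>: "\<kappa> permutes pts {v}" using single by (simp add: compatible_def)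
  have "stay \<kappa> v = pts {v}" using permutes_in_image[OF \<kappa>] by (auto simp: stay_def pts_def)
  moreover have "edges {v} = {}" "nbrs {v} v = {}" by (auto simp: edges_def nbrs_def support_adj_def)
  moreover have "cycpoly (pts {v}) \<kappa> div [:1, -1:] = hookpoly (pts {v}) \<kappa>"
  proof -
    have "pts {v} \<noteq> {}" using single.prems by simp
    from cycpoly_eq_hookpoly[OF finite_pts \<kappa> this] show ?thesis
      by (simp only: nonzero_mult_div_cancel_left[OF one_minus_y_nonzero] not_False_eq_True)
  qed
  ultimately have "netval K {v} \<kappa> = content_eval K (card (pts {v})) (hookpoly (pts {v}) \<kappa>)"
    by (simp add: netval_def vertex_poly_def)
  moreover have "netsum K {v} \<kappa> = content_eval K (card (pts {v})) (hookpoly (pts {v}) \<kappa>)"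
  proof -
    have "netsum K {v} \<kappa> = (\<Sum>\<gamma> | \<gamma> permutes pts {v}. block_weight {v} \<gamma> * real (ncol K (pts {v}) (\<kappa> \<circ> \<gamma>)))"
      unfolding netsum_def by (subst sum_blockperms_insert) (simp_all add: blockperms_empty)
    also have "\<dots> = (\<Sum>\<gamma> | \<gamma> permutes pts {v}. poly (hookpoly (pts {v}) \<gamma>) 1 * real (ncol K (pts {v}) (\<kappa> \<circ> \<gamma>)))"
      unfolding block_weight_def by simp
    also have "\<dots> = content_eval K (card (pts {v})) (hookpoly (pts {v}) \<kappa>)"
      by (rule sum_hookpoly_ncol[OF finite_pts \<kappa> K])
    finally show ?thesis .
  qed
  ultimately show ?case by (simp only:)
next
  case (leaf V l k)
  let ?W = "insert l V"
  have l: "l \<notin> V" and k: "k \<in> V" and lk: "support_adj n s l k"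
    and uniq: "\<And>j. j \<in> V \<Longrightarrow> support_adj n s l j \<Longrightarrow> j = k" by (fact leaf.hyps)+
  have c: "compatible ?W \<kappa>" using leaf.prems by simp
  have fV: "finite V" by (rule leafy_finite[OF leaf.hyps(1)])
  have VW: "?W \<subseteq> {1..n}" using leaf.prems by simp
  have kl: "k \<noteq> l" using k l by auto
  obtain U U' \<iota> \<tau> \<kappa>' where U: "U \<subseteq> pts {l}" and U': "U' \<subseteq> pts {k}" and cU: "card U = sym_entry s l k"
    and \<iota>: "\<iota> permutes U \<union> U'" "\<iota> ` U = U'" "\<And>x. \<iota> (\<iota> x) = x"
    and \<tau>: "\<tau> permutes pts V" "\<And>x. x \<in> U' \<Longrightarrow> \<tau> x = x" "\<And>x. x \<in> pts V - U' \<Longrightarrow> \<tau> x = \<kappa> x \<and> \<kappa> x \<in> pts V - U'"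
    and \<kappa>': "\<kappa>' permutes pts {l} - U" and \<kappa>: "\<kappa> = \<iota> \<circ> \<tau> \<circ> \<kappa>'"
    and st: "stay \<kappa> l = pts {l} - U" and \<kappa>'e: "\<And>x. x \<in> pts {l} - U \<Longrightarrow> \<kappa>' x = \<kappa> x"
    and U'e: "U' = {x \<in> pts V. lab (\<kappa> x) = l}"
    by (rule leaf_data[OF l k fV VW uniq c], assumption, assumption, rule that)
  let ?s = "sym_entry s l k"
  have s0: "?s > 0" using lk by (simp add: support_adj_def)
  have Une: "U \<noteq> {}" using s0 cU by auto
  have fU: "finite U" "finite U'" using U U' finite_subset[OF _ finite_pts] by auto
  have U'V: "U' \<subseteq> pts V" by (auto simp: U'e)
  have UV: "U \<inter> pts V = {}" using U pts_disjoint[OF l] by auto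
  \<comment> \<open>\<open>kap \<rho>\<close> closes the gap left by the matching: it acts on
    \<open>U'\<close> as \<open>\<rho>\<close> moved there by \<open>\<iota>\<close>, and as
    \<open>\<kappa>\<close> on the other points of \<open>V\<close>.\<close>
  define kap where "kap \<rho> = (\<iota> \<circ> \<rho> \<circ> \<iota>) \<circ> \<tau>" for \<rho>
  have inv\<iota>: "inv \<iota> = \<iota>" using \<iota>(3) by (intro inv_equality)
  have p\<iota>: "permutation \<iota>" using \<iota>(1) fU by (auto intro: permutes_imp_permutation)
  have \<iota>U': "\<iota> x \<in> U" if "x \<in> U'" for x
  proof -
    have "x \<in> \<iota> ` U" using that \<iota>(2) by simp
    then obtain u where "u \<in> U" "x = \<iota> u" by blast
    then show ?thesis using \<iota>(3) by simp
  qed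
  have \<iota>U: "\<iota> x \<in> U'" if "x \<in> U" for x using that \<iota>(2) by auto
  have conj: "\<iota> \<circ> \<rho> \<circ> \<iota> permutes U'" if \<rho>: "\<rho> permutes U" for \<rho>
  proof (rule permutes_superset)
    show "\<iota> \<circ> \<rho> \<circ> \<iota> permutes U \<union> U'"
      by (intro permutes_compose \<iota>(1) permutes_subset[OF \<rho>]) auto
    fix x assume "x \<in> U \<union> U' - U'"
    then have "\<iota> x \<notin> U" using \<iota>U UV U'V by blast
    then show "(\<iota> \<circ> \<rho> \<circ> \<iota>) x = x" using permutes_not_in[OF \<rho>] \<iota>(3) by simp
  qed
  have kap1: "kap \<rho> x = (\<iota> \<circ> \<rho> \<circ> \<iota>) x" "kap \<rho> x \<in> U'" if \<rho>: "\<rho> permutes U" and x: "x \<in> U'" for \<rho> x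
    using permutes_in_image[OF conj[OF \<rho>], of x] x \<tau>(2)[OF x] by (simp_all add: kap_def)
  have kap2: "kap \<rho> x = \<kappa> x" if \<rho>: "\<rho> permutes U" and x: "x \<in> pts V - U'" for \<rho> x
    using \<tau>(3)[OF x] permutes_not_in[OF conj[OF \<rho>]] by (simp add: kap_def)
  have kapp: "kap \<rho> permutes pts V" if \<rho>: "\<rho> permutes U" for \<rho>
    unfolding kap_def by (rule permutes_compose[OF \<tau>(1) permutes_subset[OF conj[OF \<rho>] U'V]])
  have U'lab: "lab x = k" if "x \<in> U'" for x using that U' by (auto simp: pts_def)
  have U'lab': "lab (\<kappa> x) = l" if "x \<in> U'" for x using that U'e by auto
  \<comment> \<open>Points of \<open>U'\<close> went to the leaf under \<open>\<kappa>\<close> and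
    stay in block \<open>k\<close> under \<open>kap \<rho>\<close>, so no count between two blocks
    of \<open>V\<close> changes.\<close>
  have compat: "compatible V (kap \<rho>)" if \<rho>: "\<rho> permutes U" for \<rho>
    unfolding compatible_def
  proof (intro conjI ballI impI)
    show "kap \<rho> permutes pts V" by (rule kapp[OF \<rho>])
    fix x assume x: "x \<in> pts V" and ne: "lab (kap \<rho> x) \<noteq> lab x"
    then have "x \<notin> U'" using kap1[OF \<rho>] U'lab by metis
    then have x': "x \<in> pts V - U'" using x by simp
    have "x \<in> pts ?W" using x by (auto simp: pts_def)
    then have "\<kappa> (\<kappa> x) = x" using c ne kap2[OF \<rho> x'] by (auto simp: compatible_def)
    then show "kap \<rho> (kap \<rho> x) = x" using kap2[OF \<rho>] \<tau>(3)[OF x'] x' by simp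
  next
    fix i j assume ij: "i \<in> V" "j \<in> V" "i \<noteq> j"
    have "lab (kap \<rho> x) = j \<longleftrightarrow> lab (\<kappa> x) = j" if x: "x \<in> pts {i}" for x
    proof (cases "x \<in> U'")
      case True
      have "i = k" using x U'lab[OF True] by (auto simp: pts_def)
      moreover have "lab (kap \<rho> x) = k" using kap1(2)[OF \<rho> True] U'lab by auto
      ultimately show ?thesis using U'lab'[OF True] ij l by auto
    next
      case False
      then have "x \<in> pts V - U'" using x ij by (auto simp: pts_def)
      then show ?thesis using kap2[OF \<rho>] by simp
    qed
    then have "{x \<in> pts {i}. lab (kap \<rho> x) = j} = {x \<in> pts {i}. lab (\<kappa> x) = j}" by blast
    then show "card {x \<in> pts {i}. lab (kap \<rho> x) = j} = sym_entry s i j"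
      using c ij by (simp add: compatible_def)
  qed
  have IH: "netsum K V (kap \<rho>) = netval K V (kap \<rho>)" if "\<rho> permutes U" for \<rho>
    by (rule leaf.IH[OF _ compat[OF that]]) (use leaf.prems in auto)
  have cyc_l: "cycpoly (pts {l} - U) \<kappa>' = cycpoly (stay \<kappa> l) \<kappa>"
    unfolding st by (rule cycpoly_cong[OF \<kappa>'e])
  let ?c = "\<lambda>A. content_eval K (card (pts {l})) (cycpoly (stay \<kappa> l) \<kappa> * monom 1 A) / hook_content K ?s A"
  \<comment> \<open>\<open>sum_leaf\<close> is applied for each fixed \<open>\<beta>\<close> on the
    other blocks, with \<open>\<tau> \<circ> \<beta>\<close> as \<open>\<sigma>\<close>; the sums
    over \<open>\<beta>\<close> then reassemble to \<open>netsum\<close> of the smaller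
    systems.\<close>
  have step1: "netsum K ?W \<kappa> = (\<Sum>A<min ?s K. ?c A * (\<Sum>\<rho> | \<rho> permutes U. hook U A \<rho> * netsum K V (kap \<rho>)))"
  proof -
    have "netsum K ?W \<kappa> = (\<Sum>\<beta>\<in>blockperms V. block_weight V \<beta> *
       (\<Sum>\<gamma> | \<gamma> permutes pts {l}. poly (hookpoly (pts {l}) \<gamma>) 1 *
          real (ncol K (pts V \<union> pts {l}) (\<iota> \<circ> (\<tau> \<circ> \<beta>) \<circ> (\<kappa>' \<circ> \<gamma>)))))"
      unfolding netsum_def sum_blockperms_insert[OF l] sum_distrib_left pts_insert[of l V]
    proof (rule sum.cong[OF refl], rule sum.cong[OF refl])
      fix \<beta> \<gamma> assume "\<beta> \<in> blockperms V" and g: "\<gamma> \<in> {\<gamma>. \<gamma> permutes pts {l}}"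
      then have \<beta>: "\<beta> permutes pts V" by (simp add: blockperms_def)
      have comm: "\<kappa>' (\<beta> x) = \<beta> (\<kappa>' x)" for x
      proof (cases "x \<in> pts V")
        case True
        then have "\<beta> x \<in> pts V" using permutes_in_image[OF \<beta>] by simp
        then have "x \<notin> pts {l} - U" "\<beta> x \<notin> pts {l} - U" using True pts_disjoint[OF l] by auto
        then show ?thesis using permutes_not_in[OF \<kappa>'] by simp
      next
        case False
        then have "\<kappa>' x \<notin> pts V"
          using permutes_in_image[OF \<kappa>', of x] permutes_not_in[OF \<kappa>', of x] pts_disjoint[OF l]
          by (cases "x \<in> pts {l} - U") auto
        then show ?thesis using False permutes_not_in[OF \<beta>] by simp
      qed
      have e: "\<kappa> \<circ> (\<beta> \<circ> \<gamma>) = \<iota> \<circ> (\<tau> \<circ> \<beta>) \<circ> (\<kappa>' \<circ> \<gamma>)"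
        unfolding \<kappa> by (simp add: fun_eq_iff comm)
      show "block_weight ?W (\<beta> \<circ> \<gamma>) * real (ncol K (pts V \<union> pts {l}) (\<kappa> \<circ> (\<beta> \<circ> \<gamma>))) =
        block_weight V \<beta> * (poly (hookpoly (pts {l}) \<gamma>) 1 *
          real (ncol K (pts V \<union> pts {l}) (\<iota> \<circ> (\<tau> \<circ> \<beta>) \<circ> (\<kappa>' \<circ> \<gamma>))))"
        unfolding e using block_weight_insert[OF l fV \<beta>, of \<gamma>] g by (simp only: mem_Collect_eq mult.assoc)
    qed
    also have "\<dots> = (\<Sum>\<beta>\<in>blockperms V. block_weight V \<beta> * (\<Sum>A<min ?s K. ?c A *
        (\<Sum>\<rho> | \<rho> permutes U. hook U A \<rho> * real (ncol K (pts V) (kap \<rho> \<circ> \<beta>)))))"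
    proof (rule sum.cong[OF refl])
      fix \<beta> assume "\<beta> \<in> blockperms V"
      then have "\<beta> permutes pts V" by (simp add: blockperms_def)
      then have \<sigma>: "\<tau> \<circ> \<beta> permutes pts V" by (rule permutes_compose[OF _ \<tau>(1)])
      have e: "kap \<rho> \<circ> \<beta> = (\<iota> \<circ> \<rho> \<circ> \<iota>) \<circ> (\<tau> \<circ> \<beta>)" for \<rho> by (simp only: kap_def comp_assoc)
      show "block_weight V \<beta> * (\<Sum>\<gamma> | \<gamma> permutes pts {l}. poly (hookpoly (pts {l}) \<gamma>) 1 *
          real (ncol K (pts V \<union> pts {l}) (\<iota> \<circ> (\<tau> \<circ> \<beta>) \<circ> (\<kappa>' \<circ> \<gamma>)))) =
          block_weight V \<beta> * (\<Sum>A<min ?s K. ?c A *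
        (\<Sum>\<rho> | \<rho> permutes U. hook U A \<rho> * real (ncol K (pts V) (kap \<rho> \<circ> \<beta>))))"
        unfolding sum_leaf[OF finite_pts finite_pts pts_disjoint[OF l] U Une U'V \<iota> \<sigma> \<kappa>' K] cU cyc_l e ..
    qed
    also have "\<dots> = (\<Sum>A<min ?s K. \<Sum>\<beta>\<in>blockperms V. block_weight V \<beta> * (?c A *
        (\<Sum>\<rho> | \<rho> permutes U. hook U A \<rho> * real (ncol K (pts V) (kap \<rho> \<circ> \<beta>)))))"
      by (simp only: sum_distrib_left[of "block_weight V _" _ "{..<min ?s K}"]) (rule sum.swap)
    also have "\<dots> = (\<Sum>A<min ?s K. ?c A * (\<Sum>\<rho> | \<rho> permutes U. hook U A \<rho> * netsum K V (kap \<rho>)))"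
    proof (rule sum.cong[OF refl])
      fix A
      have "(\<Sum>\<rho> | \<rho> permutes U. hook U A \<rho> * netsum K V (kap \<rho>)) =
          (\<Sum>\<beta>\<in>blockperms V. \<Sum>\<rho> | \<rho> permutes U. hook U A \<rho> * (block_weight V \<beta> * real (ncol K (pts V) (kap \<rho> \<circ> \<beta>))))"
        unfolding netsum_def sum_distrib_left by (rule sum.swap)
      also have "\<dots> = (\<Sum>\<beta>\<in>blockperms V. block_weight V \<beta> *
          (\<Sum>\<rho> | \<rho> permutes U. hook U A \<rho> * real (ncol K (pts V) (kap \<rho> \<circ> \<beta>))))"
        unfolding sum_distrib_left by (rule sum.cong[OF refl], rule sum.cong[OF refl]) (simp only: mult.left_commute)
      finally show "(\<Sum>\<beta>\<in>blockperms V. block_weight V \<beta> * (?c A *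
        (\<Sum>\<rho> | \<rho> permutes U. hook U A \<rho> * real (ncol K (pts V) (kap \<rho> \<circ> \<beta>))))) =
        ?c A * (\<Sum>\<rho> | \<rho> permutes U. hook U A \<rho> * netsum K V (kap \<rho>))"
        by (simp only: mult.left_commute[of "block_weight V _" "?c A"] sum_distrib_left[of "?c A", symmetric])
    qed
    finally show ?thesis .
  qed
  define e0 where "e0 = (min l k, max l k)"
  have se0: "s e0 = ?s" by (auto simp: e0_def sym_entry_def min_def max_def)
  have Ee: "edges ?W = insert e0 (edges V)"
  proof (rule set_eqI)
    fix e :: "nat \<times> nat"
    obtain i j where e: "e = (i, j)" by (cases e)
    have "support_adj n s i j \<longleftrightarrow> i = k" if "j = l" "i \<in> V" for i j
      using that uniq lk support_adj_sym by blast
    moreover have "support_adj n s i j \<longleftrightarrow> j = k" if "i = l" "j \<in> V" for i j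
      using that uniq lk by blast
    ultimately show "e \<in> edges ?W \<longleftrightarrow> e \<in> insert e0 (edges V)"
      using k l kl by (auto simp: e edges_def e0_def min_def max_def)
  qed
  have e0E: "e0 \<notin> edges V" using l by (auto simp: edges_def e0_def min_def max_def split: if_splits)
  have fE: "finite (edges V)" by (rule finite_subset[of _ "V \<times> V"]) (use fV in \<open>auto simp: edges_def\<close>)
  have "\<not> support_adj n s l l" by (simp add: support_adj_def)
  then have nb_l: "nbrs ?W l = {k}" unfolding nbrs_def using uniq lk k by blast
  have nb_k: "nbrs ?W k = insert l (nbrs V k)"
    using lk support_adj_sym[of n s k l] by (auto simp: nbrs_def)
  have nb_i: "nbrs ?W i = nbrs V i" if "i \<in> V" "i \<noteq> k" for i
  proof -
    have "\<not> support_adj n s i l" using that uniq[OF that(1)] support_adj_sym[of n s i l] by blast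
    then show ?thesis by (auto simp: nbrs_def)
  qed
  have sA: "sym_entry (A(e0 := a)) i j = sym_entry A i j" if "i \<in> V" "j \<in> V" for A i j and a :: nat
  proof -
    have "e0 = (l, k) \<or> e0 = (k, l)" by (simp add: e0_def min_def max_def)
    moreover have "i \<noteq> l" "j \<noteq> l" using that l by auto
    ultimately have "(i, j) \<noteq> e0" "(j, i) \<noteq> e0" by auto
    then show ?thesis by (simp add: sym_entry_def)
  qed
  have sA0: "sym_entry (A(e0 := a)) l k = a" "sym_entry (A(e0 := a)) k l = a" for A and a :: nat
    using kl by (auto simp: sym_entry_def e0_def min_def max_def)
  define rest where "rest A = (\<Prod>j\<in>nbrs V k. [:1, -1:] * monom (1::real) (sym_entry A k j))" for A :: "nat \<times> nat \<Rightarrow> nat"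
  let ?D = "cycpoly (stay \<kappa> k) \<kappa>"
  have vl: "vertex_poly ?W \<kappa> (A(e0 := a)) l = cycpoly (stay \<kappa> l) \<kappa> * monom 1 a" for A a
  proof -
    have "cycpoly (stay \<kappa> l) \<kappa> * ([:1, -1:] * monom 1 a) = [:1, -1:] * (cycpoly (stay \<kappa> l) \<kappa> * monom 1 a)"
      by (simp only: mult.left_commute)
    then show ?thesis unfolding vertex_poly_def nb_l
      by (simp only: sA0 prod.insert prod.empty finite.emptyI empty_iff not_False_eq_True mult_1_right
          nonzero_mult_div_cancel_left[OF one_minus_y_nonzero])
  qed
  have vk: "vertex_poly ?W \<kappa> (A(e0 := a)) k = ?D * monom 1 a * rest A" for A a
  proof -
    have "l \<notin> nbrs V k" "finite (nbrs V k)" using l fV by (auto simp: nbrs_def)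
    then have "(\<Prod>j\<in>nbrs ?W k. [:1, -1:] * monom 1 (sym_entry (A(e0 := a)) k j)) = ([:1, -1:] * monom 1 a) * rest A"
      unfolding nb_k rest_def using sA0(2) sA[OF k]
      by (subst prod.insert) (auto simp: nbrs_def intro!: prod.cong arg_cong2[where f = "(*)"])
    moreover have "?D * (([:1, -1:] * monom 1 a) * rest A) = [:1, -1:] * (?D * monom 1 a * rest A)"
      by (simp only: mult_ac)
    ultimately show ?thesis unfolding vertex_poly_def
      by (simp only: nonzero_mult_div_cancel_left[OF one_minus_y_nonzero])
  qed
  have vi: "vertex_poly V (kap \<rho>) A i = vertex_poly ?W \<kappa> (A(e0 := a)) i"
    if \<rho>: "\<rho> permutes U" and i: "i \<in> V" "i \<noteq> k" for \<rho> A i a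
  proof -
    have k': "kap \<rho> x = \<kappa> x" if "x \<in> pts {i}" for x
    proof -
      have "x \<in> pts V - U'" using that i U'lab by (auto simp: pts_def)
      then show ?thesis by (rule kap2[OF \<rho>])
    qed
    then have "stay (kap \<rho>) i = stay \<kappa> i"
      unfolding stay_def by (intro Collect_cong conj_cong refl) simp
    moreover have "cycpoly (stay \<kappa> i) (kap \<rho>) = cycpoly (stay \<kappa> i) \<kappa>"
      by (rule cycpoly_cong[OF k']) (simp add: stay_def)
    moreover have "(\<Prod>j\<in>nbrs V i. [:1, -1:] * monom 1 (sym_entry A i j)) =
        (\<Prod>j\<in>nbrs V i. [:1, -1:] * monom (1::real) (sym_entry (A(e0 := a)) i j))"
      by (rule prod.cong[OF refl]) (use sA[OF i(1)] in \<open>simp add: nbrs_def\<close>)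
    ultimately show ?thesis by (simp only: vertex_poly_def nb_i[OF i])
  qed
  \<comment> \<open>At the neighbour the points \<open>U'\<close> have joined those that stay; their
    cycle polynomial is that of \<open>\<rho>\<close>, and it provides the factor
    \<open>1 - y\<close> that the division removes.\<close>
  have vk': "vertex_poly V (kap \<rho>) A k = ?D * hookpoly U \<rho> * rest A" if \<rho>: "\<rho> permutes U" for \<rho> A
  proof -
    have k': "kap \<rho> x = \<kappa> x" if "x \<in> stay \<kappa> k" for x
    proof -
      have "x \<in> pts V - U'" using that k U'lab' kl by (auto simp: stay_def pts_def)
      then show ?thesis by (rule kap2[OF \<rho>])
    qed
    have sk: "stay (kap \<rho>) k = stay \<kappa> k \<union> U'"
    proof (rule set_eqI)
      fix x
      show "x \<in> stay (kap \<rho>) k \<longleftrightarrow> x \<in> stay \<kappa> k \<union> U'"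
      proof (cases "x \<in> U'")
        case True
        then show ?thesis using kap1(2)[OF \<rho> True] U'lab U' by (auto simp: stay_def)
      next
        case False
        have "kap \<rho> x = \<kappa> x" if "x \<in> pts {k}"
          using kap2[OF \<rho>, of x] that False k by (auto simp: pts_def)
        then show ?thesis using False by (auto simp: stay_def)
      qed
    qed
    have dj: "stay \<kappa> k \<inter> U' = {}" using U'lab' kl by (auto simp: stay_def)
    have fst: "finite (stay \<kappa> k)" by (simp add: stay_def)
    have cl: "kap \<rho> ` stay \<kappa> k \<subseteq> stay \<kappa> k"
    proof
      fix y assume "y \<in> kap \<rho> ` stay \<kappa> k"
      then obtain x where x: "x \<in> stay \<kappa> k" "y = kap \<rho> x" by auto
      then show "y \<in> stay \<kappa> k" using k'[OF x(1)] stay_closed[OF c x(1)] k by simp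
    qed
    have cl': "kap \<rho> ` U' \<subseteq> U'" using kap1(2)[OF \<rho>] by auto
    have "cycpoly (stay (kap \<rho>) k) (kap \<rho>) = cycpoly (stay \<kappa> k) (kap \<rho>) * cycpoly U' (kap \<rho>)"
      unfolding sk by (rule cycpoly_Un[OF fst fU(2) dj permutes_inj_on[OF kapp[OF \<rho>]] cl cl'])
    also have "cycpoly (stay \<kappa> k) (kap \<rho>) = ?D" by (rule cycpoly_cong[OF k'])
    also have "cycpoly U' (kap \<rho>) = cycpoly (\<iota> ` U) (\<iota> \<circ> \<rho> \<circ> inv \<iota>)"
      unfolding \<iota>(2) inv\<iota> by (rule cycpoly_cong[OF kap1(1)[OF \<rho>]])
    also have "\<dots> = cycpoly U \<rho>" by (rule cycpoly_conj[OF p\<iota> fU(1) permutes_inj[OF \<rho>]])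
    also have "\<dots> = [:1, -1:] * hookpoly U \<rho>" by (rule cycpoly_eq_hookpoly[OF fU(1) \<rho> Une])
    finally have "cycpoly (stay (kap \<rho>) k) (kap \<rho>) * rest A = [:1, -1:] * (?D * hookpoly U \<rho> * rest A)"
      by (simp only: mult_ac)
    then show ?thesis unfolding vertex_poly_def rest_def[symmetric]
      by (simp only: nonzero_mult_div_cancel_left[OF one_minus_y_nonzero])
  qed
  let ?ce = "\<lambda>i. content_eval K (card (pts {i}))"
  \<comment> \<open>The factor of \<open>k\<close> is linear in \<open>hookpoly U \<rho>\<close>,
    which \<open>sum_hook_hookpoly\<close> replaces by \<open>s!\<close> times the power
    \<open>y^a\<close>. This is the power that stands in the vertex polynomial of \<open>k\<close>
    in the larger system.\<close>
  have inner: "(\<Sum>\<rho> | \<rho> permutes U. hook U a \<rho> * (\<Prod>i\<in>V. ?ce i (vertex_poly V (kap \<rho>) A i))) =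
      fact ?s * (\<Prod>i\<in>V. ?ce i (vertex_poly ?W \<kappa> (A(e0 := a)) i))" if a: "a < ?s" for a A
  proof -
    let ?M = "\<Prod>i\<in>V - {k}. ?ce i (vertex_poly ?W \<kappa> (A(e0 := a)) i)"
    have "(\<Sum>\<rho> | \<rho> permutes U. hook U a \<rho> * (\<Prod>i\<in>V. ?ce i (vertex_poly V (kap \<rho>) A i))) =
        (\<Sum>\<rho> | \<rho> permutes U. ?M * ?ce k (smult (hook U a \<rho>) (?D * hookpoly U \<rho> * rest A)))"
    proof (rule sum.cong[OF refl])
      fix \<rho> assume "\<rho> \<in> {\<rho>. \<rho> permutes U}"
      then have \<rho>: "\<rho> permutes U" by simp
      have "(\<Prod>i\<in>V. ?ce i (vertex_poly V (kap \<rho>) A i)) = ?ce k (?D * hookpoly U \<rho> * rest A) * ?M"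
        unfolding prod.remove[OF fV k] vk'[OF \<rho>]
        by (rule arg_cong2[where f = "(*)"], rule refl, rule prod.cong[OF refl]) (use vi[OF \<rho>] in simp)
      then show "hook U a \<rho> * (\<Prod>i\<in>V. ?ce i (vertex_poly V (kap \<rho>) A i)) =
          ?M * ?ce k (smult (hook U a \<rho>) (?D * hookpoly U \<rho> * rest A))"
        by (simp only: content_eval_smult mult_ac)
    qed
    also have "\<dots> = ?M * ?ce k (\<Sum>\<rho> | \<rho> permutes U. smult (hook U a \<rho>) (?D * hookpoly U \<rho> * rest A))"
      by (simp only: content_eval_sum sum_distrib_left)
    also have "(\<Sum>\<rho> | \<rho> permutes U. smult (hook U a \<rho>) (?D * hookpoly U \<rho> * rest A)) =
        (\<Sum>\<rho> | \<rho> permutes U. smult (hook U a \<rho>) (hookpoly U \<rho>)) * (?D * rest A)"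
      unfolding sum_distrib_right by (rule sum.cong[OF refl]) (simp only: mult_smult_left, simp only: mult_ac)
    also have "\<dots> = smult (fact ?s) (?D * monom 1 a * rest A)"
    proof -
      have "monom (fact ?s) a = smult (fact ?s) (monom (1::real) a)" by (simp add: smult_monom)
      then show ?thesis using sum_hook_hookpoly[OF fU(1), of a] a cU
        by (simp add: mult_ac)
    qed
    also have "?M * ?ce k \<dots> = fact ?s * (\<Prod>i\<in>V. ?ce i (vertex_poly ?W \<kappa> (A(e0 := a)) i))"
      unfolding prod.remove[OF fV k] vk by (simp only: content_eval_smult mult_ac)
    finally show ?thesis .
  qed
  let ?P = "PiE (edges V) (\<lambda>e. {..<min (s e) K})"
  let ?E = "\<lambda>A. \<Prod>e\<in>edges V. fact (s e) / hook_content K (s e) (A e)"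
  have "netval K ?W \<kappa> = (\<Sum>(a, A)\<in>{..<min ?s K} \<times> ?P.
      (\<Prod>e\<in>edges ?W. fact (s e) / hook_content K (s e) ((A(e0 := a)) e)) *
     (\<Prod>i\<in>?W. ?ce i (vertex_poly ?W \<kappa> (A(e0 := a)) i)))"
  proof -
    have inj: "inj_on (\<lambda>(a, A). A(e0 := a)) ({..<min ?s K} \<times> ?P)"
      using inj_combinator[OF e0E, of "\<lambda>e. {..<min (s e) K}"] by (simp only: se0)
    show ?thesis unfolding netval_def Ee PiE_insert_eq se0
      by (subst sum.reindex[OF inj]) (simp add: case_prod_unfold)
  qed
  also have "\<dots> = (\<Sum>a<min ?s K. \<Sum>A\<in>?P. ?c a * (?E A * (fact ?s * (\<Prod>i\<in>V. ?ce i (vertex_poly ?W \<kappa> (A(e0 := a)) i)))))"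
    unfolding sum.cartesian_product[symmetric]
  proof (rule sum.cong[OF refl], rule sum.cong[OF refl])
    fix a A
    have "(\<Prod>e\<in>edges ?W. fact (s e) / hook_content K (s e) ((A(e0 := a)) e)) =
        (fact ?s / hook_content K ?s a) * (\<Prod>e\<in>edges V. fact (s e) / hook_content K (s e) ((A(e0 := a)) e))"
      unfolding Ee prod.insert[OF fE e0E] se0 by simp
    also have "(\<Prod>e\<in>edges V. fact (s e) / hook_content K (s e) ((A(e0 := a)) e)) = ?E A"
      by (rule prod.cong[OF refl]) (use e0E in auto)
    finally have 1: "(\<Prod>e\<in>edges ?W. fact (s e) / hook_content K (s e) ((A(e0 := a)) e)) =
        (fact ?s / hook_content K ?s a) * ?E A" .
    show "(\<Prod>e\<in>edges ?W. fact (s e) / hook_content K (s e) ((A(e0 := a)) e)) *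
       (\<Prod>i\<in>?W. ?ce i (vertex_poly ?W \<kappa> (A(e0 := a)) i)) =
       ?c a * (?E A * (fact ?s * (\<Prod>i\<in>V. ?ce i (vertex_poly ?W \<kappa> (A(e0 := a)) i))))"
      unfolding 1 prod.insert[OF fV l] vl by simp
  qed
  also have "\<dots> = (\<Sum>a<min ?s K. ?c a * (\<Sum>\<rho> | \<rho> permutes U. hook U a \<rho> * netsum K V (kap \<rho>)))"
  proof (rule sum.cong[OF refl])
    fix a assume a: "a \<in> {..<min ?s K}"
    have "(\<Sum>\<rho> | \<rho> permutes U. hook U a \<rho> * netsum K V (kap \<rho>)) =
        (\<Sum>\<rho> | \<rho> permutes U. \<Sum>A\<in>?P. hook U a \<rho> * (?E A * (\<Prod>i\<in>V. ?ce i (vertex_poly V (kap \<rho>) A i))))"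
      by (rule sum.cong[OF refl]) (simp add: IH netval_def sum_distrib_left)
    also have "\<dots> = (\<Sum>A\<in>?P. \<Sum>\<rho> | \<rho> permutes U. hook U a \<rho> * (?E A * (\<Prod>i\<in>V. ?ce i (vertex_poly V (kap \<rho>) A i))))"
      by (rule sum.swap)
    also have "\<dots> = (\<Sum>A\<in>?P. ?E A * (\<Sum>\<rho> | \<rho> permutes U. hook U a \<rho> * (\<Prod>i\<in>V. ?ce i (vertex_poly V (kap \<rho>) A i))))"
      by (simp only: mult.left_commute[of "hook U a _"] sum_distrib_left)
    also have "\<dots> = (\<Sum>A\<in>?P. ?E A * (fact ?s * (\<Prod>i\<in>V. ?ce i (vertex_poly ?W \<kappa> (A(e0 := a)) i))))"
      by (rule sum.cong[OF refl]) (use a inner in simp)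
    finally show "(\<Sum>A\<in>?P. ?c a * (?E A * (fact ?s * (\<Prod>i\<in>V. ?ce i (vertex_poly ?W \<kappa> (A(e0 := a)) i))))) =
        ?c a * (\<Sum>\<rho> | \<rho> permutes U. hook U a \<rho> * netsum K V (kap \<rho>))"
      by (simp only: sum_distrib_left[of "?c a"])
  qed
  also have "\<dots> = netsum K ?W \<kappa>" by (rule step1[symmetric])
  finally show ?case by simp
qed

end


section \<open>Trees arise by attaching leaves\<close>

definition joined :: "('v \<Rightarrow> 'v \<Rightarrow> bool) \<Rightarrow> 'v set \<Rightarrow> 'v \<Rightarrow> 'v \<Rightarrow> bool" where
  "joined adj W u v \<longleftrightarrow> (\<exists>p. p \<noteq> [] \<and> distinct p \<and> set p \<subseteq> W \<and> hd p = u \<and> last p = v \<and>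
     (\<forall>j. Suc j < length p \<longrightarrow> adj (p ! j) (p ! Suc j)))"

lemma joined_insert:
  assumes sym: "\<And>u v. adj u v \<Longrightarrow> adj v u"
    and W: "\<And>u v. u \<in> W \<Longrightarrow> v \<in> W \<Longrightarrow> joined adj W u v"
    and l: "l \<notin> W" "k \<in> W" "adj l k" and uv: "u \<in> insert l W" "v \<in> insert l W"
  shows "joined adj (insert l W) u v"
proof -
  consider "u = l" "v = l" | "u = l" "v \<in> W" | "u \<in> W" "v = l" | "u \<in> W" "v \<in> W" using uv by blast
  then show ?thesis
  proof cases
    case 1
    then show ?thesis unfolding joined_def by (intro exI[of _ "[l]"]) auto
  next
    case 2
    from W[OF l(2) 2(2)] obtain p where p: "p \<noteq> []" "distinct p" "set p \<subseteq> W" "hd p = k" "last p = v"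
      "\<And>j. Suc j < length p \<Longrightarrow> adj (p ! j) (p ! Suc j)" unfolding joined_def by blast
    have "adj ((l # p) ! j) ((l # p) ! Suc j)" if "Suc j < length (l # p)" for j
    proof (cases j)
      case 0
      then show ?thesis using l(3) p(1,4) by (simp add: hd_conv_nth)
    next
      case (Suc i)
      then show ?thesis using p(6)[of i] that by simp
    qed
    moreover have "distinct (l # p)" using p l by auto
    ultimately show ?thesis unfolding joined_def using 2 p by (intro exI[of _ "l # p"]) auto
  next
    case 3
    from W[OF 3(1) l(2)] obtain p where p: "p \<noteq> []" "distinct p" "set p \<subseteq> W" "hd p = u" "last p = k"
      "\<And>j. Suc j < length p \<Longrightarrow> adj (p ! j) (p ! Suc j)" unfolding joined_def by blast
    have "adj ((p @ [l]) ! j) ((p @ [l]) ! Suc j)" if "Suc j < length (p @ [l])" for j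
    proof (cases "Suc j < length p")
      case True
      then show ?thesis using p(6)[of j] by (simp add: nth_append)
    next
      case False
      then have "j = length p - 1" "Suc j = length p" using that by auto
      then show ?thesis using sym[OF l(3)] p(1,5) by (simp add: nth_append last_conv_nth)
    qed
    moreover have "distinct (p @ [l])" using p l by auto
    ultimately show ?thesis unfolding joined_def using 3 p by (intro exI[of _ "p @ [l]"]) auto
  next
    case 4
    from W[OF this] obtain p where "p \<noteq> []" "distinct p" "set p \<subseteq> W" "hd p = u" "last p = v"
      "\<forall>j. Suc j < length p \<longrightarrow> adj (p ! j) (p ! Suc j)" unfolding joined_def by blast
    then show ?thesis unfolding joined_def by (intro exI[of _ p]) auto
  qed
qed

text \<open>The vertex \<open>l\<close> closes the path from \<open>u\<close> to \<open>v\<close>.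
  Distinct ends give the path at least two vertices, hence the cycle the required three.\<close>

lemma joined_cycle:
  assumes j: "joined adj W u v" and uv: "u \<noteq> v" and l: "l \<notin> W" "adj l u" "adj v l"
  obtains c where "set c \<subseteq> insert l W" "graph_cycle adj c"
proof -
  from j obtain p where p: "p \<noteq> []" "distinct p" "set p \<subseteq> W" "hd p = u" "last p = v"
      "\<And>j. Suc j < length p \<Longrightarrow> adj (p ! j) (p ! Suc j)" unfolding joined_def by blast
  have len: "length p \<ge> 2"
  proof (rule ccontr)
    assume "\<not> length p \<ge> 2"
    moreover have "length p \<noteq> 0" using p(1) by simp
    ultimately have "length p = 1" by linarith
    then obtain x where "p = [x]" by (auto simp: length_Suc_conv)
    then show False using p(4,5) uv by simp
  qed
  have "adj ((l # p) ! j) ((l # p) ! (Suc j mod length (l # p)))" if j: "j < length (l # p)" for j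
  proof (cases j)
    case 0
    then show ?thesis using l(2) p(1,4) by (simp add: hd_conv_nth)
  next
    case (Suc i)
    show ?thesis
    proof (cases "Suc i < length p")
      case True
      then show ?thesis using Suc p(6)[OF True] by simp
    next
      case False
      then have "i = length p - 1" "Suc (Suc i) = length (l # p)" using j Suc by auto
      then show ?thesis using Suc l(3) p(1,5) by (simp add: last_conv_nth)
    qed
  qed
  then have "graph_cycle adj (l # p)" using len p l(1) by (auto simp: graph_cycle_def)
  then show thesis by (rule that[rotated]) (use p(3) in auto)
qed

text \<open>A largest \<open>W\<close> that is \<open>leafy\<close> and joined by simple paths
  inside itself must be all of \<open>V\<close>. Connectedness would supply an edge leaving
  \<open>W\<close>; its outer end has no second neighbour in \<open>W\<close>, since that would
  close a cycle, so it could be attached as a leaf.\<close>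

lemma is_tree_leafy:
  assumes V: "finite V" and tree: "is_tree V adj" and sym: "\<And>u v. adj u v \<Longrightarrow> adj v u"
    and adjV: "\<And>u v. adj u v \<Longrightarrow> v \<in> V"
  shows "leafy adj V"
proof -
  define P where "P W \<longleftrightarrow> W \<subseteq> V \<and> leafy adj W \<and> (\<forall>u\<in>W. \<forall>v\<in>W. joined adj W u v)" for W
  obtain v0 where v0: "v0 \<in> V" using tree by (auto simp: is_tree_def)
  have "joined adj {v0} v0 v0" unfolding joined_def by (intro exI[of _ "[v0]"]) auto
  then have P0: "P {v0}" using v0 by (simp add: P_def leafy.single)
  have "\<forall>W. P W \<longrightarrow> card W < Suc (card V)" using V card_mono by (auto simp: P_def less_Suc_eq_le)
  from ex_has_greatest_nat[OF P0 this] obtain W where W: "P W" and mx: "\<And>W'. P W' \<Longrightarrow> card W' \<le> card W"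
    by blast
  have WV: "W \<subseteq> V" and lf: "leafy adj W" and jn: "\<And>u v. u \<in> W \<Longrightarrow> v \<in> W \<Longrightarrow> joined adj W u v"
    using W by (auto simp: P_def)
  have fW: "finite W" by (rule leafy_finite[OF lf])
  have Wne: "W \<noteq> {}" using lf by (cases rule: leafy.cases) auto
  have "W = V"
  proof (rule ccontr)
    assume "W \<noteq> V"
    then obtain u v where uv: "u \<in> W" "v \<in> V" "v \<notin> W" using WV Wne by blast
    have "adj\<^sup>*\<^sup>* u v" using tree uv WV by (auto simp: is_tree_def)
    then have "v \<in> W \<or> (\<exists>k l. k \<in> W \<and> l \<notin> W \<and> adj k l)"
      using uv(1) by (induction rule: rtranclp_induct) auto
    then obtain k l where k: "k \<in> W" and l: "l \<notin> W" and kl: "adj k l" using uv(3) by blast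
    have lV: "l \<in> V" by (rule adjV[OF kl])
    have uniq: "j = k" if j: "j \<in> W" and lj: "adj l j" for j
    proof (rule ccontr)
      assume "j \<noteq> k"
      then obtain c where "set c \<subseteq> insert l W" "graph_cycle adj c"
        using joined_cycle[OF jn[OF j k] _ l lj kl] by blast
      then show False using tree lV WV unfolding is_tree_def by blast
    qed
    have "P (insert l W)"
      unfolding P_def
    proof (intro conjI ballI)
      show "insert l W \<subseteq> V" using lV WV by auto
      show "leafy adj (insert l W)" by (rule leafy.leaf[OF lf l k sym[OF kl] uniq])
      fix u v assume u: "u \<in> insert l W" and v: "v \<in> insert l W"
      show "joined adj (insert l W) u v"
        by (rule joined_insert[where k = k]) (fact sym jn l k sym[OF kl] u v)+
    qed
    then show False using mx[of "insert l W"] l fW by simp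
  qed
  then show ?thesis using lf by simp
qed


subsection \<open>Counting pairings of given type\<close>

definition pair_type :: "nat \<Rightarrow> nat \<Rightarrow> nat \<times> nat" where
  "pair_type i k = (min i k, max i k)"

text \<open>Minimum and maximum of the labels make the type a function of the unordered
  pair.\<close>

definition block_type :: "(nat \<times> nat) set \<Rightarrow> nat \<times> nat" where
  "block_type B = (Min (fst ` B), Max (fst ` B))"

text \<open>One multiplicity function covers pairs inside a block, with equal labels, and pairs
  between blocks. Every type is constrained, so pairs of a type with \<open>m e = 0\<close> are
  excluded.\<close>

definition typed_pairings :: "(nat \<times> nat) set \<Rightarrow> (nat \<times> nat \<Rightarrow> nat) \<Rightarrow> (nat \<times> nat) set set set" where
  "typed_pairings S m = {P \<in> pairings S. \<forall>e. card {B \<in> P. block_type B = e} = m e}"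

text \<open>The number of points that a pair of type \<open>e\<close> uses in each block it
  meets.\<close>

definition type_mult :: "nat \<times> nat \<Rightarrow> nat" where
  "type_mult e = (if fst e = snd e then 2 else 1)"

definition block_card :: "(nat \<times> nat) set \<Rightarrow> nat \<Rightarrow> nat" where
  "block_card S i = card {x \<in> S. fst x = i}"

lemma block_type_pair: "block_type {x, y} = pair_type (fst x) (fst y)"
  by (simp add: block_type_def pair_type_def)

lemma pair_type_eq: "pair_type i k = pair_type j l \<longleftrightarrow> (i = j \<and> k = l) \<or> (i = l \<and> k = j)"
  by (auto simp: pair_type_def min_def max_def split: if_splits)

lemma pairings_insert:
  assumes xy: "x \<in> S" "y \<in> S" "x \<noteq> y"
  shows "bij_betw (insert {x, y}) (pairings (S - {x, y})) {P \<in> pairings S. {x, y} \<in> P}"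
proof (rule bij_betw_byWitness[where f' = "\<lambda>P. P - {{x, y}}"])
  have nin: "{x, y} \<notin> P" if "P \<in> pairings (S - {x, y})" for P
    using that by (auto simp: pairings_def partition_on_def)
  then show "\<forall>P\<in>pairings (S - {x, y}). insert {x, y} P - {{x, y}} = P" by auto
  show "\<forall>P\<in>{P \<in> pairings S. {x, y} \<in> P}. insert {x, y} (P - {{x, y}}) = P" by auto
  show "insert {x, y} ` pairings (S - {x, y}) \<subseteq> {P \<in> pairings S. {x, y} \<in> P}"
  proof clarify
    fix P assume "P \<in> pairings (S - {x, y})"
    then have P: "\<Union>P = S - {x, y}" "disjoint P" "{} \<notin> P" "\<forall>B\<in>P. card B = 2"
      by (auto simp: pairings_def partition_on_def)
    have "disjoint (insert {x, y} P)"
      using P(1,2) by (auto simp: pairwise_insert disjnt_def)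
    moreover have "\<Union>(insert {x, y} P) = S" using P(1) xy by auto
    ultimately show "insert {x, y} P \<in> pairings S \<and> {x, y} \<in> insert {x, y} P"
      using P xy by (simp add: pairings_def partition_on_def)
  qed
  show "(\<lambda>P. P - {{x, y}}) ` {P \<in> pairings S. {x, y} \<in> P} \<subseteq> pairings (S - {x, y})"
  proof clarify
    fix P assume "P \<in> pairings S" and xyP: "{x, y} \<in> P"
    then have P: "\<Union>P = S" "disjoint P" "{} \<notin> P" "\<forall>B\<in>P. card B = 2"
      by (auto simp: pairings_def partition_on_def)
    have dj: "B \<inter> {x, y} = {}" if "B \<in> P - {{x, y}}" for B
      using P(2) that xyP by (auto simp: pairwise_def disjnt_def)
    have "\<Union>(P - {{x, y}}) = S - {x, y}"
    proof
      show "\<Union>(P - {{x, y}}) \<subseteq> S - {x, y}" using P(1) dj by blast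
      show "S - {x, y} \<subseteq> \<Union>(P - {{x, y}})" using P(1) by auto
    qed
    moreover have "disjoint (P - {{x, y}})" using P(2) by (rule pairwise_subset) auto
    ultimately show "P - {{x, y}} \<in> pairings (S - {x, y})"
      using P by (simp add: pairings_def partition_on_def)
  qed
qed

lemma finite_pairings: "finite S \<Longrightarrow> finite (pairings S)"
  by (rule finite_subset[of _ "Pow (Pow S)"]) (auto simp: pairings_def partition_on_def)

lemma finite_pairing: "finite S \<Longrightarrow> P \<in> pairings S \<Longrightarrow> finite P"
  by (rule finite_subset[of _ "Pow S"]) (auto simp: pairings_def partition_on_def)

lemma card_typed_pairings_pair:
  assumes S: "finite S" and xy: "x \<in> S" "y \<in> S" "x \<noteq> y" and m: "m (pair_type (fst x) (fst y)) > 0"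
  shows "card {P \<in> typed_pairings S m. {x, y} \<in> P} =
    card (typed_pairings (S - {x, y}) (m(pair_type (fst x) (fst y) := m (pair_type (fst x) (fst y)) - 1)))"
proof -
  let ?e = "pair_type (fst x) (fst y)"
  let ?m' = "m(?e := m ?e - 1)"
  have bij: "bij_betw (insert {x, y}) (pairings (S - {x, y})) {P \<in> pairings S. {x, y} \<in> P}"
    by (rule pairings_insert[OF xy])
  have *: "insert {x, y} P \<in> typed_pairings S m \<longleftrightarrow> P \<in> typed_pairings (S - {x, y}) ?m'"
    if P: "P \<in> pairings (S - {x, y})" for P
  proof -
    have fP: "finite P" by (rule finite_pairing[OF _ P]) (use S in auto)
    have nin: "{x, y} \<notin> P" using P by (auto simp: pairings_def partition_on_def)
    have ins: "insert {x, y} P \<in> pairings S" using bij_betwE[OF bij] P by blast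
    have "card {B \<in> insert {x, y} P. block_type B = e} =
        (if e = ?e then Suc (card {B \<in> P. block_type B = e}) else card {B \<in> P. block_type B = e})" for e
    proof (cases "e = ?e")
      case True
      then have "{B \<in> insert {x, y} P. block_type B = e} = insert {x, y} {B \<in> P. block_type B = e}"
        by (auto simp: block_type_pair)
      then show ?thesis using True fP nin by simp
    next
      case False
      then have "{B \<in> insert {x, y} P. block_type B = e} = {B \<in> P. block_type B = e}"
        by (auto simp: block_type_pair)
      then show ?thesis using False by simp
    qed
    then have "card {B \<in> insert {x, y} P. block_type B = e} = m e \<longleftrightarrow>
        card {B \<in> P. block_type B = e} = ?m' e" for e
      using m by (cases "e = ?e") auto
    then show ?thesis using ins P by (simp add: typed_pairings_def)
  qed
  have "bij_betw (insert {x, y}) (typed_pairings (S - {x, y}) ?m') {P \<in> typed_pairings S m. {x, y} \<in> P}"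
  proof (rule bij_betw_subset[OF bij])
    show "typed_pairings (S - {x, y}) ?m' \<subseteq> pairings (S - {x, y})" by (auto simp: typed_pairings_def)
    show "insert {x, y} ` typed_pairings (S - {x, y}) ?m' = {P \<in> typed_pairings S m. {x, y} \<in> P}"
    proof
      show "insert {x, y} ` typed_pairings (S - {x, y}) ?m' \<subseteq> {P \<in> typed_pairings S m. {x, y} \<in> P}"
      proof (rule image_subsetI)
        fix P assume P: "P \<in> typed_pairings (S - {x, y}) ?m'"
        then have "P \<in> pairings (S - {x, y})" by (simp only: typed_pairings_def mem_Collect_eq)
        from *[OF this] P show "insert {x, y} P \<in> {P \<in> typed_pairings S m. {x, y} \<in> P}" by simp
      qed
      show "{P \<in> typed_pairings S m. {x, y} \<in> P} \<subseteq> insert {x, y} ` typed_pairings (S - {x, y}) ?m'"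
      proof
        fix Q assume Q: "Q \<in> {P \<in> typed_pairings S m. {x, y} \<in> P}"
        then have "Q \<in> {P \<in> pairings S. {x, y} \<in> P}" by (simp add: typed_pairings_def)
        then obtain P where P: "P \<in> pairings (S - {x, y})" "Q = insert {x, y} P"
          using bij_betw_imp_surj_on[OF bij] by blast
        then show "Q \<in> insert {x, y} ` typed_pairings (S - {x, y}) ?m'" using *[OF P(1)] Q by blast
      qed
    qed
  qed
  then show ?thesis by (rule bij_betw_same_card[symmetric])
qed

lemma card_typed_pairings_sum:
  assumes S: "finite S" and x: "x \<in> S"
  shows "card (typed_pairings S m) = (\<Sum>y\<in>S - {x}. card {P \<in> typed_pairings S m. {x, y} \<in> P})"
proof -
  have f: "finite (typed_pairings S m)"
    using finite_pairings[OF S] by (rule rev_finite_subset) (auto simp: typed_pairings_def)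
  have "typed_pairings S m = (\<Union>y\<in>S - {x}. {P \<in> typed_pairings S m. {x, y} \<in> P})"
  proof
    show "typed_pairings S m \<subseteq> (\<Union>y\<in>S - {x}. {P \<in> typed_pairings S m. {x, y} \<in> P})"
    proof
      fix P assume P: "P \<in> typed_pairings S m"
      then have h: "\<Union>P = S" "\<forall>B\<in>P. card B = 2" by (auto simp: typed_pairings_def pairings_def partition_on_def)
      then obtain B where B: "B \<in> P" "x \<in> B" using x by blast
      then obtain y where "y \<noteq> x" "B = {x, y}" using h(2) by (metis card_2_iff doubleton_eq_iff insertE singletonD)
      then show "P \<in> (\<Union>y\<in>S - {x}. {P \<in> typed_pairings S m. {x, y} \<in> P})" using P B h(1) by auto
    qed
  qed auto
  moreover have "card (\<Union>y\<in>S - {x}. {P \<in> typed_pairings S m. {x, y} \<in> P}) =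
      (\<Sum>y\<in>S - {x}. card {P \<in> typed_pairings S m. {x, y} \<in> P})"
  proof (rule card_UN_disjoint)
    show "\<forall>y\<in>S - {x}. finite {P \<in> typed_pairings S m. {x, y} \<in> P}" using f by simp
    show "\<forall>y\<in>S - {x}. \<forall>z\<in>S - {x}. y \<noteq> z \<longrightarrow>
        {P \<in> typed_pairings S m. {x, y} \<in> P} \<inter> {P \<in> typed_pairings S m. {x, z} \<in> P} = {}"
    proof (intro ballI impI equals0I)
      fix y z P assume yz: "y \<in> S - {x}" "z \<in> S - {x}" "y \<noteq> z"
        and P: "P \<in> {P \<in> typed_pairings S m. {x, y} \<in> P} \<inter> {P \<in> typed_pairings S m. {x, z} \<in> P}"
      then have "disjoint P" by (auto simp: typed_pairings_def pairings_def partition_on_def)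
      moreover have "{x, y} \<inter> {x, z} \<noteq> {}" by auto
      ultimately have "{x, y} = {x, z}" using P pairwiseD[of disjnt P "{x, y}" "{x, z}"]
        unfolding disjnt_def by blast
      then show False using yz by (auto simp: doubleton_eq_iff)
    qed
  qed (use S in auto)
  ultimately show ?thesis by simp
qed

definition type_set :: "nat set \<Rightarrow> (nat \<times> nat) set" where
  "type_set V = {(i, k). i \<in> V \<and> k \<in> V \<and> i \<le> k}"

lemma prod_fact_block_card:
  assumes V: "finite V" and S: "finite S" and x: "x \<in> S" "fst x \<in> V"
  shows "(\<Prod>i\<in>V. fact (block_card S i) :: real) =
    real (block_card S (fst x)) * (\<Prod>i\<in>V. fact (block_card (S - {x}) i))"
proof -
  have 1: "block_card (S - {x}) i = block_card S i" if "i \<noteq> fst x" for i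
    unfolding block_card_def by (rule arg_cong[where f = card]) (use that in auto)
  have e: "{z \<in> S - {x}. fst z = fst x} = {z \<in> S. fst z = fst x} - {x}" by auto
  have 2: "block_card S (fst x) = Suc (block_card (S - {x}) (fst x))"
    unfolding block_card_def e by (rule card.remove) (use S x in auto)
  have "(\<Prod>i\<in>V - {fst x}. fact (block_card S i) :: real) = (\<Prod>i\<in>V - {fst x}. fact (block_card (S - {x}) i))"
    by (rule prod.cong) (simp_all add: 1)
  then show ?thesis
    unfolding prod.remove[OF V x(2)] 2 by simp
qed

lemma sum_type_upd:
  assumes V: "finite V" and i: "i \<in> V" "k \<in> V" "j \<in> V" and m: "m (pair_type i k) > 0"
  shows "(\<Sum>l\<in>V. type_mult (pair_type j l) * m (pair_type j l)) =
    (\<Sum>l\<in>V. type_mult (pair_type j l) * (m(pair_type i k := m (pair_type i k) - 1)) (pair_type j l)) +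
    ((if j = i then 1 else 0) + (if j = k then 1 else 0))"
proof -
  let ?e = "pair_type i k"
  have "(\<Sum>l\<in>V. type_mult (pair_type j l) * m (pair_type j l)) =
      (\<Sum>l\<in>V. type_mult (pair_type j l) * (m(?e := m ?e - 1)) (pair_type j l) +
         (if pair_type j l = ?e then type_mult (pair_type j l) else 0))"
  proof (rule sum.cong[OF refl])
    fix l
    show "type_mult (pair_type j l) * m (pair_type j l) =
        type_mult (pair_type j l) * (m(?e := m ?e - 1)) (pair_type j l) +
         (if pair_type j l = ?e then type_mult (pair_type j l) else 0)"
      using m by (cases "m ?e") auto
  qed
  moreover have "(\<Sum>l\<in>V. if pair_type j l = ?e then type_mult (pair_type j l) else 0) =
      (if j = i then 1 else 0) + (if j = k then 1 else 0)"
  proof -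
    consider "j = i" "j = k" | "j = i" "j \<noteq> k" | "j \<noteq> i" "j = k" | "j \<noteq> i" "j \<noteq> k" by blast
    then show ?thesis
    proof cases
      case 1
      then have "(if pair_type j l = ?e then type_mult (pair_type j l) else 0) = (if l = i then 2 else 0)" for l
        by (auto simp: pair_type_eq) (simp add: pair_type_def type_mult_def)
      then show ?thesis using 1 V i by simp
    next
      case 2
      then have "(if pair_type j l = ?e then type_mult (pair_type j l) else 0) = (if l = k then 1 else 0)" for l
        by (auto simp: pair_type_eq) (simp add: pair_type_def type_mult_def min_def max_def)
      then show ?thesis using 2 V i by simp
    next
      case 3
      then have "(if pair_type j l = ?e then type_mult (pair_type j l) else 0) = (if l = i then 1 else 0)" for l
        by (auto simp: pair_type_eq) (simp add: pair_type_def type_mult_def min_def max_def)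
      then show ?thesis using 3 V i by simp
    next
      case 4
      then have "pair_type j l \<noteq> ?e" for l by (auto simp: pair_type_eq)
      then show ?thesis using 4 by simp
    qed
  qed
  ultimately show ?thesis by (simp add: sum.distrib)
qed

text \<open>The order of the stabiliser of a pairing of type \<open>m\<close> under block-preserving
  permutations: pairs of equal type may be interchanged, and the two points of a pair inside a block
  may be swapped.\<close>

definition type_denom :: "nat set \<Rightarrow> (nat \<times> nat \<Rightarrow> nat) \<Rightarrow> real" where
  "type_denom V m = (\<Prod>e\<in>type_set V. real (type_mult e) ^ m e * fact (m e))"

lemma finite_type_set: "finite V \<Longrightarrow> finite (type_set V)"
  by (rule finite_subset[of _ "V \<times> V"]) (auto simp: type_set_def)

lemma type_denom_upd:
  assumes "finite V" "e \<in> type_set V" "m e > 0"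
  shows "type_denom V m = real (type_mult e) * real (m e) * type_denom V (m(e := m e - 1))"
proof -
  obtain k where k: "m e = Suc k" using assms(3) by (cases "m e") auto
  have "(\<Prod>f\<in>type_set V - {e}. real (type_mult f) ^ m f * fact (m f)) =
      (\<Prod>f\<in>type_set V - {e}. real (type_mult f) ^ (m(e := m e - 1)) f * fact ((m(e := m e - 1)) f))"
    by (rule prod.cong) auto
  then show ?thesis
    unfolding type_denom_def prod.remove[OF finite_type_set[OF assms(1)] assms(2)] by (simp add: k)
qed

text \<open>By induction, removing a point together with its partner.\<close>

theorem card_typed_pairings:
  assumes V: "finite V" and "finite S" "fst ` S \<subseteq> V"
    and "\<And>i. i \<in> V \<Longrightarrow> block_card S i = (\<Sum>k\<in>V. type_mult (pair_type i k) * m (pair_type i k))"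
    and "\<And>e. e \<notin> type_set V \<Longrightarrow> m e = 0"
  shows "real (card (typed_pairings S m)) * type_denom V m = (\<Prod>i\<in>V. fact (block_card S i))"
  using assms(2-)
proof (induction "card S" arbitrary: S m rule: less_induct)
  case less
  have S: "finite S" and SV: "fst ` S \<subseteq> V" by (fact less.prems)+
  note bc = less.prems(3) and m0 = less.prems(4)
  show ?case
  proof (cases "S = {}")
    case True
    have mz: "m e = 0" for e
    proof (cases "e \<in> type_set V")
      case e: True
      then obtain i k where ik: "e = (i, k)" "i \<in> V" "k \<in> V" "i \<le> k" by (auto simp: type_set_def)
      have "type_mult (pair_type i k) * m (pair_type i k) \<le> (\<Sum>k\<in>V. type_mult (pair_type i k) * m (pair_type i k))"
        using V ik by (intro member_le_sum) auto
      also have "\<dots> = 0" using bc[OF ik(2)] True by (simp add: block_card_def)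
      finally show ?thesis using ik by (simp add: pair_type_def type_mult_def split: if_splits)
    qed (use m0 in auto)
    have "P = {}" if "P \<in> pairings S" for P
    proof (rule equals0I)
      fix B assume "B \<in> P"
      then have "B \<subseteq> {}" "card B = 2" using that True by (auto simp: pairings_def partition_on_def)
      then show False by simp
    qed
    moreover have "{} \<in> pairings S" using True by (simp add: pairings_def partition_on_def)
    ultimately have "pairings S = {{}}" by blast
    then have "P \<in> typed_pairings S m \<longleftrightarrow> P = {}" for P
      by (cases "P = {}") (simp_all add: typed_pairings_def mz)
    then have "typed_pairings S m = {{}}" by blast
    then show ?thesis using True by (simp add: type_denom_def mz block_card_def)
  next
    case False
    then obtain x where x: "x \<in> S" by auto
    let ?i = "fst x"
    let ?T = "\<lambda>S. (\<Prod>i\<in>V. fact (block_card S i)) :: real"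
    have iV: "?i \<in> V" using x SV by auto
    have fx: "finite (S - {x})" using S by simp
    \<comment> \<open>Pairing \<open>x\<close> with \<open>y\<close> lowers \<open>m\<close> by 1 at
      one type. \<open>type_denom\<close> thereby loses the factor \<open>type_mult * m\<close>, and
      the product of factorials loses one factor for \<open>x\<close> and one for
      \<open>y\<close>.\<close>
    have term_y: "real (card {P \<in> typed_pairings S m. {x, y} \<in> P}) * type_denom V m =
        real (type_mult (pair_type ?i (fst y)) * m (pair_type ?i (fst y))) *
          (?T (S - {x}) / real (block_card (S - {x}) (fst y)))" if y: "y \<in> S - {x}" for y
    proof (cases "m (pair_type ?i (fst y)) > 0")
      case False
      have "{P \<in> typed_pairings S m. {x, y} \<in> P} = {}"
      proof (rule equals0I)
        fix P assume P: "P \<in> {P \<in> typed_pairings S m. {x, y} \<in> P}"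
        then have "finite P" using finite_pairing[OF S] by (simp add: typed_pairings_def)
        then have "card {B \<in> P. block_type B = pair_type ?i (fst y)} > 0"
          using P by (subst card_gt_0_iff) (auto simp: block_type_pair)
        moreover have "card {B \<in> P. block_type B = pair_type ?i (fst y)} = m (pair_type ?i (fst y))"
          using P unfolding typed_pairings_def by blast
        ultimately show False using False by simp
      qed
      then show ?thesis using False by (simp only: card.empty) simp
    next
      case True
      let ?e = "pair_type ?i (fst y)"
      let ?m' = "m(?e := m ?e - 1)"
      let ?S' = "S - {x, y}"
      have yS: "y \<in> S" "x \<noteq> y" and yV: "fst y \<in> V" using y SV by auto
      have S': "?S' = S - {x} - {y}" by auto
      have eV: "?e \<in> type_set V" using iV yV by (auto simp: pair_type_def type_set_def min_def max_def)
      have lt: "card ?S' < card S" using S x by (intro psubset_card_mono) auto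
      have bcx: "block_card S j = block_card ?S' j + ((if j = ?i then 1 else 0) + (if j = fst y then 1 else 0))" for j
      proof -
        have "{z \<in> S. fst z = j} = {z \<in> ?S'. fst z = j} \<union> ({z \<in> {x}. fst z = j} \<union> {z \<in> {y}. fst z = j})"
          using x yS by auto
        moreover have "card ({z \<in> ?S'. fst z = j} \<union> ({z \<in> {x}. fst z = j} \<union> {z \<in> {y}. fst z = j})) =
            card {z \<in> ?S'. fst z = j} + (card {z \<in> {x}. fst z = j} + card {z \<in> {y}. fst z = j})"
          using S yS by (subst card_Un_disjoint; (subst card_Un_disjoint)?) auto
        moreover have "card {z \<in> {u}. fst z = j} = (if j = fst u then 1 else 0)" for u :: "nat \<times> nat"
        proof -
          have "{z \<in> {u}. fst z = j} = (if j = fst u then {u} else {})" by auto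
          then show ?thesis by simp
        qed
        ultimately show ?thesis by (simp add: block_card_def)
      qed
      have "real (card (typed_pairings ?S' ?m')) * type_denom V ?m' = ?T ?S'"
      proof (rule less.hyps[OF lt])
        show "finite ?S'" using S by simp
        show "fst ` ?S' \<subseteq> V" using SV by auto
        show "?m' e = 0" if "e \<notin> type_set V" for e using m0[OF that] eV that by auto
        fix j assume j: "j \<in> V"
        show "block_card ?S' j = (\<Sum>k\<in>V. type_mult (pair_type j k) * ?m' (pair_type j k))"
          using bc[OF j] bcx[of j] sum_type_upd[OF V iV yV j, of m] True by linarith
      qed
      moreover have "card {P \<in> typed_pairings S m. {x, y} \<in> P} = card (typed_pairings ?S' ?m')"
        by (rule card_typed_pairings_pair[where m = m, OF S x yS True])
      moreover have "?T (S - {x}) = real (block_card (S - {x}) (fst y)) * ?T ?S'"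
        unfolding S' by (rule prod_fact_block_card[OF V fx y yV])
      moreover have "block_card (S - {x}) (fst y) > 0"
      proof -
        have "y \<in> {z \<in> S - {x}. fst z = fst y}" using y by simp
        then show ?thesis unfolding block_card_def using fx
          by (intro card_gt_0_iff[THEN iffD2] conjI) (blast, simp)
      qed
      ultimately show ?thesis
        unfolding type_denom_upd[where m = m, OF V eV True] by simp
    qed
    \<comment> \<open>This covers a block \<open>k\<close> without points other than
      \<open>x\<close>, where the quotient by its size cannot be cancelled. If \<open>k\<close> is
      the block of \<open>x\<close>, twice the multiplicity is at most 1, hence the multiplicity is
      0.\<close>
    have zero: "type_mult (pair_type ?i k) * m (pair_type ?i k) = 0" if k: "k \<in> V" "block_card (S - {x}) k = 0" for k
    proof (cases "k = ?i")
      case True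
      have "{z \<in> S. fst z = k} = insert x {z \<in> S - {x}. fst z = k}" using x True by auto
      then have "block_card S k = 1" using k(2) fx by (simp add: block_card_def)
      moreover have "type_mult (pair_type k k) * m (pair_type k k) \<le> block_card S k"
        unfolding bc[OF k(1)] using V k(1) by (intro member_le_sum) auto
      moreover have "type_mult (pair_type k k) = 2" by (simp add: type_mult_def pair_type_def)
      ultimately show ?thesis using True by simp
    next
      case False
      then have "{z \<in> S. fst z = k} = {z \<in> S - {x}. fst z = k}" by auto
      then have "block_card S k = 0" using k(2) by (simp add: block_card_def)
      moreover have "type_mult (pair_type k ?i) * m (pair_type k ?i) \<le> block_card S k"
        unfolding bc[OF k(1)] using V iV by (intro member_le_sum) auto
      moreover have "pair_type k ?i = pair_type ?i k" by (simp add: pair_type_eq)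
      ultimately show ?thesis by simp
    qed
    have "real (card (typed_pairings S m)) * type_denom V m =
        (\<Sum>y\<in>S - {x}. real (type_mult (pair_type ?i (fst y)) * m (pair_type ?i (fst y))) *
          (?T (S - {x}) / real (block_card (S - {x}) (fst y))))"
      unfolding card_typed_pairings_sum[OF S x, of m] of_nat_sum sum_distrib_right
      by (rule sum.cong[OF refl]) (rule term_y)
    also have "\<dots> = (\<Sum>k\<in>V. \<Sum>y | y \<in> S - {x} \<and> fst y = k. real (type_mult (pair_type ?i (fst y)) * m (pair_type ?i (fst y))) *
          (?T (S - {x}) / real (block_card (S - {x}) (fst y))))"
      by (rule sum.group[OF fx V, symmetric]) (use SV in auto)
    also have "\<dots> = (\<Sum>k\<in>V. real (type_mult (pair_type ?i k) * m (pair_type ?i k)) * ?T (S - {x}))"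
    proof (rule sum.cong[OF refl])
      fix k assume k: "k \<in> V"
      have "(\<Sum>y | y \<in> S - {x} \<and> fst y = k. real (type_mult (pair_type ?i (fst y)) * m (pair_type ?i (fst y))) *
          (?T (S - {x}) / real (block_card (S - {x}) (fst y)))) =
          real (block_card (S - {x}) k) * (real (type_mult (pair_type ?i k) * m (pair_type ?i k)) *
          (?T (S - {x}) / real (block_card (S - {x}) k)))"
        by (simp add: block_card_def)
      also have "\<dots> = real (type_mult (pair_type ?i k) * m (pair_type ?i k)) * ?T (S - {x})"
      proof (cases "block_card (S - {x}) k = 0")
        case True
        then show ?thesis using zero[OF k True] by (simp only: mult_zero_left of_nat_0)
      next
        case False
        then show ?thesis by simp
      qed
      finally show "(\<Sum>y | y \<in> S - {x} \<and> fst y = k. real (type_mult (pair_type ?i (fst y)) * m (pair_type ?i (fst y))) *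
          (?T (S - {x}) / real (block_card (S - {x}) (fst y)))) =
          real (type_mult (pair_type ?i k) * m (pair_type ?i k)) * ?T (S - {x})" .
    qed
    \<comment> \<open>Summed over the block of the partner, the multiplicities give the size of the
      block of \<open>x\<close>, by the hypothesis on \<open>m\<close>.\<close>
    also have "\<dots> = real (block_card S ?i) * ?T (S - {x})"
      unfolding bc[OF iV] by (simp add: sum_distrib_right)
    also have "\<dots> = ?T S" by (rule prod_fact_block_card[OF V S x iV, symmetric])
    finally show ?thesis .
  qed
qed


subsection \<open>Contribution of a block\<close>

lemma cycpoly_pair:
  assumes xy: "x \<noteq> y" and \<mu>: "\<mu> x = y" "\<mu> y = x"
  shows "cycpoly {x, y} \<mu> = [:1, 0, -1:]"
proof -
  let ?c = "cycle_of_list [x, y]"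
  have c: "?c permutes {x, y}" "cyclic_on ?c {x, y}"
    using cycle_permutes[of "[x, y]"] cyclic_cycle_of_list[of "[x, y]"] xy by auto
  have card: "card {x, y} = 2" using xy by simp
  have "cycpoly {x, y} \<mu> = cycpoly {x, y} ?c"
    by (rule cycpoly_cong) (use \<mu> in auto)
  also have "\<dots> = [:1, -1:] * hookpoly {x, y} ?c"
    by (rule cycpoly_eq_hookpoly[OF _ c(1)]) auto
  also have "hookpoly {x, y} ?c = (\<Sum>b<2. monom 1 b)"
    unfolding hookpoly_def card
    by (rule sum.cong[OF refl]) (use hook_cyclic[OF _ c] card in simp)
  also have "\<dots> = [:1, 1:]" by (simp add: numeral_2_eq_2 monom_Suc monom_0 one_pCons)
  finally show ?thesis by simp
qed

text \<open>Each pair is a cycle of length 2 and contributes the factor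
  \<open>1 - y^2\<close>.\<close>

lemma cycpoly_pairing:
  assumes "finite P" "\<And>B. B \<in> P \<Longrightarrow> \<exists>x y. x \<noteq> y \<and> B = {x, y} \<and> \<mu> x = y \<and> \<mu> y = x"
    "pairwise disjnt P" and inj: "inj \<mu>"
  shows "cycpoly (\<Union>P) \<mu> = [:1, 0, -1:] ^ card P"
  using assms(1-3)
proof (induction P rule: finite_induct)
  case empty
  have "isgn {} \<mu> = 1" unfolding isgn_def by (simp add: agree_def)
  then show ?case by (simp add: cycpoly_def one_pCons monom_0)
next
  case (insert B P)
  obtain x y where B: "x \<noteq> y" "B = {x, y}" "\<mu> x = y" "\<mu> y = x" using insert.prems(1)[of B] by auto
  have fin: "finite (\<Union>P)"
  proof (rule finite_Union[OF insert.hyps(1)])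
    fix C assume "C \<in> P"
    then obtain u v where "C = {u, v}" using insert.prems(1)[of C] by auto
    then show "finite C" by simp
  qed
  have dj: "B \<inter> \<Union>P = {}"
    using insert.prems(2) insert.hyps(2) by (auto simp: pairwise_insert disjnt_def)
  have cl: "\<mu> ` \<Union>P \<subseteq> \<Union>P"
  proof
    fix z assume "z \<in> \<mu> ` \<Union>P"
    then obtain C w where C: "C \<in> P" "w \<in> C" "z = \<mu> w" by auto
    then obtain u v where "C = {u, v}" "\<mu> u = v" "\<mu> v = u" using insert.prems(1)[of C] by auto
    then show "z \<in> \<Union>P" using C by auto
  qed
  have "cycpoly (B \<union> \<Union>P) \<mu> = cycpoly B \<mu> * cycpoly (\<Union>P) \<mu>"
  proof (rule cycpoly_Un[OF _ fin dj inj_on_subset[OF inj subset_UNIV] _ cl])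
    show "finite B" using B(2) by simp
    show "\<mu> ` B \<subseteq> B" unfolding B(2) by (simp add: B(3,4))
  qed
  moreover have "cycpoly (\<Union>P) \<mu> = [:1, 0, -1:] ^ card P"
    by (rule insert.IH) (use insert.prems in \<open>auto simp: pairwise_insert\<close>)
  ultimately show ?case using insert.hyps cycpoly_pair[OF B(1,3,4)] B(2) by simp
qed

lemma content_eval_diff: "content_eval K p (f - g) = content_eval K p f - content_eval K p g"
  using content_eval_add[of K p f "smult (-1) g"] content_eval_smult[of K p "-1" g] by simp

lemma pochhammer_backward_diff:
  "pochhammer x (Suc r) - pochhammer (x - 1) (Suc r) = real (Suc r) * pochhammer x r" for x :: real
  by (simp add: pochhammer_Suc[of x] pochhammer_rec[of "x - 1"] algebra_simps)

text \<open>Raising the exponent of \<open>y\<close> by 1 acts on the content product as lowering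
  \<open>K\<close> by 1, so multiplication by \<open>1 - y\<close> is a backward difference. It
  lowers the degree of a rising factorial by 1 and multiplies by the old degree; \<open>m\<close> of
  these degrees make up \<open>p! / (p - m)!\<close>.\<close>

lemma content_eval_power:
  assumes "m \<le> p"
  shows "content_eval K p ([:1, -1:] ^ m * monom 1 b) =
    fact p / fact (p - m) * pochhammer (real K - real b) (p - m)"
  using assms
proof (induction m arbitrary: b)
  case 0
  then show ?case by (simp add: content_eval_monom hook_content_def)
next
  case (Suc m)
  define r where "r = p - Suc m"
  have r: "p - m = Suc r" "p - Suc m = r" using Suc.prems by (auto simp: r_def)
  let ?x = "real K - real b"
  have "[:1, -1:] * monom (1::real) b = monom 1 b - monom 1 (Suc b)"
    by (simp add: monom_Suc mult_pCons_left)
  then have "[:1, -1:] ^ Suc m * monom (1::real) b = [:1, -1:] ^ m * monom 1 b - [:1, -1:] ^ m * monom 1 (Suc b)"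
    by (simp only: power_Suc2 mult.assoc right_diff_distrib)
  then have "content_eval K p ([:1, -1:] ^ Suc m * monom 1 b) =
      fact p / fact (Suc r) * (pochhammer ?x (Suc r) - pochhammer (?x - 1) (Suc r))"
    using Suc by (simp only: content_eval_diff r) (simp add: r algebra_simps diff_divide_distrib)
  also have "pochhammer ?x (Suc r) - pochhammer (?x - 1) (Suc r) = real (Suc r) * pochhammer ?x r"
    by (rule pochhammer_backward_diff)
  finally show ?case by (simp add: r)
qed

text \<open>For \<open>K \<le> b\<close> the assumption places a factor 0 in the product, in
  agreement with the convention for reciprocal factorials of negative numbers.\<close>

lemma pochhammer_eq_recip_fact:
  assumes "b < K + r"
  shows "pochhammer (real K - real b) r = fact (K + r - b - 1) * recip_fact (int K - int b - 1)"
proof (cases "b < K")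
  case True
  define j where "j = K - b - 1"
  have K: "K = b + Suc j" using True by (simp add: j_def)
  have "fact (j + r) = (fact j :: real) * pochhammer (1 + real j) r"
    using pochhammer_product'[of "1::real" j r] by (simp add: pochhammer_fact)
  then have "pochhammer (1 + real j) r = fact (j + r) / fact j" by simp
  then show ?thesis by (simp add: K recip_fact_def add_ac)
next
  case False
  then have "pochhammer (real K - real b) r = 0"
    unfolding pochhammer_eq_0_iff using assms by (intro exI[of _ "b - K"]) (auto simp: of_nat_diff)
  then show ?thesis using False by (simp add: recip_fact_def)
qed

text \<open>\<open>t\<close> counts the factors from which \<open>1 - y\<close> is chosen instead of
  \<open>2 y\<close>; it becomes the summation variable of the formula.\<close>

lemma one_minus_square_power:
  "[:1, 0, -1:] ^ q = (\<Sum>t\<le>q. smult (real (q choose t) * 2 ^ (q - t)) ([:1, -1:] ^ (q + t) * monom 1 (q - t)))"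
proof -
  have 1: "[:1, 0, -1:] = [:1, -1:] * ([:1, -1:] + monom (2::real) 1)"
    by (simp add: monom_Suc monom_0)
  have m: "monom (2::real) 1 ^ j = smult (2 ^ j) (monom 1 j)" for j
    by (simp add: monom_power smult_monom)
  show ?thesis
    unfolding 1 power_mult_distrib binomial_ring sum_distrib_left
  proof (rule sum.cong[OF refl])
    fix t
    have c: "of_nat (q choose t) * f = smult (real (q choose t)) f" for f :: "real poly"
      by (simp add: of_nat_poly)
    show "[:1, -1:] ^ q * (of_nat (q choose t) * [:1, -1:] ^ t * monom 2 1 ^ (q - t)) =
        smult (real (q choose t) * 2 ^ (q - t)) ([:1, -1:] ^ (q + t) * monom 1 (q - t))"
      unfolding mult.assoc c m
      by (simp only: mult_smult_left mult_smult_right smult_smult power_add) (simp only: mult_ac)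
  qed
qed

text \<open>With \<open>d\<close> neighbours and total leg length \<open>a\<close>, the term of
  index \<open>t\<close> is a multiple of \<open>(1 - y)^(q + d - 1 + t) y^(q - t + a)\<close>, to
  which \<open>content_eval_power\<close> applies. The \<open>-1\<close> in the exponent is the
  division by \<open>1 - y\<close>.\<close>

lemma content_eval_vertex:
  assumes N: "finite N" and A: "\<forall>k\<in>N. A k < S k" and pos: "2 * q + sum S N > 0" and K: "K \<ge> 1"
  shows "content_eval K (2 * q + sum S N)
      (([:1, 0, -1:] ^ q * (\<Prod>k\<in>N. [:1, -1:] * monom 1 (A k))) div [:1, -1:]) =
    (\<Sum>t\<le>q. real (q choose t) * 2 ^ (q - t) * fact (2 * q + sum S N) / fact (q - t + 1 + (\<Sum>k\<in>N. S k - 1)) *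
       fact (K + (\<Sum>k\<in>N. S k - A k - 1)) * recip_fact (int K - int (q - t + 1) - (\<Sum>k\<in>N. int (A k))))"
proof -
  let ?p = "2 * q + sum S N" and ?d = "card N" and ?a = "sum A N"
  have le: "?d \<le> sum S N"
  proof -
    have "(\<Sum>k\<in>N. 1) \<le> sum S N" by (rule sum_mono) (use A in force)
    then show ?thesis by simp
  qed
  have d1: "(\<Sum>k\<in>N. S k - 1) + ?d = sum S N"
  proof -
    have "(\<Sum>k\<in>N. S k - 1) + (\<Sum>k\<in>N. 1) = sum S N"
      unfolding sum.distrib[symmetric] by (rule sum.cong[OF refl]) (use A in force)
    then show ?thesis by simp
  qed
  have d2: "(\<Sum>k\<in>N. S k - A k - 1) + ?d + ?a = sum S N"
  proof -
    have "(\<Sum>k\<in>N. S k - A k - 1) + (\<Sum>k\<in>N. 1) + sum A N = sum S N"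
      unfolding sum.distrib[symmetric] by (rule sum.cong[OF refl]) (use A in force)
    then show ?thesis by simp
  qed
  \<comment> \<open>A block of positive size has an inner pair or a neighbour, so a factor
    \<open>1 - y\<close> is available for the division.\<close>
  have qd: "q + ?d > 0"
  proof (cases "q = 0")
    case True
    then have "N \<noteq> {}" using pos by auto
    then show ?thesis using N by (simp add: card_gt_0_iff)
  qed simp
  have prod: "(\<Prod>k\<in>N. [:1, -1:] * monom (1::real) (A k)) = [:1, -1:] ^ ?d * monom 1 ?a"
  proof -
    have "(\<Prod>k\<in>N. monom (1::real) (A k)) = monom 1 ?a"
      using N by (induction N rule: finite_induct) (simp_all add: mult_monom one_pCons monom_0)
    then show ?thesis unfolding prod.distrib prod_constant by (simp only:)
  qed
  have "[:1, 0, -1:] ^ q * ([:1, -1:] ^ ?d * monom (1::real) ?a) =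
      (\<Sum>t\<le>q. smult (real (q choose t) * 2 ^ (q - t)) ([:1, -1:] ^ (q + t) * monom 1 (q - t)) * ([:1, -1:] ^ ?d * monom 1 ?a))"
    unfolding one_minus_square_power sum_distrib_right ..
  also have "\<dots> = (\<Sum>t\<le>q. [:1, -1:] * smult (real (q choose t) * 2 ^ (q - t)) ([:1, -1:] ^ (q + ?d - 1 + t) * monom 1 (q - t + ?a)))"
  proof (rule sum.cong[OF refl])
    fix t
    have "[:1, -1:] ^ (q + t) * monom (1::real) (q - t) * ([:1, -1:] ^ ?d * monom 1 ?a) =
        [:1, -1:] ^ (q + t + ?d) * (monom 1 (q - t) * monom 1 ?a)"
      by (simp only: power_add mult_ac)
    also have "q + t + ?d = Suc (q + ?d - 1 + t)" using qd by simp
    also have "monom (1::real) (q - t) * monom 1 ?a = monom 1 (q - t + ?a)" by (simp add: mult_monom)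
    finally have e: "[:1, -1:] ^ (q + t) * monom (1::real) (q - t) * ([:1, -1:] ^ ?d * monom 1 ?a) =
        [:1, -1:] * ([:1, -1:] ^ (q + ?d - 1 + t) * monom 1 (q - t + ?a))"
      by (simp only: power_Suc mult.assoc)
    show "smult (real (q choose t) * 2 ^ (q - t)) ([:1, -1:] ^ (q + t) * monom 1 (q - t)) * ([:1, -1:] ^ ?d * monom 1 ?a) =
        [:1, -1:] * smult (real (q choose t) * 2 ^ (q - t)) ([:1, -1:] ^ (q + ?d - 1 + t) * monom 1 (q - t + ?a))"
      by (simp only: mult_smult_left mult_smult_right e)
  qed
  also have "\<dots> = [:1, -1:] * (\<Sum>t\<le>q. smult (real (q choose t) * 2 ^ (q - t)) ([:1, -1:] ^ (q + ?d - 1 + t) * monom 1 (q - t + ?a)))"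
    by (simp only: sum_distrib_left)
  finally have "([:1, 0, -1:] ^ q * (\<Prod>k\<in>N. [:1, -1:] * monom 1 (A k))) div [:1, -1:] =
      (\<Sum>t\<le>q. smult (real (q choose t) * 2 ^ (q - t)) ([:1, -1:] ^ (q + ?d - 1 + t) * monom 1 (q - t + ?a)))"
    unfolding prod by (simp only: nonzero_mult_div_cancel_left[OF one_minus_y_nonzero])
  then have "content_eval K ?p (([:1, 0, -1:] ^ q * (\<Prod>k\<in>N. [:1, -1:] * monom 1 (A k))) div [:1, -1:]) =
      (\<Sum>t\<le>q. real (q choose t) * 2 ^ (q - t) * content_eval K ?p ([:1, -1:] ^ (q + ?d - 1 + t) * monom 1 (q - t + ?a)))"
    by (simp only: content_eval_sum content_eval_smult)
  also have "\<dots> = (\<Sum>t\<le>q. real (q choose t) * 2 ^ (q - t) * fact ?p / fact (q - t + 1 + (\<Sum>k\<in>N. S k - 1)) *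
       fact (K + (\<Sum>k\<in>N. S k - A k - 1)) * recip_fact (int K - int (q - t + 1) - (\<Sum>k\<in>N. int (A k))))"
  proof (rule sum.cong[OF refl])
    fix t assume "t \<in> {..q}"
    then have t: "t \<le> q" by simp
    \<comment> \<open>The degree of the rising factorial that is left. With
      \<open>R = q - t + 1\<close> it is the argument of the last factorial in the denominator of
      the formula.\<close>
    define r where "r = q - t + 1 + (\<Sum>k\<in>N. S k - 1)"
    have m: "q + ?d - 1 + t \<le> ?p" using t le qd by linarith
    have pr: "?p - (q + ?d - 1 + t) = r" using d1 t qd le unfolding r_def by linarith
    have lt: "q - t + ?a < K + r" using d1 d2 K t unfolding r_def by linarith
    have top: "K + r - (q - t + ?a) - 1 = K + (\<Sum>k\<in>N. S k - A k - 1)"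
      using d1 d2 K t unfolding r_def by linarith
    have bot: "int K - int (q - t + ?a) - 1 = int K - int (q - t + 1) - (\<Sum>k\<in>N. int (A k))" by simp
    have "content_eval K ?p ([:1, -1:] ^ (q + ?d - 1 + t) * monom 1 (q - t + ?a)) =
        fact ?p / fact r * (fact (K + (\<Sum>k\<in>N. S k - A k - 1)) * recip_fact (int K - int (q - t + 1) - (\<Sum>k\<in>N. int (A k))))"
      unfolding content_eval_power[OF m] pr pochhammer_eq_recip_fact[OF lt] top bot ..
    then show "real (q choose t) * 2 ^ (q - t) * content_eval K ?p ([:1, -1:] ^ (q + ?d - 1 + t) * monom 1 (q - t + ?a)) =
        real (q choose t) * 2 ^ (q - t) * fact ?p / fact (q - t + 1 + (\<Sum>k\<in>N. S k - 1)) *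
       fact (K + (\<Sum>k\<in>N. S k - A k - 1)) * recip_fact (int K - int (q - t + 1) - (\<Sum>k\<in>N. int (A k)))"
      unfolding r_def[symmetric] by simp
  qed
  finally show ?thesis .
qed

section \<open>From colourings back to cycles; conjugation of all blocks\<close>

lemma ncol_eq_num_cycles:
  assumes S: "finite S" and \<pi>: "\<pi> permutes S"
  shows "ncol K S \<pi> = K ^ num_cycles S \<pi>"
proof -
  have pe: "permutation \<pi>" using \<pi> S by (auto intro: permutes_imp_permutation)
  let ?O = "orbit \<pi> ` S"
  let ?A = "{f \<in> S \<rightarrow>\<^sub>E {..<K}. \<forall>x\<in>S. f (\<pi> x) = f x}"
  let ?up = "\<lambda>g x. if x \<in> S then g (orbit \<pi> x) else undefined"
  let ?down = "\<lambda>f X. if X \<in> ?O then f (SOME x. x \<in> X) else undefined"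
  have const: "f y = f x" if f: "f \<in> ?A" and x: "x \<in> S" and y: "y \<in> orbit \<pi> x" for f x y
    using y
  proof induction
    case base
    then show ?case using f x by simp
  next
    case (step y)
    then show ?case using f permutes_orbit_subset[OF \<pi> x] by auto
  qed
  have some: "f (SOME y. y \<in> orbit \<pi> x) = f x" if "f \<in> ?A" "x \<in> S" for f x
  proof -
    have "(SOME y. y \<in> orbit \<pi> x) \<in> orbit \<pi> x" using orbit_nonempty[of \<pi> x] by (simp add: some_in_eq)
    then show ?thesis by (rule const[OF that])
  qed
  have "bij_betw ?up (?O \<rightarrow>\<^sub>E {..<K}) ?A"
  proof (rule bij_betw_byWitness[where f' = ?down])
    have up: "?up g \<in> ?A" if g: "g \<in> ?O \<rightarrow>\<^sub>E {..<K}" for g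
    proof -
      have "?up g x = g (orbit \<pi> x)" "g (orbit \<pi> x) < K" if "x \<in> S" for x
        using PiE_mem[OF g, of "orbit \<pi> x"] that by auto
      then have "?up g \<in> S \<rightarrow>\<^sub>E {..<K}" by (intro PiE_I) auto
      moreover have "?up g (\<pi> x) = ?up g x" if "x \<in> S" for x
        using that permutes_in_image[OF \<pi>] permutation_orbit_step[OF pe] by simp
      ultimately show ?thesis by blast
    qed
    then show "?up ` (?O \<rightarrow>\<^sub>E {..<K}) \<subseteq> ?A" by blast
    show "\<forall>g\<in>?O \<rightarrow>\<^sub>E {..<K}. ?down (?up g) = g"
    proof
      fix g assume g: "g \<in> ?O \<rightarrow>\<^sub>E {..<K}"
      show "?down (?up g) = g"
      proof
        fix X show "?down (?up g) X = g X"
        proof (cases "X \<in> ?O")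
          case True
          then obtain x where x: "x \<in> S" "X = orbit \<pi> x" by auto
          have "?down (?up g) X = ?up g (SOME y. y \<in> orbit \<pi> x)"
            unfolding x(2)[symmetric] using True by (simp only: if_True)
          also have "\<dots> = ?up g x" by (rule some[OF up[OF g] x(1)])
          also have "\<dots> = g X" using x by simp
          finally show ?thesis .
        next
          case False
          then show ?thesis using PiE_arb[OF g False] by simp
        qed
      qed
    qed
    show "\<forall>f\<in>?A. ?up (?down f) = f"
    proof
      fix f assume f: "f \<in> ?A"
      then have fE: "f \<in> S \<rightarrow>\<^sub>E {..<K}" by simp
      show "?up (?down f) = f"
      proof
        fix x show "?up (?down f) x = f x"
          using some[OF f, of x] PiE_arb[OF fE, of x] by simp
      qed
    qed
    show "?down ` ?A \<subseteq> ?O \<rightarrow>\<^sub>E {..<K}"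
    proof (rule image_subsetI, rule PiE_I)
      fix f X assume f: "f \<in> ?A" and "X \<in> ?O"
      then obtain x where x: "x \<in> S" "X = orbit \<pi> x" by auto
      have "f \<in> S \<rightarrow>\<^sub>E {..<K}" using f by simp
      then have "f x < K" using PiE_mem[of f S "\<lambda>_. {..<K}" x] x(1) by simp
      then show "?down f X \<in> {..<K}" using some[OF f x(1)] x by simp
    qed simp
  qed
  then have "card ?A = card (?O \<rightarrow>\<^sub>E {..<K})" by (rule bij_betw_same_card[symmetric])
  also have "\<dots> = K ^ num_cycles S \<pi>" using S by (simp add: card_funcsetE num_cycles_def)
  finally show ?thesis by (simp add: ncol0_def)
qed

context network
begin

text \<open>\<open>sum_cyclic_conj\<close> for one block after another: permutations of different
  blocks commute, so conjugation by a product acts on each block separately.\<close>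

lemma sum_blockperms_conj:
  fixes h :: "('a \<Rightarrow> 'a) \<Rightarrow> real"
  assumes "finite V" "g \<in> blockperms V" "\<And>i. i \<in> V \<Longrightarrow> cyclic_on g (pts {i})"
  shows "(\<Sum>t\<in>blockperms V. h (inv t \<circ> g \<circ> t)) = (\<Sum>\<beta>\<in>blockperms V. block_weight V \<beta> * h \<beta>)"
  using assms
proof (induction V arbitrary: g h rule: finite_induct)
  case empty
  then show ?case by (simp add: blockperms_empty block_weight_def)
next
  case (insert l V)
  have l: "l \<notin> V" by fact
  have g: "g permutes pts (insert l V)" "\<And>x. lab (g x) = lab x" using insert.prems(1) by (auto simp: blockperms_def)
  have mem: "g x \<in> pts W \<longleftrightarrow> x \<in> pts W" if "W \<subseteq> insert l V" for x W
    using permutes_in_image[OF g(1), of x] g(2)[of x] that by (auto simp: pts_def)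
  have im: "g ` pts W = pts W" if "W \<subseteq> insert l V" for W
    by (rule endo_inj_surj) (use mem[OF that] permutes_inj_on[OF g(1)] in auto)
  let ?gV = "perm_restrict g (pts V)" and ?gl = "perm_restrict g (pts {l})"
  have pr: "?gV permutes pts V" "?gl permutes pts {l}"
    using perm_restrict_permutes[OF permutes_inj_on[OF g(1)] im] by auto
  have gV: "?gV \<in> blockperms V" using pr(1) g(2) by (auto simp: blockperms_def perm_restrict_def)
  have ge: "?gV \<circ> ?gl = g"
    using perm_restrict_union[OF pr pts_disjoint[OF l]] g(1) by (simp add: pts_insert[of l V, symmetric])
  have cV: "cyclic_on ?gV (pts {i})" if "i \<in> V" for i
  proof -
    have "cyclic_on ?gV (pts {i}) = cyclic_on g (pts {i})"
      by (rule cyclic_cong) (use that in \<open>auto simp: perm_restrict_def pts_def\<close>)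
    then show ?thesis using insert.prems(2)[of i] that by simp
  qed
  have cl: "cyclic_on ?gl (pts {l})" using insert.prems(2)[of l] by (simp add: cyclic_on_perm_restrict)
  have ne: "pts {l} \<noteq> {}" using cl by (auto simp: cyclic_on_def)
  have comm: "\<beta> \<circ> \<gamma> = \<gamma> \<circ> \<beta>" if \<beta>: "\<beta> permutes pts V" and \<gamma>: "\<gamma> permutes pts {l}" for \<beta> \<gamma>
  proof
    fix x
    consider "x \<in> pts V" | "x \<in> pts {l}" | "x \<notin> pts V" "x \<notin> pts {l}" by blast
    then show "(\<beta> \<circ> \<gamma>) x = (\<gamma> \<circ> \<beta>) x"
    proof cases
      case 1
      then have "x \<notin> pts {l}" "\<beta> x \<notin> pts {l}" using permutes_in_image[OF \<beta>, of x] pts_disjoint[OF l] by auto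
      then show ?thesis using permutes_not_in[OF \<gamma>] by simp
    next
      case 2
      then have "x \<notin> pts V" "\<gamma> x \<notin> pts V" using permutes_in_image[OF \<gamma>, of x] pts_disjoint[OF l] by auto
      then show ?thesis using permutes_not_in[OF \<beta>] by simp
    next
      case 3
      then show ?thesis using permutes_not_in[OF \<gamma>] permutes_not_in[OF \<beta>] by simp
    qed
  qed
  have conj: "inv (t \<circ> u) \<circ> g \<circ> (t \<circ> u) = (inv t \<circ> ?gV \<circ> t) \<circ> (inv u \<circ> ?gl \<circ> u)"
    if t: "t permutes pts V" and u: "u permutes pts {l}" for t u
  proof -
    have 1: "inv (t \<circ> u) = inv u \<circ> inv t"
      using permutes_bij[OF t] permutes_bij[OF u] by (rule o_inv_distrib)
    have a: "inv u \<circ> inv t = inv t \<circ> inv u" by (rule comm[OF permutes_inv[OF t] permutes_inv[OF u], symmetric])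
    have b: "inv u \<circ> ?gV = ?gV \<circ> inv u" by (rule comm[OF pr(1) permutes_inv[OF u], symmetric])
    have c: "?gl \<circ> t = t \<circ> ?gl" by (rule comm[OF t pr(2), symmetric])
    have d: "inv u \<circ> t = t \<circ> inv u" by (rule comm[OF t permutes_inv[OF u], symmetric])
    have "inv (t \<circ> u) \<circ> g \<circ> (t \<circ> u) = inv t \<circ> (inv u \<circ> ?gV) \<circ> (?gl \<circ> t) \<circ> u"
      by (subst ge[symmetric]) (simp only: 1 a comp_assoc)
    also have "\<dots> = inv t \<circ> ?gV \<circ> (inv u \<circ> t) \<circ> ?gl \<circ> u"
      unfolding b c by (simp only: comp_assoc)
    also have "\<dots> = (inv t \<circ> ?gV \<circ> t) \<circ> (inv u \<circ> ?gl \<circ> u)"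
      unfolding d by (simp only: comp_assoc)
    finally show ?thesis .
  qed
  have "(\<Sum>t\<in>blockperms (insert l V). h (inv t \<circ> g \<circ> t)) =
      (\<Sum>t\<in>blockperms V. \<Sum>u | u permutes pts {l}. h ((inv t \<circ> ?gV \<circ> t) \<circ> (inv u \<circ> ?gl \<circ> u)))"
    unfolding sum_blockperms_insert[OF l]
    by (rule sum.cong[OF refl], rule sum.cong[OF refl]) (use conj in \<open>simp only: blockperms_def mem_Collect_eq\<close>)
  also have "\<dots> = (\<Sum>t\<in>blockperms V. \<Sum>\<gamma> | \<gamma> permutes pts {l}. poly (hookpoly (pts {l}) \<gamma>) 1 * h ((inv t \<circ> ?gV \<circ> t) \<circ> \<gamma>))"
    by (rule sum.cong[OF refl]) (rule sum_cyclic_conj[OF finite_pts ne pr(2) cl])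
  also have "\<dots> = (\<Sum>\<beta>\<in>blockperms V. block_weight V \<beta> * (\<Sum>\<gamma> | \<gamma> permutes pts {l}. poly (hookpoly (pts {l}) \<gamma>) 1 * h (\<beta> \<circ> \<gamma>)))"
    by (rule insert.IH[OF gV cV])
  also have "\<dots> = (\<Sum>\<beta>\<in>blockperms (insert l V). block_weight (insert l V) \<beta> * h \<beta>)"
    unfolding sum_blockperms_insert[OF l] sum_distrib_left
    by (rule sum.cong[OF refl], rule sum.cong[OF refl])
       (simp only: blockperms_def mem_Collect_eq block_weight_insert[OF l insert.hyps(1)] mult.assoc)
  finally show ?case .
qed

lemma card_blockperms:
  assumes "finite V"
  shows "real (card (blockperms V)) = (\<Prod>i\<in>V. fact (card (pts {i})))"
  using assms
proof (induction V rule: finite_induct)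
  case (insert l V)
  have "real (card (blockperms (insert l V))) = (\<Sum>\<beta>\<in>blockperms (insert l V). 1)" by simp
  also have "\<dots> = (\<Sum>\<beta>\<in>blockperms V. real (fact (card (pts {l}))))"
    unfolding sum_blockperms_insert[OF insert.hyps(2)] by (simp add: card_permutations)
  also have "\<dots> = fact (card (pts {l})) * real (card (blockperms V))" by simp
  finally show ?case using insert by simp
qed (simp add: blockperms_empty)

end


subsection \<open>The genus series\<close>

lemma pairing_partner:
  assumes P: "P \<in> pairings S" and a: "a \<in> S"
  obtains b where "b \<in> S" "b \<noteq> a" "{a, b} \<in> P" "pairing_involution P a = b" "pairing_involution P b = a"
proof -
  have U: "\<Union>P = S" and dj: "disjoint P" and c2: "\<And>B. B \<in> P \<Longrightarrow> card B = 2"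
    using P by (auto simp: pairings_def partition_on_def)
  obtain B where B: "B \<in> P" "a \<in> B" using U a by blast
  obtain x y where xy: "B = {x, y}" "x \<noteq> y" using c2[OF B(1)] by (auto simp: card_2_iff)
  define b where "b = (if a = x then y else x)"
  have b: "B = {a, b}" "b \<noteq> a" using xy B(2) by (auto simp: b_def)
  have bS: "b \<in> S" using U B(1) b(1) by blast
  have uniq: "{u, v} = B" if "{u, v} \<in> P" "u \<in> B" for u v
    using pairwiseD[OF dj that(1) B(1)] that(2) by (auto simp: disjnt_def)
  have inv: "pairing_involution P u = v" if uv: "B = {u, v}" "v \<noteq> u" for u v
  proof -
    have "u \<in> \<Union>P" using uv B(1) by auto
    moreover have "(THE w. w \<noteq> u \<and> {u, w} \<in> P) = v"
    proof (rule the_equality)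
      show "v \<noteq> u \<and> {u, v} \<in> P" using uv B(1) by simp
      fix w assume w: "w \<noteq> u \<and> {u, w} \<in> P"
      then have "{u, w} = {u, v}" using uniq[of u w] uv by simp
      then show "w = v" using w by (auto simp: doubleton_eq_iff)
    qed
    ultimately show ?thesis by (simp add: pairing_involution_def)
  qed
  show thesis
  proof (rule that[OF bS b(2)])
    show "{a, b} \<in> P" using B(1) b(1) by simp
    show "pairing_involution P a = b" by (rule inv[OF b])
    show "pairing_involution P b = a" by (rule inv) (use b in auto)
  qed
qed

lemma pairing_involution_outside:
  "P \<in> pairings S \<Longrightarrow> a \<notin> S \<Longrightarrow> pairing_involution P a = a"
  by (auto simp: pairing_involution_def pairings_def partition_on_def)

lemma pairing_involution_involutive:
  assumes "P \<in> pairings S"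
  shows "pairing_involution P (pairing_involution P a) = a"
proof (cases "a \<in> S")
  case True
  then show ?thesis by (rule pairing_partner[OF assms]) simp
next
  case False
  then show ?thesis by (simp add: pairing_involution_outside[OF assms])
qed

lemma pairing_involution_permutes:
  assumes "P \<in> pairings S"
  shows "pairing_involution P permutes S"
proof (rule bij_imp_permutes)
  have im: "pairing_involution P a \<in> S" if "a \<in> S" for a
    using that by (rule pairing_partner[OF assms]) simp
  show "bij_betw (pairing_involution P) S S"
    by (rule bij_betw_byWitness[where f' = "pairing_involution P"])
       (use im pairing_involution_involutive[OF assms] in auto)
qed (rule pairing_involution_outside[OF assms])

lemma pairing_block:
  assumes P: "P \<in> pairings S" and B: "B \<in> P"
  obtains a b where "a \<in> S" "b \<in> S" "a \<noteq> b" "B = {a, b}" "pairing_involution P a = b" "pairing_involution P b = a"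
proof -
  have "card B = 2" "B \<subseteq> S" using P B by (auto simp: pairings_def partition_on_def)
  then obtain a c where ac: "a \<in> S" "B = {a, c}" "a \<noteq> c" by (auto simp: card_2_iff)
  obtain b where b: "b \<in> S" "b \<noteq> a" "{a, b} \<in> P" "pairing_involution P a = b" "pairing_involution P b = a"
    by (rule pairing_partner[OF P ac(1)])
  have "disjoint P" using P by (auto simp: pairings_def partition_on_def)
  then have "B = {a, b}" using pairwiseD[of disjnt P B "{a, b}"] B b(3) ac(2) by (auto simp: disjnt_def)
  then show thesis using that[of a b] ac b by simp
qed

lemma image_pairing:
  assumes P: "P \<in> pairings S" and t: "t permutes S"
  shows "(`) t ` P \<in> pairings S"
    and "pairing_involution ((`) t ` P) = t \<circ> pairing_involution P \<circ> inv t"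
proof -
  have inj: "inj t" by (rule permutes_inj[OF t])
  have U: "\<Union>P = S" and dj: "disjoint P" and ne: "{} \<notin> P" and c2: "\<forall>B\<in>P. card B = 2"
    using P by (auto simp: pairings_def partition_on_def)
  have "\<Union>((`) t ` P) = S" using U permutes_image[OF t] by (metis image_Union)
  moreover have "disjoint ((`) t ` P)"
  proof (rule pairwiseI)
    fix A B assume A: "A \<in> (`) t ` P" and B: "B \<in> (`) t ` P" and ne: "A \<noteq> B"
    obtain C where C: "C \<in> P" "A = t ` C" using A by auto
    obtain D where D: "D \<in> P" "B = t ` D" using B by auto
    have "C \<noteq> D" using ne C(2) D(2) by auto
    then have "C \<inter> D = {}" using pairwiseD[OF dj C(1) D(1)] by (simp add: disjnt_def)
    then show "disjnt A B" unfolding disjnt_def C(2) D(2) image_Int[OF inj, symmetric] by simp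
  qed
  moreover have "\<forall>B\<in>(`) t ` P. card B = 2"
    using c2 card_image[OF inj_on_subset[OF inj subset_UNIV]] by auto
  ultimately show tP: "(`) t ` P \<in> pairings S"
    using ne by (auto simp: pairings_def partition_on_def)
  show "pairing_involution ((`) t ` P) = t \<circ> pairing_involution P \<circ> inv t"
  proof
    fix x
    show "pairing_involution ((`) t ` P) x = (t \<circ> pairing_involution P \<circ> inv t) x"
    proof (cases "x \<in> S")
      case True
      then have "inv t x \<in> S" using permutes_in_image[OF permutes_inv[OF t]] by simp
      then obtain b where b: "b \<in> S" "b \<noteq> inv t x" "{inv t x, b} \<in> P" "pairing_involution P (inv t x) = b"
        by (rule pairing_partner[OF P])
      have "t ` {inv t x, b} \<in> (`) t ` P" using b(3) by (rule imageI)
      then have xb: "{x, t b} \<in> (`) t ` P" by (simp add: permutes_inverses[OF t])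
      have "x \<noteq> t b" using b(2) by (metis permutes_inverses(2)[OF t])
      obtain u v where uv: "u \<noteq> v" "{x, t b} = {u, v}" "pairing_involution ((`) t ` P) u = v" "pairing_involution ((`) t ` P) v = u"
        by (rule pairing_block[OF tP xb])
      then have "pairing_involution ((`) t ` P) x = t b" by (auto simp: doubleton_eq_iff)
      then show ?thesis using b(4) by simp
    next
      case False
      then have "inv t x \<notin> S" using permutes_in_image[OF permutes_inv[OF t]] by simp
      then show ?thesis
        using pairing_involution_outside[OF P] pairing_involution_outside[OF tP False]
        by (simp add: permutes_inverses[OF t])
    qed
  qed
qed

text \<open>\<open>q\<close> and \<open>s\<close> as one multiplicity function. The value 0 outside
  the type set is required because \<open>typed_pairings\<close> constrains every type.\<close>

definition surface_type :: "nat \<Rightarrow> (nat \<Rightarrow> nat) \<Rightarrow> (nat \<times> nat \<Rightarrow> nat) \<Rightarrow> nat \<times> nat \<Rightarrow> nat" where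
  "surface_type n q s e = (if e \<in> type_set {1..n} then if fst e = snd e then q (fst e) else s e else 0)"

lemma surface_type_pair:
  assumes "i \<in> {1..n}" "k \<in> {1..n}"
  shows "surface_type n q s (pair_type i k) = (if i = k then q i else sym_entry s i k)"
  using assms by (auto simp: surface_type_def type_set_def pair_type_def sym_entry_def min_def max_def)

lemma block_type_iff:
  assumes P: "P \<in> pairings S" and B: "B \<in> P"
  shows "(\<exists>x y. B = {(i, x), (k, y)}) \<longleftrightarrow> block_type B = pair_type i k"
proof
  assume "\<exists>x y. B = {(i, x), (k, y)}"
  then show "block_type B = pair_type i k" by (auto simp: block_type_pair)
next
  assume e: "block_type B = pair_type i k"
  obtain a b where "B = {a, b}" by (rule pairing_block[OF P B])
  moreover from this have "(fst a = i \<and> fst b = k) \<or> (fst a = k \<and> fst b = i)"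
    using e by (auto simp: block_type_pair pair_type_eq)
  ultimately show "\<exists>x y. B = {(i, x), (k, y)}"
    by (cases a; cases b) (auto simp: insert_commute)
qed

lemma paired_surfaces_eq:
  "paired_surfaces n q s = typed_pairings (labelled_set n (block_size n q s)) (surface_type n q s)"
proof -
  let ?S = "labelled_set n (block_size n q s)"
  let ?m = "surface_type n q s"
  have "((\<forall>i\<in>{1..n}. card {B \<in> P. \<exists>x y. B = {(i, x), (i, y)}} = q i) \<and>
     (\<forall>i\<in>{1..n}. \<forall>k\<in>{1..n}. i \<noteq> k \<longrightarrow> card {B \<in> P. \<exists>x y. B = {(i, x), (k, y)}} = sym_entry s i k)) \<longleftrightarrow>
     (\<forall>e. card {B \<in> P. block_type B = e} = ?m e)" (is "?L \<longleftrightarrow> ?R") if P: "P \<in> pairings ?S" for P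
  proof -
    have e: "{B \<in> P. \<exists>x y. B = {(i, x), (k, y)}} = {B \<in> P. block_type B = pair_type i k}" for i k
      using block_type_iff[OF P] by blast
    have out: "{B \<in> P. block_type B = e} = {}" if "e \<notin> type_set {1..n}" for e
    proof (rule equals0I)
      fix B assume B: "B \<in> {B \<in> P. block_type B = e}"
      obtain a b where ab: "a \<in> ?S" "b \<in> ?S" "B = {a, b}"
        by (rule pairing_block[OF P, of B]) (use B in auto)
      then have "fst a \<in> {1..n}" "fst b \<in> {1..n}" by (auto simp: labelled_set_def)
      then have "block_type B \<in> type_set {1..n}"
        unfolding ab(3) block_type_pair by (auto simp: pair_type_def type_set_def min_def max_def)
      then show False using B that by simp
    qed
    show ?thesis
      unfolding e
    proof
      assume L: "(\<forall>i\<in>{1..n}. card {B \<in> P. block_type B = pair_type i i} = q i) \<and>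
         (\<forall>i\<in>{1..n}. \<forall>k\<in>{1..n}. i \<noteq> k \<longrightarrow> card {B \<in> P. block_type B = pair_type i k} = sym_entry s i k)"
      show ?R
      proof
        fix e
        show "card {B \<in> P. block_type B = e} = ?m e"
        proof (cases "e \<in> type_set {1..n}")
          case True
          then obtain i k where ik': "e = (i, k)" "i \<in> {1..n}" "k \<in> {1..n}" "i \<le> k"
            by (auto simp: type_set_def)
          then have ik: "e = pair_type i k" "i \<in> {1..n}" "k \<in> {1..n}" by (simp_all add: pair_type_def)
          then show ?thesis using L surface_type_pair[OF ik(2,3), of q s] by (cases "i = k") auto
        next
          case False
          then show ?thesis using out[OF False] by (simp only: surface_type_def if_False card.empty)
        qed
      qed
    next
      assume R: ?R
      then have R': "card {B \<in> P. block_type B = pair_type i k} = (if i = k then q i else sym_entry s i k)"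
        if "i \<in> {1..n}" "k \<in> {1..n}" for i k
        using surface_type_pair[OF that, of q s] by (simp only:)
      show "(\<forall>i\<in>{1..n}. card {B \<in> P. block_type B = pair_type i i} = q i) \<and>
         (\<forall>i\<in>{1..n}. \<forall>k\<in>{1..n}. i \<noteq> k \<longrightarrow> card {B \<in> P. block_type B = pair_type i k} = sym_entry s i k)"
        using R' by auto
    qed
  qed
  then show ?thesis unfolding paired_surfaces_def typed_pairings_def by blast
qed

lemma finite_typed_pairings: "finite S \<Longrightarrow> finite (typed_pairings S m)"
  using finite_pairings[of S] by (rule rev_finite_subset) (auto simp: typed_pairings_def)

lemma image_typed_pairing:
  assumes P: "P \<in> typed_pairings S m" and t: "t permutes S" and lab: "\<And>x. fst (t x) = fst x"
  shows "(`) t ` P \<in> typed_pairings S m"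
proof -
  have P': "P \<in> pairings S" and cnt: "\<And>e. card {B \<in> P. block_type B = e} = m e"
    using P unfolding typed_pairings_def by blast+
  have bt: "block_type (t ` B) = block_type B" for B by (simp add: block_type_def image_image lab)
  have inj: "inj ((`) t)" using permutes_inj[OF t] by (auto intro!: injI simp: inj_image_eq_iff)
  have "card {B \<in> (`) t ` P. block_type B = e} = m e" for e
  proof -
    have "{B \<in> (`) t ` P. block_type B = e} = (`) t ` {B \<in> P. block_type B = e}"
      using bt by auto
    then show ?thesis using cnt[of e] card_image[OF inj_on_subset[OF inj subset_UNIV]] by simp
  qed
  then show ?thesis using image_pairing(1)[OF P' t] unfolding typed_pairings_def by blast
qed

text \<open>Relabelling inside the blocks permutes the pairings of a given type. This allows a
  conjugation to be moved from the canonical permutation to the pairing.\<close>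

lemma sum_image_typed_pairing:
  fixes h :: "(nat \<times> nat) set set \<Rightarrow> real"
  assumes t: "t permutes S" and lab: "\<And>x. fst (t x) = fst x"
  shows "(\<Sum>P\<in>typed_pairings S m. h ((`) t ` P)) = (\<Sum>P\<in>typed_pairings S m. h P)"
proof (rule sum.reindex_bij_witness[where i = "\<lambda>P. (`) (inv t) ` P" and j = "\<lambda>P. (`) t ` P"])
  fix P assume P: "P \<in> typed_pairings S m"
  have lab': "fst (inv t x) = fst x" for x using lab[of "inv t x"] by (simp add: permutes_inverses[OF t])
  show "(`) (inv t) ` (`) t ` P = P" "(`) t ` (`) (inv t) ` P = P"
    by (simp_all add: image_image permutes_inverses[OF t])
  show "(`) t ` P \<in> typed_pairings S m" by (rule image_typed_pairing[OF P t lab])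
  show "(`) (inv t) ` P \<in> typed_pairings S m" by (rule image_typed_pairing[OF P permutes_inv[OF t] lab'])
qed simp

lemma canonical_perm_cycles:
  defines "c \<equiv> \<lambda>k. cycle_of_list [1..<Suc k]"
  shows "canonical_perm n p permutes labelled_set n p"
    and "fst (canonical_perm n p x) = fst x"
    and "i \<in> {1..n} \<Longrightarrow> p i > 0 \<Longrightarrow> cyclic_on (canonical_perm n p) (Pair i ` {1..p i})"
proof -
  have set: "set [1..<Suc k] = {1..k}" for k by auto
  have cp: "c k permutes {1..k}" for k unfolding c_def using cycle_permutes[of "[1..<Suc k]"] by (simp only: set)
  have g: "canonical_perm n p (i, x) = (if i \<in> {1..n} then (i, c (p i) x) else (i, x))" for i x
    by (simp add: canonical_perm_def c_def)
  show "fst (canonical_perm n p x) = fst x" for x by (cases x) (simp add: g)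
  show "canonical_perm n p permutes labelled_set n p"
  proof (rule inj_imp_permutes)
    show "inj_on (canonical_perm n p) (labelled_set n p)"
    proof (rule inj_onI)
      fix x y assume "x \<in> labelled_set n p" "y \<in> labelled_set n p" and e: "canonical_perm n p x = canonical_perm n p y"
      then obtain i u j v where xy: "x = (i, u)" "y = (j, v)" "i \<in> {1..n}" "j \<in> {1..n}" by (auto simp: labelled_set_def)
      then have ij: "i = j" using e by (simp add: g)
      then have "c (p i) u = c (p i) v" using e xy by (simp add: g)
      then show "x = y" using permutes_inj[OF cp[of "p i"]] xy ij by (auto dest: injD)
    qed
    show "finite (labelled_set n p)" by (rule finite_labelled_set)
    show "canonical_perm n p x \<in> labelled_set n p" if "x \<in> labelled_set n p" for x
      using that permutes_in_image[OF cp] by (cases x) (simp add: g labelled_set_def)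
    show "canonical_perm n p x = x" if "x \<notin> labelled_set n p" for x
      using that permutes_not_in[OF cp] by (cases x) (simp add: g labelled_set_def)
  qed
  show "cyclic_on (canonical_perm n p) (Pair i ` {1..p i})" if i: "i \<in> {1..n}" "p i > 0"
  proof (rule cyclic_on_image)
    show "cyclic_on (c (p i)) {1..p i}"
      unfolding c_def set[symmetric] by (rule cyclic_cycle_of_list) (use i in auto)
    show "canonical_perm n p (i, x) = (i, c (p i) x)" for x using i by (simp add: g)
  qed
qed

lemma cyclic_on_inv: "permutation f \<Longrightarrow> cyclic_on f A \<Longrightarrow> cyclic_on (inv f) A"
  by (simp add: cyclic_on_def orbit_inv_eq)

text \<open>The pairings are grouped by their number of cycles. This number is positive because the
  set of points is nonempty, in accordance with a series that starts at
  \<open>L = 1\<close>.\<close>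

lemma poly_genus_series:
  assumes S: "labelled_set n (block_size n q s) \<noteq> {}"
  shows "poly (genus_series n q s) (real K) = (\<Sum>P\<in>paired_surfaces n q s.
     real (ncol K (labelled_set n (block_size n q s)) (pairing_involution P \<circ> inv (canonical_perm n (block_size n q s)))))"
proof -
  let ?S = "labelled_set n (block_size n q s)" and ?\<gamma> = "canonical_perm n (block_size n q s)"
  let ?N = "\<lambda>P. num_cycles ?S (pairing_involution P \<circ> inv ?\<gamma>)"
  have fS: "finite ?S" by (rule finite_labelled_set)
  have fP: "finite (paired_surfaces n q s)" unfolding paired_surfaces_eq by (rule finite_typed_pairings[OF fS])
  have N: "?N P \<in> {1..card ?S}" for P
    using card_image_le[OF fS, of "orbit (pairing_involution P \<circ> inv ?\<gamma>)"] fS S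
    by (simp add: num_cycles_def Suc_le_eq card_gt_0_iff)
  have "poly (genus_series n q s) (real K) = (\<Sum>L = 1..card ?S. real (card {P \<in> paired_surfaces n q s. ?N P = L}) * real K ^ L)"
    by (simp add: genus_series_def poly_sum poly_monom cycle_count_def)
  also have "\<dots> = (\<Sum>P\<in>paired_surfaces n q s. real K ^ ?N P)"
    by (rule sum_fun_comp[OF fP, symmetric]) (use N in auto)
  also have "\<dots> = (\<Sum>P\<in>paired_surfaces n q s. real (ncol K ?S (pairing_involution P \<circ> inv ?\<gamma>)))"
  proof (rule sum.cong[OF refl])
    fix P assume "P \<in> paired_surfaces n q s"
    then have "P \<in> pairings ?S" unfolding paired_surfaces_def by blast
    then have "pairing_involution P \<circ> inv ?\<gamma> permutes ?S"
      by (intro permutes_compose permutes_inv canonical_perm_cycles(1) pairing_involution_permutes)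
    then show "real K ^ ?N P = real (ncol K ?S (pairing_involution P \<circ> inv ?\<gamma>))"
      by (simp only: ncol_eq_num_cycles[OF fS] of_nat_power)
  qed
  finally show ?thesis .
qed


section \<open>Assembling the explicit formula\<close>

lemma prod_type_set:
  fixes g :: "nat \<times> nat \<Rightarrow> 'b::comm_monoid_mult"
  assumes V: "finite V"
  shows "(\<Prod>e\<in>type_set V. g e) = (\<Prod>i\<in>V. g (i, i)) * (\<Prod>e\<in>{(i, k). i \<in> V \<and> k \<in> V \<and> i < k}. g e)"
proof -
  have "type_set V = (\<lambda>i. (i, i)) ` V \<union> {(i, k). i \<in> V \<and> k \<in> V \<and> i < k}" by (auto simp: type_set_def)
  moreover have "finite {(i, k). i \<in> V \<and> k \<in> V \<and> i < k}"
    by (rule finite_subset[of _ "V \<times> V"]) (use V in auto)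
  moreover have "(\<lambda>i. (i, i)) ` V \<inter> {(i, k). i \<in> V \<and> k \<in> V \<and> i < k} = {}" by auto
  moreover have "(\<Prod>e\<in>(\<lambda>i. (i, i)) ` V. g e) = (\<Prod>i\<in>V. g (i, i))"
    by (rule prod.reindex_cong[where l = "\<lambda>i. (i, i)"]) (auto simp: inj_on_def)
  ultimately show ?thesis using V by (simp add: prod.union_disjoint)
qed

lemma type_denom_surface_type:
  "type_denom {1..n} (surface_type n q s) =
    (\<Prod>i = 1..n. 2 ^ q i * fact (q i)) * (\<Prod>e\<in>support_edges n s. fact (s e))"
proof -
  let ?V = "{1..n}"
  let ?O = "{(i, k). i \<in> ?V \<and> k \<in> ?V \<and> i < k}"
  have fO: "finite ?O" by (rule finite_subset[of _ "?V \<times> ?V"]) auto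
  have "(\<Prod>e\<in>?O. real (type_mult e) ^ surface_type n q s e * fact (surface_type n q s e)) = (\<Prod>e\<in>?O. fact (s e))"
    by (rule prod.cong) (auto simp: type_mult_def surface_type_def type_set_def)
  \<comment> \<open>Two blocks without an edge have \<open>s e = 0\<close> and contribute
    \<open>0! = 1\<close>.\<close>
  also have "\<dots> = (\<Prod>e\<in>support_edges n s. fact (s e))"
    by (rule prod.mono_neutral_right[OF fO]) (auto simp: support_edges_def support_adj_def sym_entry_def intro!: gr0I)
  finally have "(\<Prod>e\<in>?O. real (type_mult e) ^ surface_type n q s e * fact (surface_type n q s e)) =
    (\<Prod>e\<in>support_edges n s. fact (s e))" .
  moreover have "(\<Prod>i\<in>?V. real (type_mult (i, i)) ^ surface_type n q s (i, i) * fact (surface_type n q s (i, i))) =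
      (\<Prod>i\<in>?V. 2 ^ q i * fact (q i))"
    by (rule prod.cong) (auto simp: type_mult_def surface_type_def type_set_def)
  ultimately show ?thesis by (simp only: type_denom_def prod_type_set[OF finite_atLeastAtMost])
qed

lemma row_sum_neighbours:
  assumes "i \<in> {1..n}"
  shows "row_sum n s i = (\<Sum>k\<in>neighbours n s i. sym_entry s i k)"
  unfolding row_sum_def
  by (rule sum.mono_neutral_right) (use assms in \<open>auto simp: neighbours_def support_adj_def\<close>)

lemma finite_neighbours: "finite (neighbours n s i)"
  by (rule finite_subset[of _ "{1..n}"]) (auto simp: neighbours_def support_adj_def)

definition vertex_value :: "nat \<Rightarrow> nat \<Rightarrow> (nat \<times> nat \<Rightarrow> nat) \<Rightarrow> (nat \<times> nat \<Rightarrow> nat) \<Rightarrow> nat \<Rightarrow> nat \<Rightarrow> real" where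
  "vertex_value n K s A i R =
     fact (K + (\<Sum>k\<in>neighbours n s i. sym_entry s i k - sym_entry A i k - 1)) *
     fact (R - 1 + (\<Sum>k\<in>neighbours n s i. sym_entry s i k)) / fact (R - 1) *
     recip_fact (int K - int R - (\<Sum>k\<in>neighbours n s i. int (sym_entry A i k))) /
     fact (R + (\<Sum>k\<in>neighbours n s i. sym_entry s i k - 1))"

text \<open>The coefficient \<open>(q choose t) * 2 ^ (q - t)\<close> equals
  \<open>2^q q! / (2^t t! (q-t)!)\<close>. Its numerator is pulled out for the count of pairings,
  and \<open>(q-t)!\<close> is the \<open>(R-1)!\<close> of the formula. The factorial of
  \<open>s + q - t\<close> cancels between the denominator of the coefficient and the numerator of
  \<open>vertex_value\<close>.\<close>

lemma content_eval_vertex_value: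
  assumes i: "i \<in> {1..n}" and A: "A \<in> PiE (support_edges n s) (\<lambda>e. {0..<min (s e) K})"
    and pos: "block_size n q s i > 0" and K: "K \<ge> 1"
  shows "content_eval K (block_size n q s i)
      (([:1, 0, -1:] ^ q i * (\<Prod>k\<in>neighbours n s i. [:1, -1:] * monom 1 (sym_entry A i k))) div [:1, -1:]) =
    2 ^ q i * fact (q i) * (\<Sum>t\<in>{0..q i}. fact (2 * q i + row_sum n s i) /
       (2 ^ t * fact t * fact (row_sum n s i + q i - t)) * vertex_value n K s A i (q i - t + 1))"
proof -
  let ?N = "neighbours n s i" and ?q = "q i" and ?r = "row_sum n s i"
  have bs: "block_size n q s i = 2 * ?q + sum (sym_entry s i) ?N"
    by (simp add: block_size_def row_sum_neighbours[OF i])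
  have lt: "sym_entry A i k < sym_entry s i k" if k: "k \<in> ?N" for k
  proof -
    have adj: "support_adj n s i k" "support_adj n s k i" "i \<noteq> k"
      using k support_adj_sym[of n s i k] by (auto simp: neighbours_def support_adj_def)
    then have "(min i k, max i k) \<in> support_edges n s" by (auto simp: support_edges_def min_def max_def)
    from PiE_mem[OF A this] show ?thesis using adj(3) by (auto simp: sym_entry_def min_def max_def split: if_splits)
  qed
  have pos': "2 * ?q + sum (sym_entry s i) ?N > 0" using pos bs by simp
  have "\<forall>k\<in>?N. sym_entry A i k < sym_entry s i k" using lt by blast
  note v = content_eval_vertex[OF finite_neighbours this pos' K]
  show ?thesis
    unfolding bs sum_distrib_left v atMost_atLeast0
  proof (rule sum.cong[OF refl])
    fix t assume "t \<in> {0..?q}"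
    then have t: "t \<le> ?q" by simp
    have c: "real (?q choose t) = fact ?q / (fact t * fact (?q - t))" by (rule binomial_fact[OF t])
    have p2: "(2::real) ^ ?q = 2 ^ t * 2 ^ (?q - t)" using t by (simp add: power_add[symmetric])
    have r: "?q - t + sum (sym_entry s i) ?N = ?r + ?q - t" using t row_sum_neighbours[OF i, of s] by simp
    have r2: "2 * ?q + ?r = 2 * ?q + sum (sym_entry s i) ?N" using row_sum_neighbours[OF i, of s] by simp
    have alg: "x / (a * b) * P2 * p / f * k * rc = T * P2 * x * (p / (T * a * F) * (k * F / b * rc / f))"
      if "F > 0" "T > 0" for x a b P2 p f k rc T F :: real
      using that by (simp add: mult_ac)
    show "real (?q choose t) * 2 ^ (?q - t) * fact (2 * ?q + sum (sym_entry s i) ?N) / fact (?q - t + 1 + (\<Sum>k\<in>?N. sym_entry s i k - 1)) *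
       fact (K + (\<Sum>k\<in>?N. sym_entry s i k - sym_entry A i k - 1)) * recip_fact (int K - int (?q - t + 1) - (\<Sum>k\<in>?N. int (sym_entry A i k))) =
       2 ^ ?q * fact ?q * (fact (2 * ?q + ?r) / (2 ^ t * fact t * fact (?r + ?q - t)) * vertex_value n K s A i (?q - t + 1))"
      unfolding c p2 vertex_value_def add_diff_cancel_right' r r2
      by (rule alg) simp_all
  qed
qed

lemma hook_content_eq:
  assumes "A < K"
  shows "1 / hook_content K p A = fact (K - A - 1) / fact (K + p - A - 1)"
proof -
  have "hook_content K p A = fact (K + p - A - 1) * recip_fact (int K - int A - 1)"
    unfolding hook_content_def by (rule pochhammer_eq_recip_fact) (use assms in simp)
  also have "int K - int A - 1 = int (K - A - 1)" using assms by simp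
  finally show ?thesis by (simp add: recip_fact_def)
qed

text \<open>The product over the blocks of sums over single numbers \<open>t\<close> expands into a
  sum over vectors. The factors \<open>s_e!\<close> and \<open>2^q_i q_i!\<close>, which depend on
  neither \<open>A\<close> nor \<open>t\<close>, combine to \<open>type_denom\<close>.\<close>

lemma genus_formula_network:
  assumes pos: "\<And>i. i \<in> {1..n} \<Longrightarrow> block_size n q s i > 0" and K: "K \<ge> 1"
  shows "(\<Sum>A\<in>PiE (support_edges n s) (\<lambda>e. {..<min (s e) K}).
     (\<Prod>e\<in>support_edges n s. fact (s e) / hook_content K (s e) (A e)) *
     (\<Prod>i\<in>{1..n}. content_eval K (block_size n q s i)
        (([:1, 0, -1:] ^ q i * (\<Prod>k\<in>neighbours n s i. [:1, -1:] * monom 1 (sym_entry A i k))) div [:1, -1:]))) =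
   type_denom {1..n} (surface_type n q s) * genus_formula n q s K"
proof -
  let ?E = "support_edges n s" and ?V = "{1..n}"
  let ?P = "PiE ?E (\<lambda>e. {0..<min (s e) K})" and ?T = "PiE ?V (\<lambda>i. {0..q i})"
  let ?c = "\<lambda>i t. fact (2 * q i + row_sum n s i) / (2 ^ t * fact t * fact (row_sum n s i + q i - t)) :: real"
  let ?e = "\<lambda>A. \<Prod>e\<in>?E. fact (K - A e - 1) / fact (K + s e - A e - 1) :: real"
  have "(\<Prod>e\<in>?E. fact (s e) / hook_content K (s e) (A e)) *
     (\<Prod>i\<in>?V. content_eval K (block_size n q s i)
        (([:1, 0, -1:] ^ q i * (\<Prod>k\<in>neighbours n s i. [:1, -1:] * monom 1 (sym_entry A i k))) div [:1, -1:])) =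
     type_denom ?V (surface_type n q s) *
       (\<Sum>t\<in>?T. (\<Prod>i\<in>?V. ?c i (t i)) * (?e A * (\<Prod>i\<in>?V. vertex_value n K s A i (q i - t i + 1))))"
    if A: "A \<in> ?P" for A
  proof -
    have "fact (s e) / hook_content K (s e) (A e) = fact (s e) * (fact (K - A e - 1) / fact (K + s e - A e - 1))" if "e \<in> ?E" for e
    proof -
      have "A e < K" using PiE_mem[OF A that] by simp
      from hook_content_eq[OF this, of "s e"] show ?thesis by (simp add: divide_inverse)
    qed
    then have "(\<Prod>e\<in>?E. fact (s e) / hook_content K (s e) (A e)) =
        (\<Prod>e\<in>?E. fact (s e) * (fact (K - A e - 1) / fact (K + s e - A e - 1)))"
      by (rule prod.cong[OF refl])
    then have 1: "(\<Prod>e\<in>?E. fact (s e) / hook_content K (s e) (A e)) = (\<Prod>e\<in>?E. fact (s e)) * ?e A"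
      by (simp only: prod.distrib)
    have "(\<Prod>i\<in>?V. content_eval K (block_size n q s i)
        (([:1, 0, -1:] ^ q i * (\<Prod>k\<in>neighbours n s i. [:1, -1:] * monom 1 (sym_entry A i k))) div [:1, -1:])) =
       (\<Prod>i\<in>?V. 2 ^ q i * fact (q i) * (\<Sum>t\<in>{0..q i}. ?c i t * vertex_value n K s A i (q i - t + 1)))"
      by (rule prod.cong[OF refl]) (rule content_eval_vertex_value[OF _ A pos K])
    also have "\<dots> = (\<Prod>i\<in>?V. 2 ^ q i * fact (q i)) *
        (\<Sum>t\<in>?T. (\<Prod>i\<in>?V. ?c i (t i)) * (\<Prod>i\<in>?V. vertex_value n K s A i (q i - t i + 1)))"
    proof -
      have "(\<Prod>i\<in>?V. \<Sum>t\<in>{0..q i}. ?c i t * vertex_value n K s A i (q i - t + 1)) =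
          (\<Sum>t\<in>?T. \<Prod>i\<in>?V. ?c i (t i) * vertex_value n K s A i (q i - t i + 1))"
        by (rule prod_sum_PiE) auto
      then show ?thesis by (simp only: prod.distrib)
    qed
    finally have 2: "(\<Prod>i\<in>?V. content_eval K (block_size n q s i)
        (([:1, 0, -1:] ^ q i * (\<Prod>k\<in>neighbours n s i. [:1, -1:] * monom 1 (sym_entry A i k))) div [:1, -1:])) = \<dots>" .
    have "(\<Sum>t\<in>?T. (\<Prod>i\<in>?V. ?c i (t i)) * (?e A * (\<Prod>i\<in>?V. vertex_value n K s A i (q i - t i + 1)))) =
        ?e A * (\<Sum>t\<in>?T. (\<Prod>i\<in>?V. ?c i (t i)) * (\<Prod>i\<in>?V. vertex_value n K s A i (q i - t i + 1)))"
      unfolding sum_distrib_left by (rule sum.cong[OF refl]) (simp only: mult.left_commute)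
    then show ?thesis unfolding 1 2 type_denom_surface_type by (simp only: mult_ac)
  qed
  then have "(\<Sum>A\<in>?P. (\<Prod>e\<in>?E. fact (s e) / hook_content K (s e) (A e)) *
     (\<Prod>i\<in>?V. content_eval K (block_size n q s i)
        (([:1, 0, -1:] ^ q i * (\<Prod>k\<in>neighbours n s i. [:1, -1:] * monom 1 (sym_entry A i k))) div [:1, -1:]))) =
     (\<Sum>A\<in>?P. type_denom ?V (surface_type n q s) *
       (\<Sum>t\<in>?T. (\<Prod>i\<in>?V. ?c i (t i)) * (?e A * (\<Prod>i\<in>?V. vertex_value n K s A i (q i - t i + 1)))))"
    by (rule sum.cong[OF refl])
  also have "\<dots> = type_denom ?V (surface_type n q s) *
      (\<Sum>t\<in>?T. \<Sum>A\<in>?P. (\<Prod>i\<in>?V. ?c i (t i)) * (?e A * (\<Prod>i\<in>?V. vertex_value n K s A i (q i - t i + 1))))"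
    unfolding sum_distrib_left[symmetric] by (subst sum.swap) (simp only: sum_distrib_left)
  also have "\<dots> = type_denom ?V (surface_type n q s) * genus_formula n q s K"
    unfolding genus_formula_def vertical_value_def vertex_value_def sum_distrib_left ..
  finally show ?thesis unfolding atLeast0LessThan .
qed

text \<open>The averaged sum has the same value for every pairing, \<open>type_denom\<close> times
  the formula. Multiplied by the number of pairings, \<open>type_denom\<close> becomes the product
  of the factorials of the block sizes, which is the order of the group of block-preserving
  permutations and hence the factor introduced by averaging.\<close>

theorem poly_genus_series_eq:
  assumes n: "n \<ge> 1" and pos: "\<And>i. i \<in> {1..n} \<Longrightarrow> block_size n q s i > 0"
    and tree: "is_tree {1..n} (support_adj n s)" and K: "K \<ge> 1"
  shows "poly (genus_series n q s) (real K) = genus_formula n q s K"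
proof -
  define p where "p = block_size n q s"
  define S where "S = labelled_set n p"
  define \<gamma> where "\<gamma> = canonical_perm n p"
  let ?V = "{1..n}" and ?m = "surface_type n q s"
  let ?PS = "typed_pairings S ?m"
  have fS: "finite S" unfolding S_def by (rule finite_labelled_set)
  interpret network S fst n s by unfold_locales (rule fS)
  have ptsV: "pts ?V = S" unfolding pts_def by (auto simp: S_def labelled_set_def)
  have ptsi: "pts {i} = Pair i ` {1..p i}" if "i \<in> ?V" for i
    using that unfolding pts_def by (auto simp: S_def labelled_set_def)
  have cardi: "card (pts {i}) = p i" if "i \<in> ?V" for i
    unfolding ptsi[OF that] by (simp add: card_image inj_on_def)
  have nei: "pts {i} \<noteq> {}" if "i \<in> ?V" for i
    using cardi[OF that] pos[OF that] by (auto simp: p_def)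
  have Sne: "S \<noteq> {}" using nei[of 1] n by (auto simp: pts_def)
  have \<gamma>: "\<gamma> permutes S" "\<And>x. fst (\<gamma> x) = fst x" "\<And>i. i \<in> ?V \<Longrightarrow> cyclic_on \<gamma> (pts {i})"
    using canonical_perm_cycles[where n = n and p = p] pos ptsi by (simp_all add: \<gamma>_def S_def p_def)
  have p\<gamma>: "permutation \<gamma>" using \<gamma>(1) fS by (auto intro: permutes_imp_permutation)
  \<comment> \<open>The cycles to be conjugated are those of \<open>inv \<gamma>\<close>, since the
    pairing is composed with the inverse.\<close>
  have i\<gamma>: "inv \<gamma> \<in> blockperms ?V"
  proof -
    have "fst (inv \<gamma> x) = fst x" for x using \<gamma>(2)[of "inv \<gamma> x"] by (simp add: permutes_inverses[OF \<gamma>(1)])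
    then show ?thesis using permutes_inv[OF \<gamma>(1)] unfolding blockperms_def ptsV by simp
  qed
  have bc: "block_card S i = p i" if "i \<in> ?V" for i
    using cardi[OF that] by (simp add: block_card_def pts_def)
  have bcm: "block_card S i = (\<Sum>k\<in>?V. type_mult (pair_type i k) * ?m (pair_type i k))" if i: "i \<in> ?V" for i
  proof -
    have "(\<Sum>k\<in>?V. type_mult (pair_type i k) * ?m (pair_type i k)) =
        type_mult (pair_type i i) * ?m (pair_type i i) + (\<Sum>k\<in>?V - {i}. type_mult (pair_type i k) * ?m (pair_type i k))"
      by (rule sum.remove) (use i in auto)
    also have "(\<Sum>k\<in>?V - {i}. type_mult (pair_type i k) * ?m (pair_type i k)) = (\<Sum>k\<in>?V - {i}. sym_entry s i k)"
    proof (rule sum.cong[OF refl])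
      fix k assume k: "k \<in> ?V - {i}"
      then have "type_mult (pair_type i k) = 1" by (auto simp: type_mult_def pair_type_def min_def max_def)
      then show "type_mult (pair_type i k) * ?m (pair_type i k) = sym_entry s i k"
        using surface_type_pair[OF i, of k q s] k by auto
    qed
    also have "type_mult (pair_type i i) = 2" by (simp add: type_mult_def pair_type_def)
    finally show ?thesis
      using bc[OF i] surface_type_pair[OF i i, of q s] by (simp add: p_def block_size_def row_sum_def)
  qed
  have PSc: "real (card ?PS) * type_denom ?V ?m = (\<Prod>i\<in>?V. fact (p i))"
  proof -
    have "real (card ?PS) * type_denom ?V ?m = (\<Prod>i\<in>?V. fact (block_card S i))"
      by (rule card_typed_pairings[OF _ fS _ bcm]) (auto simp: S_def labelled_set_def surface_type_def)
    then show ?thesis using bc by simp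
  qed
  have leafy: "leafy (support_adj n s) ?V"
    by (rule is_tree_leafy[OF _ tree]) (use support_adj_sym in \<open>auto simp: support_adj_def\<close>)
  have comp: "compatible ?V (pairing_involution P)"
    and stay: "cycpoly (stay (pairing_involution P) i) (pairing_involution P) = [:1, 0, -1:] ^ q i"
    if P: "P \<in> ?PS" and i: "i \<in> ?V" for P i
  proof -
    let ?\<mu> = "pairing_involution P"
    have P': "P \<in> pairings S" and cnt: "\<And>e. card {B \<in> P. block_type B = e} = ?m e"
      using P unfolding typed_pairings_def by blast+
    have \<mu>: "?\<mu> permutes S" by (rule pairing_involution_permutes[OF P'])
    have \<mu>\<mu>: "?\<mu> (?\<mu> x) = x" for x by (rule pairing_involution_involutive[OF P'])
    have pb: "{x, ?\<mu> x} \<in> P" "?\<mu> x \<noteq> x" if x: "x \<in> S" for x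
      by (rule pairing_partner[OF P' x]; simp)+
    show "compatible ?V ?\<mu>"
      unfolding compatible_def ptsV
    proof (intro conjI ballI impI)
      show "?\<mu> permutes S" by (rule \<mu>)
      show "?\<mu> (?\<mu> x) = x" for x by (rule \<mu>\<mu>)
      fix i k assume ik: "i \<in> ?V" "k \<in> ?V" "i \<noteq> k"
      \<comment> \<open>A pair between two different blocks has exactly one point in block
        \<open>i\<close>.\<close>
      have "bij_betw (\<lambda>x. {x, ?\<mu> x}) {x \<in> pts {i}. fst (?\<mu> x) = k} {B \<in> P. block_type B = pair_type i k}"
      proof (rule bij_betwI')
        fix x y assume "x \<in> {x \<in> pts {i}. fst (?\<mu> x) = k}" "y \<in> {x \<in> pts {i}. fst (?\<mu> x) = k}"
        then show "{x, ?\<mu> x} = {y, ?\<mu> y} \<longleftrightarrow> x = y" using ik by (auto simp: doubleton_eq_iff pts_def)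
      next
        fix x assume "x \<in> {x \<in> pts {i}. fst (?\<mu> x) = k}"
        then show "{x, ?\<mu> x} \<in> {B \<in> P. block_type B = pair_type i k}"
          using pb(1)[of x] by (auto simp: pts_def block_type_pair)
      next
        fix B assume B: "B \<in> {B \<in> P. block_type B = pair_type i k}"
        obtain a b where ab: "a \<in> S" "b \<in> S" "B = {a, b}" "?\<mu> a = b" "?\<mu> b = a"
          by (rule pairing_block[OF P', of B]) (use B in auto)
        then consider "fst a = i" "fst b = k" | "fst a = k" "fst b = i"
          using B by (auto simp: block_type_pair pair_type_eq)
        then show "\<exists>x\<in>{x \<in> pts {i}. fst (?\<mu> x) = k}. B = {x, ?\<mu> x}"
        proof cases
          case 1
          then show ?thesis using ab by (intro bexI[of _ a]) (auto simp: pts_def)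
        next
          case 2
          then show ?thesis using ab by (intro bexI[of _ b]) (auto simp: pts_def)
        qed
      qed
      then show "card {x \<in> pts {i}. fst (?\<mu> x) = k} = sym_entry s i k"
        using cnt[of "pair_type i k"] surface_type_pair[OF ik(1,2), of q s] ik(3) by (simp add: bij_betw_same_card)
    qed
    let ?Q = "{B \<in> P. block_type B = pair_type i i}"
    have "stay ?\<mu> i = \<Union>?Q"
    proof
      show "stay ?\<mu> i \<subseteq> \<Union>?Q"
      proof
        fix x assume "x \<in> stay ?\<mu> i"
        then have "x \<in> S" "fst x = i" "fst (?\<mu> x) = i" by (auto simp: stay_def pts_def)
        then have "{x, ?\<mu> x} \<in> ?Q" using pb(1)[of x] by (simp add: block_type_pair)
        then show "x \<in> \<Union>?Q" by blast
      qed
      show "\<Union>?Q \<subseteq> stay ?\<mu> i"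
      proof
        fix x assume "x \<in> \<Union>?Q"
        then obtain B where B: "B \<in> P" "block_type B = pair_type i i" "x \<in> B" by blast
        obtain a b where "a \<in> S" "b \<in> S" "B = {a, b}" "?\<mu> a = b" "?\<mu> b = a"
          by (rule pairing_block[OF P' B(1)])
        then show "x \<in> stay ?\<mu> i" using B(2,3)
          by (auto simp: stay_def pts_def block_type_pair pair_type_eq)
      qed
    qed
    moreover have "cycpoly (\<Union>?Q) ?\<mu> = [:1, 0, -1:] ^ card ?Q"
    proof (rule cycpoly_pairing)
      show "finite ?Q" using finite_pairing[OF fS P'] by simp
      show "inj ?\<mu>" by (rule permutes_inj[OF \<mu>])
      show "pairwise disjnt ?Q" using P' by (auto simp: pairings_def partition_on_def intro: pairwise_subset)
      fix B assume B: "B \<in> ?Q"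
      obtain a b where "a \<noteq> b" "B = {a, b}" "?\<mu> a = b" "?\<mu> b = a"
        by (rule pairing_block[OF P', of B]) (use B in auto)
      then show "\<exists>x y. x \<noteq> y \<and> B = {x, y} \<and> ?\<mu> x = y \<and> ?\<mu> y = x" by blast
    qed
    ultimately show "cycpoly (stay ?\<mu> i) ?\<mu> = [:1, 0, -1:] ^ q i"
      using cnt[of "pair_type i i"] surface_type_pair[OF i i, of q s] by simp
  qed
  have val: "netsum K ?V (pairing_involution P) = type_denom ?V ?m * genus_formula n q s K" if P: "P \<in> ?PS" for P
  proof -
    have c: "compatible ?V (pairing_involution P)" using comp[OF P, of 1] n by simp
    have "netsum K ?V (pairing_involution P) = netval K ?V (pairing_involution P)"
      by (rule netsum_eq_netval[OF leafy _ c _ K]) (use nei in auto)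
    also have "\<dots> = (\<Sum>A\<in>PiE (support_edges n s) (\<lambda>e. {..<min (s e) K}).
       (\<Prod>e\<in>support_edges n s. fact (s e) / hook_content K (s e) (A e)) *
       (\<Prod>i\<in>?V. content_eval K (block_size n q s i)
        (([:1, 0, -1:] ^ q i * (\<Prod>k\<in>neighbours n s i. [:1, -1:] * monom 1 (sym_entry A i k))) div [:1, -1:])))"
    proof -
      have e: "edges ?V = support_edges n s" by (auto simp: edges_def support_edges_def support_adj_def)
      have nb: "nbrs ?V i = neighbours n s i" for i by (auto simp: nbrs_def neighbours_def support_adj_def)
      have "(\<Prod>i\<in>?V. content_eval K (card (pts {i})) (vertex_poly ?V (pairing_involution P) A i)) =
          (\<Prod>i\<in>?V. content_eval K (block_size n q s i)
        (([:1, 0, -1:] ^ q i * (\<Prod>k\<in>neighbours n s i. [:1, -1:] * monom 1 (sym_entry A i k))) div [:1, -1:]))" for A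
        by (rule prod.cong[OF refl]) (simp only: vertex_poly_def nb stay[OF P] cardi p_def)
      then show ?thesis unfolding netval_def e by (simp only:)
    qed
    also have "\<dots> = type_denom ?V ?m * genus_formula n q s K"
      by (rule genus_formula_network[OF pos K])
    finally show ?thesis .
  qed
  let ?A = "\<Sum>P\<in>?PS. real (ncol K S (pairing_involution P \<circ> inv \<gamma>))"
  \<comment> \<open>Conjugating \<open>inv \<gamma>\<close> by \<open>inv t\<close> amounts to
    carrying the pairing along \<open>t\<close> to another one of the same type, so every
    \<open>t\<close> yields the whole sum \<open>?A\<close>.\<close>
  have "real (card (blockperms ?V)) * ?A = (\<Sum>t\<in>blockperms ?V. \<Sum>P\<in>?PS. real (ncol K S (pairing_involution P \<circ> (inv t \<circ> inv \<gamma> \<circ> t))))"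
  proof -
    have "(\<Sum>P\<in>?PS. real (ncol K S (pairing_involution P \<circ> (inv t \<circ> inv \<gamma> \<circ> t)))) = ?A" if t: "t \<in> blockperms ?V" for t
    proof -
      have tp: "t permutes S" "\<And>x. fst (t x) = fst x" using t unfolding blockperms_def ptsV by auto
      have "(\<Sum>P\<in>?PS. real (ncol K S (pairing_involution P \<circ> (inv t \<circ> inv \<gamma> \<circ> t)))) =
          (\<Sum>P\<in>?PS. real (ncol K S (pairing_involution ((`) t ` P) \<circ> inv \<gamma>)))"
      proof (rule sum.cong[OF refl])
        fix P assume "P \<in> ?PS"
        then have P: "P \<in> pairings S" unfolding typed_pairings_def by blast
        have \<pi>: "pairing_involution P \<circ> (inv t \<circ> inv \<gamma> \<circ> t) permutes S"
          by (intro permutes_compose permutes_inv pairing_involution_permutes[OF P] tp \<gamma>(1))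
        have "pairing_involution ((`) t ` P) \<circ> inv \<gamma> = t \<circ> (pairing_involution P \<circ> (inv t \<circ> inv \<gamma> \<circ> t)) \<circ> inv t"
          unfolding image_pairing(2)[OF P tp(1)]
          by (simp add: fun_eq_iff permutes_inverses[OF tp(1)])
        then show "real (ncol K S (pairing_involution P \<circ> (inv t \<circ> inv \<gamma> \<circ> t))) =
            real (ncol K S (pairing_involution ((`) t ` P) \<circ> inv \<gamma>))"
          using ncol_conj_permutes[OF tp(1) \<pi>, of K] by (simp only:)
      qed
      also have "\<dots> = ?A" by (rule sum_image_typed_pairing[OF tp])
      finally show ?thesis .
    qed
    then show ?thesis by simp
  qed
  also have "\<dots> = (\<Sum>P\<in>?PS. \<Sum>t\<in>blockperms ?V. real (ncol K S (pairing_involution P \<circ> (inv t \<circ> inv \<gamma> \<circ> t))))"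
    by (rule sum.swap)
  also have "\<dots> = (\<Sum>P\<in>?PS. netsum K ?V (pairing_involution P))"
  proof (rule sum.cong[OF refl])
    fix P
    have "(\<Sum>t\<in>blockperms ?V. real (ncol K S (pairing_involution P \<circ> (inv t \<circ> inv \<gamma> \<circ> t)))) =
        (\<Sum>\<beta>\<in>blockperms ?V. block_weight ?V \<beta> * real (ncol K S (pairing_involution P \<circ> \<beta>)))"
      by (rule sum_blockperms_conj[OF _ i\<gamma>]) (use \<gamma>(3) cyclic_on_inv[OF p\<gamma>] in auto)
    then show "(\<Sum>t\<in>blockperms ?V. real (ncol K S (pairing_involution P \<circ> (inv t \<circ> inv \<gamma> \<circ> t)))) =
        netsum K ?V (pairing_involution P)"
      by (simp only: netsum_def ptsV)
  qed
  also have "\<dots> = real (card ?PS) * type_denom ?V ?m * genus_formula n q s K"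
    using val by simp
  also have "\<dots> = real (card (blockperms ?V)) * genus_formula n q s K"
    unfolding PSc card_blockperms[OF finite_atLeastAtMost]
    by (rule arg_cong2[where f = "(*)"]) (use cardi in \<open>auto intro: prod.cong\<close>)
  finally have "real (card (blockperms ?V)) * ?A = real (card (blockperms ?V)) * genus_formula n q s K" .
  moreover have "real (card (blockperms ?V)) \<noteq> 0"
    unfolding card_blockperms[OF finite_atLeastAtMost] by simp
  ultimately have "?A = genus_formula n q s K" by simp
  then show ?thesis
    using poly_genus_series[of n q s K] Sne by (simp only: paired_surfaces_eq S_def p_def \<gamma>_def not_False_eq_True)
qed


lemma poly_eq_on_naturals:
  fixes P Q :: "real poly"
  assumes "\<And>K::nat. K \<ge> 1 \<Longrightarrow> poly P (real K) = poly Q (real K)"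
  shows "P = Q"
proof (rule ccontr)
  assume "P \<noteq> Q"
  then have "finite {x. poly (P - Q) x = 0}" by (intro poly_roots_finite) simp
  moreover have "real ` {1..} \<subseteq> {x. poly (P - Q) x = 0}" using assms by auto
  ultimately have "finite (real ` {1..})" by (rule finite_subset[rotated])
  then show False by (auto dest!: finite_imageD simp: infinite_Ici)
qed

theorem theorem1p1:
  fixes n :: nat and q :: "nat \<Rightarrow> nat" and s :: "nat \<times> nat \<Rightarrow> nat"
  assumes "n \<ge> 1"
    and "\<And>i. i \<in> {1..n} \<Longrightarrow> block_size n q s i > 0"
    and "is_tree {1..n} (support_adj n s)"
  shows "(\<forall>K::nat. K \<ge> 1 \<longrightarrow> poly (genus_series n q s) (of_nat K) = genus_formula n q s K) \<and>
    (\<exists>P :: real poly. \<forall>K::nat. K \<ge> 1 \<longrightarrow> genus_formula n q s K = poly P (of_nat K)) \<and>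
    (\<forall>P :: real poly. (\<forall>K::nat. K \<ge> 1 \<longrightarrow> genus_formula n q s K = poly P (of_nat K))
       \<longrightarrow> P = genus_series n q s)"
proof (intro conjI allI impI)
  have eq: "poly (genus_series n q s) (real K) = genus_formula n q s K" if "K \<ge> 1" for K
    by (rule poly_genus_series_eq[OF assms that])
  then show "poly (genus_series n q s) (real K) = genus_formula n q s K" if "K \<ge> 1" for K
    using that .
  \<comment> \<open>The genus series is the witness: polynomiality comes from the identity, not from
    the shape of the formula, whose summation range depends on \<open>K\<close>.\<close>
  show "\<exists>P :: real poly. \<forall>K::nat. K \<ge> 1 \<longrightarrow> genus_formula n q s K = poly P (of_nat K)"
    using eq by (intro exI[of _ "genus_series n q s"]) simp
  fix P :: "real poly"
  assume "\<forall>K::nat. K \<ge> 1 \<longrightarrow> genus_formula n q s K = poly P (of_nat K)"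
  then show "P = genus_series n q s" using eq by (intro poly_eq_on_naturals) simp
qed

end
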